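(* Let $R$ be a commutative Noetherian local ring and let $\mathfrak{q} \in \operatorname{Spec}(R)$. Consider the following properties: (i) The injective hull $E(R/\mathfrak{q})$ of the $R$-module $R/\mathfrak{q}$ is simple divisible as an $R$-module. (ii) The local ring $R_{\mathfrak{q}}$ is analytically irreducible and essentially complete. Then (i) implies (ii). If the canonical map $R \to R_{\mathfrak{q}}$ is injective, then also (ii) implies (i).
   Context: An $R$-module $N$ is divisible if $rN = N$ for every non-zero-divisor $r \in R$. $N$ is called simple divisible if $N$ is divisible, $N \neq 0$, and every submodule $0 \neq V \subsetneq N$ is not divisible. A Noetherian local ring $A$ with completion $\widehat{A}$ (with respect to its maximal ideal) is analytically irreducible if $\widehat{A}$ is an integral domain. It is essentially complete if for every ideal $I$ of $\widehat{A}$ that is essential in $\widehat{A}$ (i.e. meets every nonzero ideal of $\widehat{A}$ nontrivially) the contraction $I \cap A$ is an essential ideal of $A$; when $\widehat{A}$ is a domain, this means: $Q \in \operatorname{Spec}(\widehat{A})$ and $Q \cap A = 0$ imply $Q = 0$. *)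

theory Defs
  imports "HOL-Algebra.Module" "HOL-Algebra.Ideal_Product" "HOL-Algebra.Ring_Divisibility"
begin

definition module_homs ::
  "('a, 'r) ring_scheme \<Rightarrow> ('a, 'm, 'x) module_scheme \<Rightarrow> ('a, 'n, 'y) module_scheme \<Rightarrow> ('m \<Rightarrow> 'n) set"
  where "module_homs R M N =
    {f \<in> carrier M \<rightarrow> carrier N.
       (\<forall>x \<in> carrier M. \<forall>y \<in> carrier M. f (x \<oplus>\<^bsub>M\<^esub> y) = f x \<oplus>\<^bsub>N\<^esub> f y) \<and>
       (\<forall>r \<in> carrier R. \<forall>x \<in> carrier M. f (r \<odot>\<^bsub>M\<^esub> x) = r \<odot>\<^bsub>N\<^esub> f x)}"

text \<open>
  A definition cannot quantify over types, so the test modules \<open>M \<rightarrow> N\<close> below have their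
  elements in the type \<^typ>\<open>'a\<close> of the ring.  This is no restriction: by the argument of Baer's
  criterion the extension property then holds for modules over arbitrary types, see
  \<open>injective_module_extend\<close> below.
\<close>

definition injective_module :: "('a, 'r) ring_scheme \<Rightarrow> ('a, 'e, 'x) module_scheme \<Rightarrow> bool"
  where "injective_module R E \<longleftrightarrow> module R E \<and>
    (\<forall>(M :: ('a, 'a) module) (N :: ('a, 'a) module) f g.
       module R M \<and> module R N \<and> f \<in> module_homs R M N \<and> inj_on f (carrier M) \<and> g \<in> module_homs R M E
       \<longrightarrow> (\<exists>h \<in> module_homs R N E. \<forall>x \<in> carrier M. h (f x) = g x))"

definition ideal_module :: "('a, 'r) ring_scheme \<Rightarrow> 'a set \<Rightarrow> ('a, 'a) module"
  where "ideal_module R I =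
    \<lparr>carrier = I, monoid.mult = (\<otimes>\<^bsub>R\<^esub>), one = \<one>\<^bsub>R\<^esub>,
     ring.zero = \<zero>\<^bsub>R\<^esub>, add = (\<oplus>\<^bsub>R\<^esub>), smult = (\<otimes>\<^bsub>R\<^esub>)\<rparr>"

lemma (in cring) ideal_module_module:
  assumes "ideal I R"
  shows "module R (ideal_module R I)"
proof -
  interpret I: ideal I R by fact
  have sub: "x \<in> carrier R" if "x \<in> I" for x using that I.Icarr by blast
  show ?thesis
  proof (rule moduleI)
    show "cring R" by (rule is_cring)
    show "abelian_group (ideal_module R I)"
      by (rule abelian_groupI)
        (auto simp: ideal_module_def sub a_ac l_neg r_neg intro!: bexI[of _ "\<ominus> _"])
  qed (auto simp: ideal_module_def sub I.I_l_closed l_distr r_distr m_assoc)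
qed

lemma module_homs_zero:
  assumes M: "module R M" and N: "module R N" and f: "f \<in> module_homs R M N"
  shows "f \<zero>\<^bsub>M\<^esub> = \<zero>\<^bsub>N\<^esub>"
proof -
  interpret M: module R M by (rule M)
  have "f \<zero>\<^bsub>M\<^esub> \<in> carrier N" "f (\<zero>\<^bsub>R\<^esub> \<odot>\<^bsub>M\<^esub> \<zero>\<^bsub>M\<^esub>) = \<zero>\<^bsub>R\<^esub> \<odot>\<^bsub>N\<^esub> f \<zero>\<^bsub>M\<^esub>"
    using f M.M.zero_closed M.R.zero_closed unfolding module_homs_def by blast+
  then show ?thesis
    using M.smult_l_null[OF M.M.zero_closed] module.smult_l_null[OF N] by simp
qed

lemma injective_module_extend:
  fixes R :: "('a, 'r) ring_scheme" and E :: "('a, 'e, 'x) module_scheme"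
    and M :: "('a, 'm, 'y) module_scheme" and N :: "('a, 'n, 'z) module_scheme"
  assumes inj: "injective_module R E"
    and M: "module R M" and N: "module R N"
    and f: "f \<in> module_homs R M N" and f_inj: "inj_on f (carrier M)" and g: "g \<in> module_homs R M E"
  shows "\<exists>h \<in> module_homs R N E. \<forall>x \<in> carrier M. h (f x) = g x"
proof -
  interpret E: module R E using inj by (simp add: injective_module_def)
  interpret M: module R M by (rule M)
  interpret N: module R N by (rule N)
  define closed where "closed G \<longleftrightarrow> G \<subseteq> carrier N \<times> carrier E \<and>
      (\<forall>x y x' y'. (x, y) \<in> G \<longrightarrow> (x', y') \<in> G \<longrightarrow> (x \<oplus>\<^bsub>N\<^esub> x', y \<oplus>\<^bsub>E\<^esub> y') \<in> G) \<and>
      (\<forall>r x y. r \<in> carrier R \<longrightarrow> (x, y) \<in> G \<longrightarrow> (r \<odot>\<^bsub>N\<^esub> x, r \<odot>\<^bsub>E\<^esub> y) \<in> G) \<and>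
      (\<forall>y. (\<zero>\<^bsub>N\<^esub>, y) \<in> G \<longrightarrow> y = \<zero>\<^bsub>E\<^esub>)" for G
  define G0 where "G0 = (\<lambda>x. (f x, g x)) ` carrier M"
  define F where "F = {G. closed G \<and> G0 \<subseteq> G}"
  have f0: "f \<zero>\<^bsub>M\<^esub> = \<zero>\<^bsub>N\<^esub>" using module_homs_zero[OF M] f N by blast
  have g0: "g \<zero>\<^bsub>M\<^esub> = \<zero>\<^bsub>E\<^esub>" using module_homs_zero[OF M] g E.module_axioms by blast
  have "closed G0"
    unfolding closed_def
  proof (intro conjI allI impI)
    show "G0 \<subseteq> carrier N \<times> carrier E" using f g by (auto simp: G0_def module_homs_def)
  next
    fix x y x' y' assume "(x, y) \<in> G0" "(x', y') \<in> G0"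
    then obtain u v where uv: "u \<in> carrier M" "v \<in> carrier M"
      and [simp]: "x = f u" "y = g u" "x' = f v" "y' = g v" by (auto simp: G0_def)
    then have "(x \<oplus>\<^bsub>N\<^esub> x', y \<oplus>\<^bsub>E\<^esub> y') = (f (u \<oplus>\<^bsub>M\<^esub> v), g (u \<oplus>\<^bsub>M\<^esub> v))"
      using f g by (simp add: module_homs_def)
    then show "(x \<oplus>\<^bsub>N\<^esub> x', y \<oplus>\<^bsub>E\<^esub> y') \<in> G0" using uv unfolding G0_def by blast
  next
    fix r x y assume r: "r \<in> carrier R" and "(x, y) \<in> G0"
    then obtain u where u: "u \<in> carrier M" and [simp]: "x = f u" "y = g u" by (auto simp: G0_def)
    then have "(r \<odot>\<^bsub>N\<^esub> x, r \<odot>\<^bsub>E\<^esub> y) = (f (r \<odot>\<^bsub>M\<^esub> u), g (r \<odot>\<^bsub>M\<^esub> u))"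
      using f g r by (simp add: module_homs_def)
    then show "(r \<odot>\<^bsub>N\<^esub> x, r \<odot>\<^bsub>E\<^esub> y) \<in> G0" using u r unfolding G0_def by blast
  next
    fix y assume "(\<zero>\<^bsub>N\<^esub>, y) \<in> G0"
    then obtain x where x: "x \<in> carrier M" "f x = \<zero>\<^bsub>N\<^esub>" "y = g x" by (auto simp: G0_def)
    then have "x = \<zero>\<^bsub>M\<^esub>" using f_inj f0 by (metis inj_onD M.M.zero_closed)
    then show "y = \<zero>\<^bsub>E\<^esub>" using x g0 by simp
  qed
  then have "G0 \<in> F" by (simp add: F_def)
  have "\<exists>G \<in> F. \<forall>G' \<in> F. G \<subseteq> G' \<longrightarrow> G' = G"
  proof (rule subset_Zorn_nonempty)
    show "F \<noteq> {}" using \<open>G0 \<in> F\<close> by blast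
  next
    fix C assume "C \<noteq> {}" and C: "subset.chain F C"
    then have CF: "\<And>G. G \<in> C \<Longrightarrow> closed G \<and> G0 \<subseteq> G"
      and lin: "\<And>G H. G \<in> C \<Longrightarrow> H \<in> C \<Longrightarrow> G \<subseteq> H \<or> H \<subseteq> G"
      by (auto simp: subset_chain_def F_def)
    have "closed (\<Union>C)"
      unfolding closed_def
    proof (intro conjI allI impI)
      show "\<Union>C \<subseteq> carrier N \<times> carrier E" using CF unfolding closed_def by blast
    next
      fix x y x' y' assume "(x, y) \<in> \<Union>C" "(x', y') \<in> \<Union>C"
      then obtain G where "G \<in> C" "(x, y) \<in> G" "(x', y') \<in> G" using lin by blast
      moreover from this have "(x \<oplus>\<^bsub>N\<^esub> x', y \<oplus>\<^bsub>E\<^esub> y') \<in> G"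
        using CF[of G] unfolding closed_def by blast
      ultimately show "(x \<oplus>\<^bsub>N\<^esub> x', y \<oplus>\<^bsub>E\<^esub> y') \<in> \<Union>C" by blast
    next
      fix r x y assume "r \<in> carrier R" "(x, y) \<in> \<Union>C"
      then show "(r \<odot>\<^bsub>N\<^esub> x, r \<odot>\<^bsub>E\<^esub> y) \<in> \<Union>C" using CF unfolding closed_def by blast
    next
      fix y assume "(\<zero>\<^bsub>N\<^esub>, y) \<in> \<Union>C"
      then show "y = \<zero>\<^bsub>E\<^esub>" using CF unfolding closed_def by blast
    qed
    moreover have "G0 \<subseteq> \<Union>C" using \<open>C \<noteq> {}\<close> CF by blast
    ultimately show "\<Union>C \<in> F" by (simp add: F_def)
  qed
  then obtain G where "G \<in> F" and G_max: "\<forall>G' \<in> F. G \<subseteq> G' \<longrightarrow> G' = G" by blast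
  then have "closed G" and "G0 \<subseteq> G" by (simp_all add: F_def)
  have max: "G' = G" if "closed G'" "G \<subseteq> G'" for G'
    using that G_max \<open>G0 \<subseteq> G\<close> by (auto simp: F_def)
  note cl = \<open>closed G\<close>[unfolded closed_def]
  have G_carr: "x \<in> carrier N \<and> y \<in> carrier E" if "(x, y) \<in> G" for x y
    using cl that by blast
  have G_add: "(x \<oplus>\<^bsub>N\<^esub> x', y \<oplus>\<^bsub>E\<^esub> y') \<in> G" if "(x, y) \<in> G" "(x', y') \<in> G" for x y x' y'
    using cl that by simp
  have G_smult: "(r \<odot>\<^bsub>N\<^esub> x, r \<odot>\<^bsub>E\<^esub> y) \<in> G" if "r \<in> carrier R" "(x, y) \<in> G" for r x y
    using cl that by simp
  have G_zero: "y = \<zero>\<^bsub>E\<^esub>" if "(\<zero>\<^bsub>N\<^esub>, y) \<in> G" for y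
    using cl that by simp
  have G_neg: "(\<ominus>\<^bsub>N\<^esub> x, \<ominus>\<^bsub>E\<^esub> y) \<in> G" if "(x, y) \<in> G" for x y
    using G_smult[of "\<ominus>\<^bsub>R\<^esub> \<one>\<^bsub>R\<^esub>", OF _ that] G_carr[OF that] N.smult_l_minus E.smult_l_minus by simp
  have G_fun: "y = y'" if "(x, y) \<in> G" "(x, y') \<in> G" for x y y'
  proof -
    have "(x \<oplus>\<^bsub>N\<^esub> \<ominus>\<^bsub>N\<^esub> x, y \<oplus>\<^bsub>E\<^esub> \<ominus>\<^bsub>E\<^esub> y') \<in> G" using that G_add G_neg by blast
    then have "y \<oplus>\<^bsub>E\<^esub> \<ominus>\<^bsub>E\<^esub> y' = \<zero>\<^bsub>E\<^esub>" using G_zero G_carr[OF that(1)] N.M.r_neg by simp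
    then have "y = \<ominus>\<^bsub>E\<^esub> (\<ominus>\<^bsub>E\<^esub> y')"
      using G_carr[OF that(1)] G_carr[OF that(2)] E.M.minus_equality by (metis E.M.a_inv_closed)
    then show ?thesis using G_carr[OF that(2)] by simp
  qed
  have zero_G: "(\<zero>\<^bsub>N\<^esub>, \<zero>\<^bsub>E\<^esub>) \<in> G"
    using \<open>G0 \<subseteq> G\<close> f0 g0 M.M.zero_closed unfolding G0_def by (metis image_subset_iff)
  have total: "\<exists>y. (n, y) \<in> G" if n: "n \<in> carrier N" for n
  proof -
    define I where "I = {r \<in> carrier R. \<exists>y. (r \<odot>\<^bsub>N\<^esub> n, y) \<in> G}"
    have I: "ideal I R"
    proof (rule idealI)
      show "subgroup I (add_monoid R)"
      proof (rule E.R.add.subgroupI)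
        show "I \<subseteq> carrier R" by (auto simp: I_def)
        have "\<zero>\<^bsub>R\<^esub> \<in> I" using zero_G n by (auto simp: I_def N.smult_l_null)
        then show "I \<noteq> {}" by blast
      next
        fix a assume "a \<in> I" then show "\<ominus>\<^bsub>R\<^esub> a \<in> I"
          using G_neg n by (auto simp: I_def N.smult_l_minus)
      next
        fix a b assume "a \<in> I" "b \<in> I" then show "a \<oplus>\<^bsub>R\<^esub> b \<in> I"
          using G_add n by (fastforce simp: I_def N.smult_l_distr)
      qed
    next
      fix a r assume ar: "a \<in> I" "r \<in> carrier R"
      then obtain y where "a \<in> carrier R" "(a \<odot>\<^bsub>N\<^esub> n, y) \<in> G" by (auto simp: I_def)
      then show "r \<otimes>\<^bsub>R\<^esub> a \<in> I"
        using G_smult[OF ar(2)] ar n by (auto simp: I_def N.smult_assoc1)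
      then show "a \<otimes>\<^bsub>R\<^esub> r \<in> I" using ar \<open>a \<in> carrier R\<close> E.R.m_comm by simp
    qed (rule E.R.ring_axioms)
    define p where "p r = (THE y. (r \<odot>\<^bsub>N\<^esub> n, y) \<in> G)" for r
    have p: "p r = y" if "(r \<odot>\<^bsub>N\<^esub> n, y) \<in> G" for r y
      unfolding p_def using that G_fun by blast
    have pG: "(r \<odot>\<^bsub>N\<^esub> n, p r) \<in> G" if "r \<in> I" for r
      using that p unfolding I_def by blast
    have I_carr: "r \<in> carrier R" if "r \<in> I" for r using that by (simp add: I_def)
    have "p \<in> module_homs R (ideal_module R I) E"
      unfolding module_homs_def
    proof (intro CollectI conjI ballI)
      show "p \<in> carrier (ideal_module R I) \<rightarrow> carrier E"
        using pG G_carr by (auto simp: ideal_module_def)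
    next
      fix a b assume "a \<in> carrier (ideal_module R I)" "b \<in> carrier (ideal_module R I)"
      then have "a \<in> I" "b \<in> I" by (simp_all add: ideal_module_def)
      then show "p (a \<oplus>\<^bsub>ideal_module R I\<^esub> b) = p a \<oplus>\<^bsub>E\<^esub> p b"
        using G_add[OF pG pG, of a b] n I_carr by (intro p) (simp add: ideal_module_def N.smult_l_distr)
    next
      fix r a assume "r \<in> carrier R" "a \<in> carrier (ideal_module R I)"
      then have "r \<in> carrier R" "a \<in> I" by (simp_all add: ideal_module_def)
      then show "p (r \<odot>\<^bsub>ideal_module R I\<^esub> a) = r \<odot>\<^bsub>E\<^esub> p a"
        using G_smult[OF _ pG, of r a] n I_carr by (intro p) (simp add: ideal_module_def N.smult_assoc1)
    qed
    moreover have "id \<in> module_homs R (ideal_module R I) (ideal_module R (carrier R))"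
      using I_carr by (auto simp: module_homs_def ideal_module_def)
    moreover have "module R (ideal_module R I)" "module R (ideal_module R (carrier R))"
      using E.R.ideal_module_module I E.R.oneideal by blast+
    ultimately obtain h where h: "h \<in> module_homs R (ideal_module R (carrier R)) E"
      and hp: "\<forall>r \<in> carrier (ideal_module R I). h (id r) = p r"
      using inj inj_on_id unfolding injective_module_def by meson
    define e where "e = h \<one>\<^bsub>R\<^esub>"
    have e: "e \<in> carrier E" using h by (auto simp: e_def module_homs_def ideal_module_def)
    have h_eq: "h r = r \<odot>\<^bsub>E\<^esub> e" if "r \<in> carrier R" for r
    proof -
      have "\<forall>s \<in> carrier R. \<forall>x \<in> carrier R. h (s \<otimes>\<^bsub>R\<^esub> x) = s \<odot>\<^bsub>E\<^esub> h x"
        using h by (simp add: module_homs_def ideal_module_def)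
      then have "h (r \<otimes>\<^bsub>R\<^esub> \<one>\<^bsub>R\<^esub>) = r \<odot>\<^bsub>E\<^esub> e"
        unfolding e_def using that E.R.one_closed by blast
      then show ?thesis using that by simp
    qed
    define G' where "G' = {(x \<oplus>\<^bsub>N\<^esub> r \<odot>\<^bsub>N\<^esub> n, y \<oplus>\<^bsub>E\<^esub> r \<odot>\<^bsub>E\<^esub> e) | x y r. (x, y) \<in> G \<and> r \<in> carrier R}"
    have "closed G'"
      unfolding closed_def
    proof (intro conjI allI impI)
      show "G' \<subseteq> carrier N \<times> carrier E"
        unfolding G'_def using G_carr n e by auto
    next
      fix x1 y1 x2 y2 assume "(x1, y1) \<in> G'" "(x2, y2) \<in> G'"
      then obtain x y r x' y' s where *: "(x, y) \<in> G" "r \<in> carrier R" "(x', y') \<in> G" "s \<in> carrier R"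
        "x1 = x \<oplus>\<^bsub>N\<^esub> r \<odot>\<^bsub>N\<^esub> n" "y1 = y \<oplus>\<^bsub>E\<^esub> r \<odot>\<^bsub>E\<^esub> e"
        "x2 = x' \<oplus>\<^bsub>N\<^esub> s \<odot>\<^bsub>N\<^esub> n" "y2 = y' \<oplus>\<^bsub>E\<^esub> s \<odot>\<^bsub>E\<^esub> e"
        unfolding G'_def by blast
      have "x1 \<oplus>\<^bsub>N\<^esub> x2 = (x \<oplus>\<^bsub>N\<^esub> x') \<oplus>\<^bsub>N\<^esub> (r \<oplus>\<^bsub>R\<^esub> s) \<odot>\<^bsub>N\<^esub> n"
        using * G_carr n by (simp add: N.smult_l_distr N.M.a_ac)
      moreover have "y1 \<oplus>\<^bsub>E\<^esub> y2 = (y \<oplus>\<^bsub>E\<^esub> y') \<oplus>\<^bsub>E\<^esub> (r \<oplus>\<^bsub>R\<^esub> s) \<odot>\<^bsub>E\<^esub> e"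
        using * G_carr e by (simp add: E.smult_l_distr E.M.a_ac)
      ultimately show "(x1 \<oplus>\<^bsub>N\<^esub> x2, y1 \<oplus>\<^bsub>E\<^esub> y2) \<in> G'"
        unfolding G'_def using * G_add by blast
    next
      fix s x1 y1 assume s: "s \<in> carrier R" and "(x1, y1) \<in> G'"
      then obtain x y r where *: "(x, y) \<in> G" "r \<in> carrier R"
        "x1 = x \<oplus>\<^bsub>N\<^esub> r \<odot>\<^bsub>N\<^esub> n" "y1 = y \<oplus>\<^bsub>E\<^esub> r \<odot>\<^bsub>E\<^esub> e"
        unfolding G'_def by blast
      have "s \<odot>\<^bsub>N\<^esub> x1 = s \<odot>\<^bsub>N\<^esub> x \<oplus>\<^bsub>N\<^esub> (s \<otimes>\<^bsub>R\<^esub> r) \<odot>\<^bsub>N\<^esub> n"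
        using * s G_carr n by (simp add: N.smult_r_distr N.smult_assoc1)
      moreover have "s \<odot>\<^bsub>E\<^esub> y1 = s \<odot>\<^bsub>E\<^esub> y \<oplus>\<^bsub>E\<^esub> (s \<otimes>\<^bsub>R\<^esub> r) \<odot>\<^bsub>E\<^esub> e"
        using * s G_carr e by (simp add: E.smult_r_distr E.smult_assoc1)
      ultimately show "(s \<odot>\<^bsub>N\<^esub> x1, s \<odot>\<^bsub>E\<^esub> y1) \<in> G'"
        unfolding G'_def using * s G_smult E.R.m_closed by blast
    next
      fix w assume "(\<zero>\<^bsub>N\<^esub>, w) \<in> G'"
      then obtain x y r where *: "(x, y) \<in> G" "r \<in> carrier R"
        "\<zero>\<^bsub>N\<^esub> = x \<oplus>\<^bsub>N\<^esub> r \<odot>\<^bsub>N\<^esub> n" "w = y \<oplus>\<^bsub>E\<^esub> r \<odot>\<^bsub>E\<^esub> e"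
        unfolding G'_def by blast
      have xc: "x \<in> carrier N" and yc: "y \<in> carrier E" using G_carr * by blast+
      have "r \<odot>\<^bsub>N\<^esub> n = \<ominus>\<^bsub>N\<^esub> x"
        using *(2,3) xc n by (metis N.M.minus_equality N.M.a_comm N.smult_closed)
      then have rG: "(r \<odot>\<^bsub>N\<^esub> n, \<ominus>\<^bsub>E\<^esub> y) \<in> G" using G_neg[OF *(1)] by simp
      then have "r \<in> I" using * by (auto simp: I_def)
      then have "r \<odot>\<^bsub>E\<^esub> e = \<ominus>\<^bsub>E\<^esub> y"
        using hp h_eq[OF *(2)] p[OF rG] by (simp add: ideal_module_def)
      then show "w = \<zero>\<^bsub>E\<^esub>" using * yc E.M.r_neg by simp
    qed
    moreover have "G \<subseteq> G'"
    proof
      fix z assume z: "z \<in> G"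
      obtain x y where [simp]: "z = (x, y)" by (cases z)
      have "z = (x \<oplus>\<^bsub>N\<^esub> \<zero>\<^bsub>R\<^esub> \<odot>\<^bsub>N\<^esub> n, y \<oplus>\<^bsub>E\<^esub> \<zero>\<^bsub>R\<^esub> \<odot>\<^bsub>E\<^esub> e)"
        using z G_carr n e by (auto simp: N.smult_l_null E.smult_l_null)
      then show "z \<in> G'" unfolding G'_def using z E.R.zero_closed by auto
    qed
    ultimately have "G' = G" by (rule max)
    moreover have "(\<zero>\<^bsub>N\<^esub> \<oplus>\<^bsub>N\<^esub> \<one>\<^bsub>R\<^esub> \<odot>\<^bsub>N\<^esub> n, \<zero>\<^bsub>E\<^esub> \<oplus>\<^bsub>E\<^esub> \<one>\<^bsub>R\<^esub> \<odot>\<^bsub>E\<^esub> e) \<in> G'"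
      unfolding G'_def using zero_G E.R.one_closed by blast
    ultimately show ?thesis using n by auto
  qed
  define h where "h n = (THE y. (n, y) \<in> G)" for n
  have h: "h n = y" if "(n, y) \<in> G" for n y
    unfolding h_def using that G_fun by blast
  have hG: "(n, h n) \<in> G" if "n \<in> carrier N" for n
    using total[OF that] h by blast
  have "h \<in> module_homs R N E"
    unfolding module_homs_def
    using hG G_carr by (auto intro!: h intro: G_add G_smult)
  moreover have "h (f x) = g x" if "x \<in> carrier M" for x
    using that \<open>G0 \<subseteq> G\<close> by (intro h) (auto simp: G0_def)
  ultimately show ?thesis by blast
qed

definition essential_submodule :: "'e set \<Rightarrow> ('a, 'r) ring_scheme \<Rightarrow> ('a, 'e, 'x) module_scheme \<Rightarrow> bool"
  where "essential_submodule U R E \<longleftrightarrow> submodule U R E \<and>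
    (\<forall>V. submodule V R E \<and> V \<noteq> {\<zero>\<^bsub>E\<^esub>} \<longrightarrow> U \<inter> V \<noteq> {\<zero>\<^bsub>E\<^esub>})"

definition injective_hull ::
  "('a, 'r) ring_scheme \<Rightarrow> ('a, 'm, 'x) module_scheme \<Rightarrow> ('a, 'e, 'y) module_scheme \<Rightarrow> bool"
  where "injective_hull R M E \<longleftrightarrow> injective_module R E \<and>
    (\<exists>i \<in> module_homs R M E. inj_on i (carrier M) \<and> essential_submodule (i ` carrier M) R E)"

definition quotient_module :: "('a, 'r) ring_scheme \<Rightarrow> 'a set \<Rightarrow> ('a, 'a set) module"
  where "quotient_module R I =
    ring.extend (R Quot I) (module.fields (\<lambda>r C. (I +>\<^bsub>R\<^esub> r) \<otimes>\<^bsub>R Quot I\<^esub> C))"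

definition non_zero_divisor :: "('a, 'r) ring_scheme \<Rightarrow> 'a \<Rightarrow> bool"
  where "non_zero_divisor R r \<longleftrightarrow> r \<in> carrier R \<and>
    (\<forall>s \<in> carrier R. r \<otimes>\<^bsub>R\<^esub> s = \<zero>\<^bsub>R\<^esub> \<longrightarrow> s = \<zero>\<^bsub>R\<^esub>)"

definition divisible_module :: "('a, 'r) ring_scheme \<Rightarrow> ('a, 'm, 'x) module_scheme \<Rightarrow> bool"
  where "divisible_module R N \<longleftrightarrow>
    (\<forall>r. non_zero_divisor R r \<longrightarrow> (\<lambda>x. r \<odot>\<^bsub>N\<^esub> x) ` carrier N = carrier N)"

definition simple_divisible :: "('a, 'r) ring_scheme \<Rightarrow> ('a, 'm, 'x) module_scheme \<Rightarrow> bool"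
  where "simple_divisible R N \<longleftrightarrow>
    divisible_module R N \<and> carrier N \<noteq> {\<zero>\<^bsub>N\<^esub>} \<and>
    (\<forall>V. submodule V R N \<and> V \<noteq> {\<zero>\<^bsub>N\<^esub>} \<and> V \<subset> carrier N
       \<longrightarrow> \<not> divisible_module R (N\<lparr>carrier := V\<rparr>))"

definition local_ring :: "('a, 'r) ring_scheme \<Rightarrow> bool"
  where "local_ring A \<longleftrightarrow> cring A \<and> (\<exists>!m. maximalideal m A)"

definition max_ideal :: "('a, 'r) ring_scheme \<Rightarrow> 'a set"
  where "max_ideal A = (THE m. maximalideal m A)"

definition fraction_rel :: "('a, 'r) ring_scheme \<Rightarrow> 'a set \<Rightarrow> (('a \<times> 'a) \<times> ('a \<times> 'a)) set"
  where "fraction_rel R S = {((a, s), (b, t)).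
    a \<in> carrier R \<and> s \<in> S \<and> b \<in> carrier R \<and> t \<in> S \<and>
    (\<exists>u \<in> S. u \<otimes>\<^bsub>R\<^esub> (a \<otimes>\<^bsub>R\<^esub> t \<ominus>\<^bsub>R\<^esub> b \<otimes>\<^bsub>R\<^esub> s) = \<zero>\<^bsub>R\<^esub>)}"

definition fraction :: "('a, 'r) ring_scheme \<Rightarrow> 'a set \<Rightarrow> 'a \<Rightarrow> 'a \<Rightarrow> ('a \<times> 'a) set"
  where "fraction R S a s = fraction_rel R S `` {(a, s)}"

text \<open>
  As for \<^const>\<open>rcoset_mult\<close>, the operations take the union over all representatives; all sets
  in that union coincide.
\<close>

definition localization :: "('a, 'r) ring_scheme \<Rightarrow> 'a set \<Rightarrow> ('a \<times> 'a) set ring"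
  where "localization R S =
    \<lparr>carrier = (carrier R \<times> S) // fraction_rel R S,
     monoid.mult = (\<lambda>P Q. \<Union>(a, s) \<in> P. \<Union>(b, t) \<in> Q. fraction R S (a \<otimes>\<^bsub>R\<^esub> b) (s \<otimes>\<^bsub>R\<^esub> t)),
     one = fraction R S \<one>\<^bsub>R\<^esub> \<one>\<^bsub>R\<^esub>,
     ring.zero = fraction R S \<zero>\<^bsub>R\<^esub> \<one>\<^bsub>R\<^esub>,
     add = (\<lambda>P Q. \<Union>(a, s) \<in> P. \<Union>(b, t) \<in> Q.
              fraction R S (a \<otimes>\<^bsub>R\<^esub> t \<oplus>\<^bsub>R\<^esub> b \<otimes>\<^bsub>R\<^esub> s) (s \<otimes>\<^bsub>R\<^esub> t))\<rparr>"

definition localization_at :: "('a, 'r) ring_scheme \<Rightarrow> 'a set \<Rightarrow> ('a \<times> 'a) set ring"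
  where "localization_at R q = localization R (carrier R - q)"

definition localization_map :: "('a, 'r) ring_scheme \<Rightarrow> 'a set \<Rightarrow> 'a \<Rightarrow> ('a \<times> 'a) set"
  where "localization_map R q r = fraction R (carrier R - q) r \<one>\<^bsub>R\<^esub>"

text \<open>
  The completion is the inverse limit of the rings \<open>A / I\<^sup>n\<close>.  The transition map \<open>A / I\<^sup>n\<^sup>+\<^sup>1 \<rightarrow> A / I\<^sup>n\<close>
  sends a coset of \<open>I\<^sup>n\<^sup>+\<^sup>1\<close> to the unique coset of \<open>I\<^sup>n\<close> containing it, hence the inclusion in
  the carrier.
\<close>

abbreviation ideal_power :: "('a, 'r) ring_scheme \<Rightarrow> 'a set \<Rightarrow> nat \<Rightarrow> 'a set"
  where "ideal_power A I n \<equiv> I [^]\<^bsub>ideals_set A\<^esub> n"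

definition adic_completion :: "('a, 'r) ring_scheme \<Rightarrow> 'a set \<Rightarrow> (nat \<Rightarrow> 'a set) ring"
  where "adic_completion A I =
    \<lparr>carrier = {x. \<forall>n. x n \<in> carrier (A Quot ideal_power A I n) \<and> x (Suc n) \<subseteq> x n},
     monoid.mult = (\<lambda>x y n. x n \<otimes>\<^bsub>A Quot ideal_power A I n\<^esub> y n),
     one = (\<lambda>n. \<one>\<^bsub>A Quot ideal_power A I n\<^esub>),
     ring.zero = (\<lambda>n. \<zero>\<^bsub>A Quot ideal_power A I n\<^esub>),
     add = (\<lambda>x y n. x n \<oplus>\<^bsub>A Quot ideal_power A I n\<^esub> y n)\<rparr>"

definition completion :: "('a, 'r) ring_scheme \<Rightarrow> (nat \<Rightarrow> 'a set) ring"
  where "completion A = adic_completion A (max_ideal A)"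

definition completion_map :: "('a, 'r) ring_scheme \<Rightarrow> 'a \<Rightarrow> nat \<Rightarrow> 'a set"
  where "completion_map A a = (\<lambda>n. ideal_power A (max_ideal A) n +>\<^bsub>A\<^esub> a)"

definition analytically_irreducible :: "('a, 'r) ring_scheme \<Rightarrow> bool"
  where "analytically_irreducible A \<longleftrightarrow> domain (completion A)"

definition essential_ideal :: "'a set \<Rightarrow> ('a, 'r) ring_scheme \<Rightarrow> bool"
  where "essential_ideal I A \<longleftrightarrow> ideal I A \<and>
    (\<forall>J. ideal J A \<and> J \<noteq> {\<zero>\<^bsub>A\<^esub>} \<longrightarrow> I \<inter> J \<noteq> {\<zero>\<^bsub>A\<^esub>})"

definition essentially_complete :: "('a, 'r) ring_scheme \<Rightarrow> bool"
  where "essentially_complete A \<longleftrightarrow>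
    (\<forall>I. essential_ideal I (completion A)
       \<longrightarrow> essential_ideal {a \<in> carrier A. completion_map A a \<in> I} A)"

end

theory Submission
  imports Defs
begin

text \<open>
  Write \<open>A = R\<^sub>q\<close>, with maximal ideal \<open>\<mm>\<close>, and \<open>E = E(R/q)\<close>.

  Elements of \<open>R\<close> outside \<open>q\<close> act bijectively on \<open>E\<close>, so \<open>E\<close> is an \<open>A\<close>-module, and as such it is the
  injective hull of the residue field of \<open>A\<close>.  Non-zero-divisors of \<open>R\<close> stay non-zero-divisors
  in \<open>A\<close>, so a divisible \<open>A\<close>-submodule of \<open>E\<close> is a divisible \<open>R\<close>-submodule.  If \<open>R \<rightarrow> A\<close> is
  injective, the elements of \<open>R - q\<close> are themselves non-zero-divisors, hence a divisible
  \<open>R\<close>-submodule of \<open>E\<close> is closed under their inverses and is a divisible \<open>A\<close>-submodule.  This reduces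
  the theorem to the equivalence \<open>simple_divisible_iff\<close> for the local ring \<open>A\<close> itself
  (\<open>simple_divisible_localized\<close> and \<open>simple_divisible_of_localized\<close> are the two passages).

  Over \<open>A\<close> the proof uses two parts of Matlis duality.  First, the completion is the ring of
  endomorphisms of \<open>E\<close> (\<open>act_mult\<close>, \<open>act_injective\<close>, \<open>act_surjective\<close>).  The reason is that every
  element of \<open>E\<close> is killed by a power of \<open>\<mm>\<close> (\<open>torsion\<close>), and that on the part of \<open>E\<close> killed by
  \<open>\<mm>\<^sup>n\<close> every homomorphism is multiplication by an element of \<open>A\<close>, unique modulo \<open>\<mm>\<^sup>n\<close>
  (\<open>hom_tors_is_smult\<close>, \<open>annihilator_tors\<close>).  Second, \<open>E\<close> is Artinian,
  by a dual form of Hilbert's basis theorem (\<open>artinian_lift\<close>).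

  Let \<open>E\<close> be simple divisible.  Images of endomorphisms are divisible, so every nonzero
  endomorphism is surjective and the completion is a domain.  Let \<open>f\<close> be a nonzero element of it, with
  kernel \<open>K \<noteq> E\<close>.  If some \<open>a \<noteq> 0\<close> in \<open>A\<close> kills \<open>K\<close>, then \<open>a\<close> factors through \<open>f\<close>, that is, \<open>a\<close> lies
  in the ideal generated by \<open>f\<close>; this is essential completeness.  Otherwise there is a minimal
  submodule \<open>V\<close> of \<open>K\<close> that no nonzero element of \<open>A\<close> kills.  For \<open>a \<noteq> 0\<close> the submodule \<open>aV\<close> has the
  same property because \<open>A\<close> is a domain, so \<open>aV = V\<close>: the submodule \<open>V\<close> is divisible, nonzero and
  proper, a contradiction.

  Conversely let the completion be a domain, let \<open>A\<close> be essentially complete, and let \<open>V\<close> be a proper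
  nonzero divisible submodule.  Some nonzero endomorphism \<open>f\<close> vanishes on \<open>V\<close>, and the
  ideal generated by \<open>f\<close> contains a nonzero \<open>a \<in> A\<close>.  Then \<open>aV = 0\<close>, whereas \<open>aV = V\<close> by divisibility.
\<close>

section \<open>Module homomorphisms, submodules and annihilators\<close>

lemma module_homs_closed:
  "f \<in> module_homs R M N \<Longrightarrow> x \<in> carrier M \<Longrightarrow> f x \<in> carrier N"
  by (auto simp: module_homs_def)

lemma module_homs_add:
  "f \<in> module_homs R M N \<Longrightarrow> x \<in> carrier M \<Longrightarrow> y \<in> carrier M \<Longrightarrow> f (x \<oplus>\<^bsub>M\<^esub> y) = f x \<oplus>\<^bsub>N\<^esub> f y"
  by (auto simp: module_homs_def)

lemma module_homs_smult:
  "f \<in> module_homs R M N \<Longrightarrow> r \<in> carrier R \<Longrightarrow> x \<in> carrier M \<Longrightarrow> f (r \<odot>\<^bsub>M\<^esub> x) = r \<odot>\<^bsub>N\<^esub> f x"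
  by (auto simp: module_homs_def)

lemma module_homs_minus:
  assumes M: "module R M" and N: "module R N" and f: "f \<in> module_homs R M N"
    and x: "x \<in> carrier M" and y: "y \<in> carrier M"
  shows "f (x \<ominus>\<^bsub>M\<^esub> y) = f x \<ominus>\<^bsub>N\<^esub> f y"
proof -
  interpret M: module R M by (rule M)
  interpret N: module R N by (rule N)
  have fx: "f x \<in> carrier N" and fy: "f y \<in> carrier N"
    using module_homs_closed[OF f] x y by auto
  have "\<ominus>\<^bsub>M\<^esub> y = (\<ominus>\<^bsub>R\<^esub> \<one>\<^bsub>R\<^esub>) \<odot>\<^bsub>M\<^esub> y" using y by (simp add: M.smult_l_minus)
  then have "f (\<ominus>\<^bsub>M\<^esub> y) = (\<ominus>\<^bsub>R\<^esub> \<one>\<^bsub>R\<^esub>) \<odot>\<^bsub>N\<^esub> f y" using y module_homs_smult[OF f] by simp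
  then have "f (\<ominus>\<^bsub>M\<^esub> y) = \<ominus>\<^bsub>N\<^esub> f y" using fy by (simp add: N.smult_l_minus)
  then show ?thesis
    using x y module_homs_add[OF f, of x "\<ominus>\<^bsub>M\<^esub> y"] by (simp add: a_minus_def)
qed

lemma module_homs_restrict:
  "f \<in> module_homs R M N \<Longrightarrow> U \<subseteq> carrier M \<Longrightarrow> f \<in> module_homs R (M\<lparr>carrier := U\<rparr>) N"
  by (auto simp: module_homs_def subset_iff)

context module
begin

lemma smult_minus_distr:
  "a \<in> carrier R \<Longrightarrow> x \<in> carrier M \<Longrightarrow> y \<in> carrier M \<Longrightarrow>
    a \<odot>\<^bsub>M\<^esub> (x \<ominus>\<^bsub>M\<^esub> y) = a \<odot>\<^bsub>M\<^esub> x \<ominus>\<^bsub>M\<^esub> a \<odot>\<^bsub>M\<^esub> y"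
  by (simp add: a_minus_def smult_r_distr smult_r_minus)

lemma minus_smult_distr:
  "a \<in> carrier R \<Longrightarrow> b \<in> carrier R \<Longrightarrow> x \<in> carrier M \<Longrightarrow>
    (a \<ominus>\<^bsub>R\<^esub> b) \<odot>\<^bsub>M\<^esub> x = a \<odot>\<^bsub>M\<^esub> x \<ominus>\<^bsub>M\<^esub> b \<odot>\<^bsub>M\<^esub> x"
  by (simp add: a_minus_def smult_l_distr smult_l_minus)

lemma diff_zero_iff:
  assumes "x \<in> carrier M" "y \<in> carrier M"
  shows "x \<ominus>\<^bsub>M\<^esub> y = \<zero>\<^bsub>M\<^esub> \<longleftrightarrow> x = y"
  using assms by (metis M.add.inv_comm M.minus_equality M.minus_minus M.r_neg M.minus_closed a_minus_def M.a_inv_closed)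

lemma submodule_diff:
  "submodule V R M \<Longrightarrow> x \<in> V \<Longrightarrow> y \<in> V \<Longrightarrow> x \<ominus>\<^bsub>M\<^esub> y \<in> V"
  by (simp add: a_minus_def submoduleE(3) submoduleE(5))

lemma submodule_zero: "submodule V R M \<Longrightarrow> \<zero>\<^bsub>M\<^esub> \<in> V"
  by (metis submoduleE(1,2,4) R.zero_closed smult_l_null subsetD ex_in_conv)

lemma zero_submodule: "submodule {\<zero>\<^bsub>M\<^esub>} R M"
  by (rule submoduleI) auto

lemma submodule_module: "submodule V R M \<Longrightarrow> module R (M\<lparr>carrier := V\<rparr>)"
  using submodule.submodule_is_module module_axioms by blast

lemma hom_image_submodule:
  assumes N: "module R N" and f: "f \<in> module_homs R M N" and V: "submodule V R M"
  shows "submodule (f ` V) R N"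
proof -
  interpret N: module R N by (rule N)
  note VE = submoduleE[OF V]
  show ?thesis
  proof (rule N.submoduleI)
    show "f ` V \<subseteq> carrier N" using VE(1) module_homs_closed[OF f] by blast
    have "f \<zero>\<^bsub>M\<^esub> = \<zero>\<^bsub>N\<^esub>" by (rule module_homs_zero[OF module_axioms N f])
    then show "\<zero>\<^bsub>N\<^esub> \<in> f ` V" using submodule_zero[OF V] by (metis image_eqI)
  next
    fix a assume "a \<in> f ` V"
    then obtain x where x: "x \<in> V" "a = f x" by blast
    then have "\<ominus>\<^bsub>N\<^esub> a = f ((\<ominus> \<one>) \<odot>\<^bsub>M\<^esub> x)"
      using VE(1) module_homs_smult[OF f, of "\<ominus> \<one>" x] module_homs_closed[OF f, of x]
      by (auto simp: N.smult_l_minus)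
    then show "\<ominus>\<^bsub>N\<^esub> a \<in> f ` V" using VE(4) x by simp
  next
    fix a b assume "a \<in> f ` V" "b \<in> f ` V"
    then obtain x y where x: "x \<in> V" "a = f x" "y \<in> V" "b = f y" by blast
    then have "a \<oplus>\<^bsub>N\<^esub> b = f (x \<oplus>\<^bsub>M\<^esub> y)" using VE(1) module_homs_add[OF f, of x y] by (simp add: subset_iff)
    then show "a \<oplus>\<^bsub>N\<^esub> b \<in> f ` V" using VE(5) x by simp
  next
    fix a y assume a: "a \<in> carrier R" and "y \<in> f ` V"
    then obtain x where x: "x \<in> V" "y = f x" by blast
    then have "a \<odot>\<^bsub>N\<^esub> y = f (a \<odot>\<^bsub>M\<^esub> x)" using a VE(1) module_homs_smult[OF f, of a x] by auto
    then show "a \<odot>\<^bsub>N\<^esub> y \<in> f ` V" using VE(4) a x by simp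
  qed
qed

lemma hom_kernel_submodule:
  assumes N: "module R N" and f: "f \<in> module_homs R M N" and V: "submodule V R M"
  shows "submodule {x \<in> V. f x = \<zero>\<^bsub>N\<^esub>} R M"
proof -
  interpret N: module R N by (rule N)
  note VE = submoduleE[OF V]
  show ?thesis
  proof (rule submoduleI)
    show "\<zero>\<^bsub>M\<^esub> \<in> {x \<in> V. f x = \<zero>\<^bsub>N\<^esub>}"
      using module_homs_zero[OF module_axioms N f] submodule_zero[OF V] by simp
  next
    fix a assume a: "a \<in> {x \<in> V. f x = \<zero>\<^bsub>N\<^esub>}"
    then have "\<ominus>\<^bsub>M\<^esub> a = (\<ominus> \<one>) \<odot>\<^bsub>M\<^esub> a" using VE(1) by (auto simp: smult_l_minus)
    then have "f (\<ominus>\<^bsub>M\<^esub> a) = \<zero>\<^bsub>N\<^esub>"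
      using a VE(1) module_homs_smult[OF f, of "\<ominus> \<one>" a] by (auto simp: subset_iff)
    then show "\<ominus>\<^bsub>M\<^esub> a \<in> {x \<in> V. f x = \<zero>\<^bsub>N\<^esub>}" using a VE(3) by simp
  qed (use VE module_homs_add[OF f] module_homs_smult[OF f] in \<open>auto simp: subset_iff\<close>)
qed

lemma smult_hom: "a \<in> carrier R \<Longrightarrow> (\<lambda>x. a \<odot>\<^bsub>M\<^esub> x) \<in> module_homs R M M"
  by (auto simp: module_homs_def smult_r_distr smult_assoc1[symmetric] R.m_comm)

lemma cyclic_submodule:
  assumes x: "x \<in> carrier M"
  shows "submodule ((\<lambda>a. a \<odot>\<^bsub>M\<^esub> x) ` carrier R) R M"
proof (rule submoduleI)
  show "\<zero>\<^bsub>M\<^esub> \<in> (\<lambda>a. a \<odot>\<^bsub>M\<^esub> x) ` carrier R"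
    using smult_l_null[OF x] R.zero_closed by (metis image_eqI)
qed (use x in \<open>auto simp: smult_l_minus[symmetric] smult_l_distr[symmetric] smult_assoc1[symmetric]\<close>)

definition ann :: "'c \<Rightarrow> 'a set"
  where "ann x = {a \<in> carrier R. a \<odot>\<^bsub>M\<^esub> x = \<zero>\<^bsub>M\<^esub>}"

definition tors :: "'a set \<Rightarrow> 'c set"
  where "tors J = {x \<in> carrier M. \<forall>a \<in> J. a \<odot>\<^bsub>M\<^esub> x = \<zero>\<^bsub>M\<^esub>}"

lemma transporter_ideal:
  assumes V: "submodule V R M" and x: "x \<in> carrier M"
  shows "ideal {a \<in> carrier R. a \<odot>\<^bsub>M\<^esub> x \<in> V} R"
proof (rule idealI)
  note VE = submoduleE[OF V]
  show "subgroup {a \<in> carrier R. a \<odot>\<^bsub>M\<^esub> x \<in> V} (add_monoid R)"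
    using x VE submodule_zero[OF V]
    by (intro R.add.subgroupI)
      (auto simp: smult_l_minus smult_l_distr a_inv_def[symmetric] intro!: exI[of _ \<zero>])
  show "c \<otimes> a \<in> {a \<in> carrier R. a \<odot>\<^bsub>M\<^esub> x \<in> V}"
    if "a \<in> {a \<in> carrier R. a \<odot>\<^bsub>M\<^esub> x \<in> V}" "c \<in> carrier R" for a c
    using that x VE(4) by (simp add: smult_assoc1)
  then show "a \<otimes> c \<in> {a \<in> carrier R. a \<odot>\<^bsub>M\<^esub> x \<in> V}"
    if "a \<in> {a \<in> carrier R. a \<odot>\<^bsub>M\<^esub> x \<in> V}" "c \<in> carrier R" for a c
    using that R.m_comm by auto
qed (rule R.ring_axioms)

lemma ann_ideal: "x \<in> carrier M \<Longrightarrow> ideal (ann x) R"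
  using transporter_ideal[OF zero_submodule] by (simp add: ann_def)

lemma tors_submodule: "J \<subseteq> carrier R \<Longrightarrow> submodule (tors J) R M"
proof (rule submoduleI)
  fix a x assume J: "J \<subseteq> carrier R" and a: "a \<in> carrier R" and x: "x \<in> tors J"
  have "b \<odot>\<^bsub>M\<^esub> (a \<odot>\<^bsub>M\<^esub> x) = \<zero>\<^bsub>M\<^esub>" if "b \<in> J" for b
  proof -
    have "b \<odot>\<^bsub>M\<^esub> (a \<odot>\<^bsub>M\<^esub> x) = a \<odot>\<^bsub>M\<^esub> (b \<odot>\<^bsub>M\<^esub> x)"
      using that J a x smult_assoc1[of a b x] smult_assoc1[of b a x]
      by (auto simp: tors_def R.m_comm)
    then show ?thesis using that x a by (simp add: tors_def)
  qed
  then show "a \<odot>\<^bsub>M\<^esub> x \<in> tors J" using a x by (simp add: tors_def)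
qed (auto simp: tors_def smult_r_minus smult_r_distr subset_iff)

text \<open>Lets \<open>tors I\<close> be cut out by finitely many equations when \<open>I\<close> is finitely generated.\<close>

lemma tors_genideal:
  assumes "S \<subseteq> carrier R"
  shows "tors (Idl S) = tors S"
proof
  show "tors (Idl S) \<subseteq> tors S" using genideal_self[OF assms] by (auto simp: tors_def)
  show "tors S \<subseteq> tors (Idl S)"
  proof
    fix x assume x: "x \<in> tors S"
    then have "Idl S \<subseteq> ann x"
      using assms by (intro genideal_minimal ann_ideal) (auto simp: tors_def ann_def)
    then show "x \<in> tors (Idl S)" using x by (auto simp: tors_def ann_def)
  qed
qed

lemma tors_antimono: "I \<subseteq> J \<Longrightarrow> tors J \<subseteq> tors I"
  by (auto simp: tors_def)

end

section \<open>Noetherian induction and powers of ideals\<close>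

lemma (in noetherian_ring) maximal_ideal_in_family:
  assumes "F \<noteq> {}" and "\<And>J. J \<in> F \<Longrightarrow> ideal J R"
  shows "\<exists>J \<in> F. \<forall>J' \<in> F. J \<subseteq> J' \<longrightarrow> J' = J"
proof (rule subset_Zorn_nonempty[OF assms(1)])
  fix C assume C: "C \<noteq> {}" "subset.chain F C"
  then have "subset.chain {I. ideal I R} C"
    using assms(2) by (auto simp: subset_chain_def)
  then have "\<Union>C \<in> C" by (rule ideal_chain_is_trivial[OF C(1)])
  then show "\<Union>C \<in> F" using C(2) by (auto simp: subset_chain_def)
qed

lemma (in noetherian_ring) ideal_induct [consumes 1, case_names larger]:
  assumes "ideal J R"
    and step: "\<And>J. ideal J R \<Longrightarrow> (\<And>J'. ideal J' R \<Longrightarrow> J \<subset> J' \<Longrightarrow> P J') \<Longrightarrow> P J"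
  shows "P J"
proof (rule ccontr)
  assume "\<not> P J"
  then have "\<exists>K \<in> {K. ideal K R \<and> \<not> P K}. \<forall>K' \<in> {K. ideal K R \<and> \<not> P K}. K \<subseteq> K' \<longrightarrow> K' = K"
    using assms(1) by (intro maximal_ideal_in_family) auto
  then obtain K where "ideal K R" "\<not> P K" and max: "\<And>K'. ideal K' R \<Longrightarrow> \<not> P K' \<Longrightarrow> K \<subseteq> K' \<Longrightarrow> K' = K"
    by blast
  then show False using step[of K] by blast
qed

lemma (in cring) ideal_power_ideal:
  assumes "ideal I R"
  shows "ideal (ideal_power R I n) R"
proof -
  interpret S: comm_monoid "ideals_set R" by (rule ideals_set_is_comm_monoid)
  have "ideal_power R I n \<in> carrier (ideals_set R)"
    using assms by (intro S.nat_pow_closed) (simp add: ideals_set_def)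
  then show ?thesis by (simp add: ideals_set_def)
qed

lemma (in cring) ideal_power_0: "ideal_power R I 0 = carrier R"
  by (simp add: ideals_set_def)

lemma (in cring) ideal_power_Suc: "ideal_power R I (Suc n) = ideal_power R I n \<cdot> I"
  by (simp add: ideals_set_def)

lemma (in cring) ideal_power_antimono:
  assumes "ideal I R" and "k \<le> n"
  shows "ideal_power R I n \<subseteq> ideal_power R I k"
  using assms(2)
proof (induction n rule: dec_induct)
  case (step n)
  have "ideal_power R I (Suc n) \<subseteq> ideal_power R I n"
    unfolding ideal_power_Suc
    using ideal_prod_inter[OF ideal_power_ideal assms(1)] assms(1) by blast
  then show ?case using step by blast
qed simp

lemma (in cring) ideal_power_pow:
  assumes "ideal I R" and "a \<in> I"
  shows "a [^] n \<in> ideal_power R I n"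
proof (induction n)
  case (Suc n)
  then show ?case
    unfolding ideal_power_Suc using assms(2) by (simp add: ideal_prod.prod)
qed (simp add: ideals_set_def)

section \<open>Duality over a Noetherian local ring\<close>

text \<open>
  The hypotheses say that \<open>A\<close> is a Noetherian local ring with maximal ideal \<open>\<mm>\<close> and that \<open>E\<close> is
  the injective hull of \<open>A/\<mm>\<close>: the class of \<open>1\<close> is sent to \<open>e\<^sub>0\<close>, and essentiality of its span, a
  simple module, amounts to \<open>e\<^sub>0\<close> lying in every nonzero submodule.
\<close>

locale residue_hull = module A E + noetherian_ring A
  for A :: "('a, 'r) ring_scheme" (structure) and E :: "('a, 'e, 'x) module_scheme" (structure) +
  fixes \<mm> :: "'a set" and e\<^sub>0 :: 'e
  assumes injective: "injective_module A E"
    and \<mm>_ideal: "ideal \<mm> A"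
    and \<mm>_proper: "\<one>\<^bsub>A\<^esub> \<notin> \<mm>"
    and outside_\<mm>: "a \<in> carrier A \<Longrightarrow> a \<notin> \<mm> \<Longrightarrow> a \<in> Units A"
    and e\<^sub>0_closed: "e\<^sub>0 \<in> carrier E"
    and e\<^sub>0_nonzero: "e\<^sub>0 \<noteq> \<zero>\<^bsub>E\<^esub>"
    and \<mm>_e\<^sub>0: "a \<in> \<mm> \<Longrightarrow> a \<odot>\<^bsub>E\<^esub> e\<^sub>0 = \<zero>\<^bsub>E\<^esub>"
    and e\<^sub>0_mem: "submodule V A E \<Longrightarrow> V \<noteq> {\<zero>\<^bsub>E\<^esub>} \<Longrightarrow> e\<^sub>0 \<in> V"
begin

interpretation \<mm>: ideal \<mm> A by (rule \<mm>_ideal)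

lemma \<mm>_carrier: "a \<in> \<mm> \<Longrightarrow> a \<in> carrier A"
  by (rule \<mm>.Icarr)

lemma proper_ideal_le_\<mm>:
  assumes I: "ideal I A" and one: "\<one>\<^bsub>A\<^esub> \<notin> I"
  shows "I \<subseteq> \<mm>"
proof
  fix a assume a: "a \<in> I"
  show "a \<in> \<mm>"
  proof (rule ccontr)
    assume "a \<notin> \<mm>"
    then have "a \<in> Units A" using outside_\<mm> a ideal.Icarr[OF I] by blast
    moreover from this have "inv\<^bsub>A\<^esub> a \<otimes>\<^bsub>A\<^esub> a \<in> I" by (intro ideal.I_l_closed[OF I a]) simp
    ultimately show False using one by simp
  qed
qed

lemma max_ideal_eq: "max_ideal A = \<mm>"
  unfolding max_ideal_def
proof (rule the_equality)
  show "maximalideal \<mm> A"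
  proof (rule maximalidealI[OF \<mm>_ideal])
    show "carrier A \<noteq> \<mm>" using \<mm>_proper by blast
    show "J = \<mm> \<or> J = carrier A" if "ideal J A" "\<mm> \<subseteq> J" "J \<subseteq> carrier A" for J
      using that proper_ideal_le_\<mm> ideal.one_imp_carrier by blast
  qed
next
  fix J assume J: "maximalideal J A"
  then interpret J: maximalideal J A .
  have "\<one>\<^bsub>A\<^esub> \<notin> J" using J.I_notcarr J.one_imp_carrier by auto
  then have "J \<subseteq> \<mm>" using proper_ideal_le_\<mm> J.ideal_axioms by blast
  then have "\<mm> = J \<or> \<mm> = carrier A" using J.I_maximal \<mm>_ideal \<mm>.a_subset by blast
  then show "J = \<mm>" using \<mm>_proper by auto
qed

text \<open>
  The hull is a cogenerator.  The image of \<open>x\<close> in \<open>N/W\<close> spans a nonzero cyclic module, which maps onto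
  the residue field; send \<open>x\<close> to \<open>e\<^sub>0\<close> and extend by injectivity.  To avoid quotients, the map
  \<open>w + ax \<mapsto> a e\<^sub>0\<close> is defined directly on \<open>W + Ax\<close>: it is well defined because the \<open>a\<close> with \<open>ax \<in> W\<close> form
  a proper ideal, hence kill \<open>e\<^sub>0\<close>.
\<close>

lemma separating_hom:
  fixes N :: "('a, 'n, 'y) module_scheme"
  assumes N: "module A N" and W: "submodule W A N" and x: "x \<in> carrier N" "x \<notin> W"
  shows "\<exists>h \<in> module_homs A N E. (\<forall>w \<in> W. h w = \<zero>\<^bsub>E\<^esub>) \<and> h x = e\<^sub>0"
proof -
  interpret N: module A N by (rule N)
  note WE = N.submoduleE[OF W]
  have Wc: "w \<in> carrier N" if "w \<in> W" for w using WE(1) that by blast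
  define U where "U = {w \<oplus>\<^bsub>N\<^esub> a \<odot>\<^bsub>N\<^esub> x | w a. w \<in> W \<and> a \<in> carrier A}"
  have U: "submodule U A N"
  proof (rule N.submoduleI)
    show "U \<subseteq> carrier N" using x Wc by (auto simp: U_def)
    have "\<zero>\<^bsub>N\<^esub> = \<zero>\<^bsub>N\<^esub> \<oplus>\<^bsub>N\<^esub> \<zero> \<odot>\<^bsub>N\<^esub> x" using x by simp
    then show "\<zero>\<^bsub>N\<^esub> \<in> U" using N.submodule_zero[OF W] unfolding U_def by blast
  next
    fix u assume "u \<in> U"
    then obtain w a where *: "w \<in> W" "a \<in> carrier A" "u = w \<oplus>\<^bsub>N\<^esub> a \<odot>\<^bsub>N\<^esub> x" by (auto simp: U_def)
    then have "\<ominus>\<^bsub>N\<^esub> u = (\<ominus>\<^bsub>N\<^esub> w) \<oplus>\<^bsub>N\<^esub> (\<ominus> a) \<odot>\<^bsub>N\<^esub> x"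
      using x Wc by (simp add: N.smult_l_minus N.M.minus_add)
    then show "\<ominus>\<^bsub>N\<^esub> u \<in> U" using * WE(3) unfolding U_def by blast
  next
    fix u v assume "u \<in> U" "v \<in> U"
    then obtain w a w' b where *: "w \<in> W" "a \<in> carrier A" "u = w \<oplus>\<^bsub>N\<^esub> a \<odot>\<^bsub>N\<^esub> x"
      "w' \<in> W" "b \<in> carrier A" "v = w' \<oplus>\<^bsub>N\<^esub> b \<odot>\<^bsub>N\<^esub> x" by (auto simp: U_def)
    then have "u \<oplus>\<^bsub>N\<^esub> v = (w \<oplus>\<^bsub>N\<^esub> w') \<oplus>\<^bsub>N\<^esub> (a \<oplus> b) \<odot>\<^bsub>N\<^esub> x"
      using x Wc by (simp add: N.smult_l_distr N.M.a_ac)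
    then show "u \<oplus>\<^bsub>N\<^esub> v \<in> U" using * WE(5) unfolding U_def by blast
  next
    fix b u assume b: "b \<in> carrier A" and "u \<in> U"
    then obtain w a where *: "w \<in> W" "a \<in> carrier A" "u = w \<oplus>\<^bsub>N\<^esub> a \<odot>\<^bsub>N\<^esub> x" by (auto simp: U_def)
    then have "b \<odot>\<^bsub>N\<^esub> u = (b \<odot>\<^bsub>N\<^esub> w) \<oplus>\<^bsub>N\<^esub> (b \<otimes> a) \<odot>\<^bsub>N\<^esub> x"
      using x Wc b by (simp add: N.smult_r_distr N.smult_assoc1)
    then show "b \<odot>\<^bsub>N\<^esub> u \<in> U" using * WE(4) b unfolding U_def by blast
  qed
  define I where "I = {a \<in> carrier A. a \<odot>\<^bsub>N\<^esub> x \<in> W}"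
  have "ideal I A" unfolding I_def by (rule N.transporter_ideal[OF W x(1)])
  moreover have "\<one> \<notin> I" using x by (simp add: I_def)
  ultimately have I\<mm>: "I \<subseteq> \<mm>" by (rule proper_ideal_le_\<mm>)
  define g where "g u = (THE y. \<exists>w a. w \<in> W \<and> a \<in> carrier A \<and> u = w \<oplus>\<^bsub>N\<^esub> a \<odot>\<^bsub>N\<^esub> x \<and> y = a \<odot>\<^bsub>E\<^esub> e\<^sub>0)" for u
  have g: "g (w \<oplus>\<^bsub>N\<^esub> a \<odot>\<^bsub>N\<^esub> x) = a \<odot>\<^bsub>E\<^esub> e\<^sub>0" if wa: "w \<in> W" "a \<in> carrier A" for w a
    unfolding g_def
  proof (rule the_equality)
    show "\<exists>w' b. w' \<in> W \<and> b \<in> carrier A \<and> w \<oplus>\<^bsub>N\<^esub> a \<odot>\<^bsub>N\<^esub> x = w' \<oplus>\<^bsub>N\<^esub> b \<odot>\<^bsub>N\<^esub> x \<and> a \<odot>\<^bsub>E\<^esub> e\<^sub>0 = b \<odot>\<^bsub>E\<^esub> e\<^sub>0"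
      using wa by blast
  next
    fix y assume "\<exists>w' b. w' \<in> W \<and> b \<in> carrier A \<and> w \<oplus>\<^bsub>N\<^esub> a \<odot>\<^bsub>N\<^esub> x = w' \<oplus>\<^bsub>N\<^esub> b \<odot>\<^bsub>N\<^esub> x \<and> y = b \<odot>\<^bsub>E\<^esub> e\<^sub>0"
    then obtain w' b where *: "w' \<in> W" "b \<in> carrier A"
      "w \<oplus>\<^bsub>N\<^esub> a \<odot>\<^bsub>N\<^esub> x = w' \<oplus>\<^bsub>N\<^esub> b \<odot>\<^bsub>N\<^esub> x" "y = b \<odot>\<^bsub>E\<^esub> e\<^sub>0" by blast
    define p where "p = a \<odot>\<^bsub>N\<^esub> x"
    define r where "r = b \<odot>\<^bsub>N\<^esub> x"
    have c: "p \<in> carrier N" "r \<in> carrier N" "w \<in> carrier N" "w' \<in> carrier N"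
      using wa * x Wc by (auto simp: p_def r_def)
    have "p \<ominus>\<^bsub>N\<^esub> r = w' \<ominus>\<^bsub>N\<^esub> w"
    proof -
      have "p = \<ominus>\<^bsub>N\<^esub> w \<oplus>\<^bsub>N\<^esub> (w \<oplus>\<^bsub>N\<^esub> p)" using c by (simp add: N.M.r_neg1)
      also have "\<dots> = \<ominus>\<^bsub>N\<^esub> w \<oplus>\<^bsub>N\<^esub> (w' \<oplus>\<^bsub>N\<^esub> r)" using *(3) by (simp add: p_def r_def)
      finally have "p = \<ominus>\<^bsub>N\<^esub> w \<oplus>\<^bsub>N\<^esub> (w' \<oplus>\<^bsub>N\<^esub> r)" .
      then have "p \<ominus>\<^bsub>N\<^esub> r = (w' \<ominus>\<^bsub>N\<^esub> w) \<oplus>\<^bsub>N\<^esub> (r \<oplus>\<^bsub>N\<^esub> \<ominus>\<^bsub>N\<^esub> r)"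
        using c by (simp only: a_minus_def N.M.a_ac N.M.a_inv_closed N.M.add.m_closed)
      then show ?thesis using c by (simp add: N.M.r_neg)
    qed
    then have "(a \<ominus> b) \<odot>\<^bsub>N\<^esub> x \<in> W"
      using wa * x N.submodule_diff[OF W] by (simp add: N.minus_smult_distr p_def r_def)
    then have "(a \<ominus> b) \<in> \<mm>" using I\<mm> wa * by (auto simp: I_def)
    then have "a \<odot>\<^bsub>E\<^esub> e\<^sub>0 \<ominus>\<^bsub>E\<^esub> b \<odot>\<^bsub>E\<^esub> e\<^sub>0 = \<zero>\<^bsub>E\<^esub>"
      using \<mm>_e\<^sub>0 wa * e\<^sub>0_closed by (simp add: minus_smult_distr[symmetric])
    then show "y = a \<odot>\<^bsub>E\<^esub> e\<^sub>0" using diff_zero_iff wa * e\<^sub>0_closed by simp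
  qed
  have "g \<in> module_homs A (N\<lparr>carrier := U\<rparr>) E"
    unfolding module_homs_def
  proof (intro CollectI conjI ballI)
    show "g \<in> carrier (N\<lparr>carrier := U\<rparr>) \<rightarrow> carrier E"
      using g e\<^sub>0_closed by (auto simp: U_def)
  next
    fix u v assume "u \<in> carrier (N\<lparr>carrier := U\<rparr>)" "v \<in> carrier (N\<lparr>carrier := U\<rparr>)"
    then obtain w a w' b where *: "w \<in> W" "a \<in> carrier A" "u = w \<oplus>\<^bsub>N\<^esub> a \<odot>\<^bsub>N\<^esub> x"
      "w' \<in> W" "b \<in> carrier A" "v = w' \<oplus>\<^bsub>N\<^esub> b \<odot>\<^bsub>N\<^esub> x" by (auto simp: U_def)
    then have "u \<oplus>\<^bsub>N\<^esub> v = (w \<oplus>\<^bsub>N\<^esub> w') \<oplus>\<^bsub>N\<^esub> (a \<oplus> b) \<odot>\<^bsub>N\<^esub> x"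
      using x Wc by (simp add: N.smult_l_distr N.M.a_ac)
    then show "g (u \<oplus>\<^bsub>N\<lparr>carrier := U\<rparr>\<^esub> v) = g u \<oplus>\<^bsub>E\<^esub> g v"
      using * g WE(5) e\<^sub>0_closed by (simp add: smult_l_distr)
  next
    fix b u assume b: "b \<in> carrier A" and "u \<in> carrier (N\<lparr>carrier := U\<rparr>)"
    then obtain w a where *: "w \<in> W" "a \<in> carrier A" "u = w \<oplus>\<^bsub>N\<^esub> a \<odot>\<^bsub>N\<^esub> x" by (auto simp: U_def)
    then have "b \<odot>\<^bsub>N\<^esub> u = (b \<odot>\<^bsub>N\<^esub> w) \<oplus>\<^bsub>N\<^esub> (b \<otimes> a) \<odot>\<^bsub>N\<^esub> x"
      using x Wc b by (simp add: N.smult_r_distr N.smult_assoc1)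
    then show "g (b \<odot>\<^bsub>N\<lparr>carrier := U\<rparr>\<^esub> u) = b \<odot>\<^bsub>E\<^esub> g u"
      using * g WE(4) b e\<^sub>0_closed by (simp add: smult_assoc1)
  qed
  moreover have "id \<in> module_homs A (N\<lparr>carrier := U\<rparr>) N"
    using N.submoduleE(1)[OF U] by (auto simp: module_homs_def)
  ultimately have "\<exists>h \<in> module_homs A N E. \<forall>u \<in> carrier (N\<lparr>carrier := U\<rparr>). h (id u) = g u"
    by (intro injective_module_extend[OF injective N.submodule_module[OF U] N _ inj_on_id])
  then obtain h where h: "h \<in> module_homs A N E" and hg: "\<And>u. u \<in> U \<Longrightarrow> h u = g u"
    by auto
  have "h w = \<zero>\<^bsub>E\<^esub>" if "w \<in> W" for w
  proof -
    have "w = w \<oplus>\<^bsub>N\<^esub> \<zero> \<odot>\<^bsub>N\<^esub> x" using that Wc x by simp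
    then have "w \<in> U" using that unfolding U_def by blast
    then have "h w = g w" by (rule hg)
    also have "\<dots> = \<zero> \<odot>\<^bsub>E\<^esub> e\<^sub>0"
      using g[OF that R.zero_closed] that Wc x by simp
    finally show ?thesis using e\<^sub>0_closed by simp
  qed
  moreover have "h x = e\<^sub>0"
  proof -
    have "x = \<zero>\<^bsub>N\<^esub> \<oplus>\<^bsub>N\<^esub> \<one> \<odot>\<^bsub>N\<^esub> x" using x by simp
    then have "x \<in> U" using N.submodule_zero[OF W] unfolding U_def by blast
    then have "h x = g x" by (rule hg)
    also have "\<dots> = \<one> \<odot>\<^bsub>E\<^esub> e\<^sub>0"
      using g[OF N.submodule_zero[OF W] R.one_closed] x by simp
    finally show ?thesis using e\<^sub>0_closed by simp
  qed
  ultimately show ?thesis using h by (intro bexI[of _ h]) auto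
qed

lemma extend_endo:
  assumes U: "submodule U A E" and g: "g \<in> module_homs A (E\<lparr>carrier := U\<rparr>) E"
  shows "\<exists>h \<in> module_homs A E E. \<forall>u \<in> U. h u = g u"
proof -
  have "id \<in> module_homs A (E\<lparr>carrier := U\<rparr>) E"
    using submoduleE(1)[OF U] by (auto simp: module_homs_def)
  from injective_module_extend[OF injective submodule_module[OF U] module_axioms this inj_on_id g]
  show ?thesis by simp
qed

text \<open>
  A homomorphism \<open>A/J \<rightarrow> E\<close> is the same as an element of \<open>tors J\<close>, so this is the cogenerator property
  for \<open>A/J\<close>.
\<close>

lemma tors_detects:
  assumes J: "ideal J A" and b: "b \<in> carrier A" "b \<notin> J"
  shows "\<exists>e \<in> tors J. b \<odot>\<^bsub>E\<^esub> e = e\<^sub>0"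
proof -
  let ?A = "ideal_module A (carrier A)"
  interpret J: ideal J A by (rule J)
  have mod: "module A ?A" by (rule R.ideal_module_module[OF R.oneideal])
  interpret AA: module A ?A by (rule mod)
  have sub: "submodule J A ?A"
  proof (rule AA.submoduleI)
    fix a assume a: "a \<in> J"
    then have "\<ominus>\<^bsub>?A\<^esub> a = \<ominus>\<^bsub>?A\<^esub> (\<one> \<odot>\<^bsub>?A\<^esub> a)" by (simp add: ideal_module_def J.Icarr)
    also have "\<dots> = (\<ominus> \<one>) \<odot>\<^bsub>?A\<^esub> a"
      using a by (subst AA.smult_l_minus) (simp_all add: ideal_module_def J.Icarr)
    finally have "\<ominus>\<^bsub>?A\<^esub> a = (\<ominus> \<one>) \<otimes> a" by (simp add: ideal_module_def)
    then show "\<ominus>\<^bsub>?A\<^esub> a \<in> J" using a J.I_l_closed by simp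
  qed (auto simp: ideal_module_def J.I_l_closed J.Icarr)
  obtain h where h: "h \<in> module_homs A ?A E" and h0: "\<And>w. w \<in> J \<Longrightarrow> h w = \<zero>\<^bsub>E\<^esub>" and hb: "h b = e\<^sub>0"
    using separating_hom[OF mod sub, of b] b by (auto simp: ideal_module_def)
  have h1: "h \<one> \<in> carrier E" using module_homs_closed[OF h, of \<one>] by (simp add: ideal_module_def)
  have ha: "h a = a \<odot>\<^bsub>E\<^esub> h \<one>" if "a \<in> carrier A" for a
    using module_homs_smult[OF h that, of \<one>] that by (simp add: ideal_module_def)
  have "a \<odot>\<^bsub>E\<^esub> h \<one> = \<zero>\<^bsub>E\<^esub>" if "a \<in> J" for a
    using ha[OF J.Icarr[OF that]] h0[OF that] by simp
  then have "h \<one> \<in> tors J" using h1 by (simp add: tors_def)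
  then show ?thesis using ha[OF b(1)] hb by auto
qed

lemma annihilator_tors:
  assumes J: "ideal J A" and b: "b \<in> carrier A" and kill: "\<And>e. e \<in> tors J \<Longrightarrow> b \<odot>\<^bsub>E\<^esub> e = \<zero>\<^bsub>E\<^esub>"
  shows "b \<in> J"
  using tors_detects[OF J b] kill e\<^sub>0_nonzero by auto

lemma faithful:
  assumes a: "a \<in> carrier A" and kill: "\<And>e. e \<in> carrier E \<Longrightarrow> a \<odot>\<^bsub>E\<^esub> e = \<zero>\<^bsub>E\<^esub>"
  shows "a = \<zero>"
  using annihilator_tors[OF R.zeroideal a] kill by (auto simp: tors_def)

text \<open>Nonzero \<open>x \<in> tors \<mm>\<close> has \<open>e\<^sub>0 = c x\<close> by essentiality, and \<open>c \<notin> \<mm>\<close> is invertible.\<close>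

lemma socle:
  assumes x: "x \<in> tors \<mm>"
  shows "\<exists>c \<in> carrier A. x = c \<odot>\<^bsub>E\<^esub> e\<^sub>0"
proof (cases "x = \<zero>\<^bsub>E\<^esub>")
  case True
  then show ?thesis using e\<^sub>0_closed by (metis R.zero_closed smult_l_null)
next
  case False
  have xc: "x \<in> carrier E" using x by (simp add: tors_def)
  have "x \<in> (\<lambda>a. a \<odot>\<^bsub>E\<^esub> x) ` carrier A" using smult_one[OF xc] by (metis R.one_closed image_eqI)
  then have "e\<^sub>0 \<in> (\<lambda>a. a \<odot>\<^bsub>E\<^esub> x) ` carrier A"
    using e\<^sub>0_mem[OF cyclic_submodule[OF xc]] False by blast
  then obtain c where c: "c \<in> carrier A" "e\<^sub>0 = c \<odot>\<^bsub>E\<^esub> x" by blast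
  then have "c \<notin> \<mm>" using x e\<^sub>0_nonzero by (auto simp: tors_def)
  then have u: "c \<in> Units A" using outside_\<mm> c by blast
  then have "inv\<^bsub>A\<^esub> c \<odot>\<^bsub>E\<^esub> e\<^sub>0 = x" using c xc by (simp add: smult_assoc1[symmetric])
  then show ?thesis using u by auto
qed

definition pow\<mm> :: "nat \<Rightarrow> 'a set"
  where "pow\<mm> n = ideal_power A \<mm> n"

lemma pow\<mm>_ideal: "ideal (pow\<mm> n) A"
  unfolding pow\<mm>_def by (rule R.ideal_power_ideal[OF \<mm>_ideal])

lemma pow\<mm>_carrier: "pow\<mm> n \<subseteq> carrier A"
  by (rule subsetI) (rule ideal.Icarr[OF pow\<mm>_ideal])

lemma pow\<mm>_0: "pow\<mm> 0 = carrier A"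
  unfolding pow\<mm>_def by (rule R.ideal_power_0)

lemma pow\<mm>_Suc: "pow\<mm> (Suc n) = pow\<mm> n \<cdot>\<^bsub>A\<^esub> \<mm>"
  unfolding pow\<mm>_def by (rule R.ideal_power_Suc)

lemma pow\<mm>_antimono: "k \<le> n \<Longrightarrow> pow\<mm> n \<subseteq> pow\<mm> k"
  unfolding pow\<mm>_def by (rule R.ideal_power_antimono[OF \<mm>_ideal])

lemma tors_pow\<mm>_mono: "k \<le> n \<Longrightarrow> tors (pow\<mm> k) \<subseteq> tors (pow\<mm> n)"
  by (rule tors_antimono[OF pow\<mm>_antimono])

lemma tors_pow\<mm>_Suc:
  assumes x: "x \<in> carrier E" and kill: "\<And>b. b \<in> \<mm> \<Longrightarrow> b \<odot>\<^bsub>E\<^esub> x \<in> tors (pow\<mm> n)"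
  shows "x \<in> tors (pow\<mm> (Suc n))"
proof -
  have "c \<odot>\<^bsub>E\<^esub> x = \<zero>\<^bsub>E\<^esub>" if "c \<in> pow\<mm> n \<cdot>\<^bsub>A\<^esub> \<mm>" for c
    using that
  proof (induction c rule: ideal_prod.induct)
    case (prod i j)
    then show ?case
      using kill[of j] x ideal.Icarr[OF pow\<mm>_ideal] \<mm>_carrier by (simp add: smult_assoc1 tors_def)
  next
    case (sum s t)
    then have "s \<in> carrier A" "t \<in> carrier A"
      using R.ideal_prod_in_carrier[OF pow\<mm>_ideal \<mm>_ideal] by blast+
    then show ?case using sum x by (simp add: smult_l_distr)
  qed
  then show ?thesis using x by (simp add: tors_def pow\<mm>_Suc)
qed

text \<open>
  Noetherian induction on the annihilator of \<open>x\<close>.  For \<open>b \<in> \<mm>\<close> with \<open>bx \<noteq> 0\<close> the annihilator of \<open>bx\<close> is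
  strictly larger: by essentiality \<open>c b x = e\<^sub>0\<close> for some \<open>c\<close>, so \<open>b c\<close> kills \<open>b x\<close>, yet \<open>b c x = e\<^sub>0 \<noteq> 0\<close>.  As
  \<open>\<mm>\<close> is finitely generated, one power of \<open>\<mm>\<close> kills \<open>bx\<close> for all generators \<open>b\<close> at once.
\<close>

lemma torsion:
  assumes "x \<in> carrier E"
  shows "\<exists>n. x \<in> tors (pow\<mm> n)"
proof -
  obtain S where S: "S \<subseteq> carrier A" "finite S" "\<mm> = Idl S"
    using finetely_gen[OF \<mm>_ideal] by blast
  have S\<mm>: "S \<subseteq> \<mm>" using S R.genideal_self by blast
  have "\<forall>x \<in> carrier E. ann x = J \<longrightarrow> (\<exists>n. x \<in> tors (pow\<mm> n))" if "ideal J A" for J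
    using that
  proof (induction rule: ideal_induct)
    case (larger J)
    show ?case
    proof (intro ballI impI)
      fix x assume x: "x \<in> carrier E" and J: "ann x = J"
      have "\<exists>n. b \<odot>\<^bsub>E\<^esub> x \<in> tors (pow\<mm> n)" if b: "b \<in> \<mm>" for b
      proof -
        have bc: "b \<in> carrier A" using b \<mm>_carrier by blast
        have bx: "b \<odot>\<^bsub>E\<^esub> x \<in> carrier E" using bc x by blast
        have le: "ann x \<subseteq> ann (b \<odot>\<^bsub>E\<^esub> x)"
        proof
          fix a assume "a \<in> ann x"
          then have "a \<in> carrier A" "b \<odot>\<^bsub>E\<^esub> (a \<odot>\<^bsub>E\<^esub> x) = \<zero>\<^bsub>E\<^esub>" using bc by (simp_all add: ann_def)
          then show "a \<in> ann (b \<odot>\<^bsub>E\<^esub> x)" using bc x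
            by (simp add: ann_def smult_assoc1[symmetric] R.m_comm)
        qed
        show ?thesis
        proof (cases "ann (b \<odot>\<^bsub>E\<^esub> x) = ann x")
          case False
          then show ?thesis using larger.IH[of "ann (b \<odot>\<^bsub>E\<^esub> x)"] le J ann_ideal[OF bx] bx by blast
        next
          case True
          have "b \<odot>\<^bsub>E\<^esub> x = \<zero>\<^bsub>E\<^esub>"
          proof (rule ccontr)
            assume nz: "b \<odot>\<^bsub>E\<^esub> x \<noteq> \<zero>\<^bsub>E\<^esub>"
            have "b \<odot>\<^bsub>E\<^esub> x \<in> (\<lambda>a. a \<odot>\<^bsub>E\<^esub> (b \<odot>\<^bsub>E\<^esub> x)) ` carrier A"
              using smult_one[OF bx] by (metis R.one_closed image_eqI)
            then have "e\<^sub>0 \<in> (\<lambda>a. a \<odot>\<^bsub>E\<^esub> (b \<odot>\<^bsub>E\<^esub> x)) ` carrier A"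
              using e\<^sub>0_mem[OF cyclic_submodule[OF bx]] nz by blast
            then obtain c where c: "c \<in> carrier A" "e\<^sub>0 = c \<odot>\<^bsub>E\<^esub> (b \<odot>\<^bsub>E\<^esub> x)" by blast
            have "(b \<otimes> c) \<odot>\<^bsub>E\<^esub> (b \<odot>\<^bsub>E\<^esub> x) = \<zero>\<^bsub>E\<^esub>"
              using \<mm>_e\<^sub>0[OF b] c bc bx by (simp add: smult_assoc1)
            then have "b \<otimes> c \<in> ann x" using True c bc by (auto simp: ann_def)
            then have "c \<odot>\<^bsub>E\<^esub> (b \<odot>\<^bsub>E\<^esub> x) = \<zero>\<^bsub>E\<^esub>"
              using c bc x by (simp add: ann_def smult_assoc1[symmetric] R.m_comm)
            then show False using c e\<^sub>0_nonzero by simp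
          qed
          then have "b \<odot>\<^bsub>E\<^esub> x \<in> tors (pow\<mm> 0)" by (simp add: tors_def pow\<mm>_0)
          then show ?thesis by blast
        qed
      qed
      then have "\<forall>b \<in> S. \<exists>n. b \<odot>\<^bsub>E\<^esub> x \<in> tors (pow\<mm> n)" using S\<mm> by blast
      then obtain k where k: "\<And>b. b \<in> S \<Longrightarrow> b \<odot>\<^bsub>E\<^esub> x \<in> tors (pow\<mm> (k b))" by metis
      define n where "n = Max (insert 0 (k ` S))"
      have "b \<odot>\<^bsub>E\<^esub> x \<in> tors (pow\<mm> n)" if "b \<in> S" for b
        using k[OF that] tors_pow\<mm>_mono[of "k b" n] S(2) that by (auto simp: n_def)
      then have "S \<subseteq> {a \<in> carrier A. a \<odot>\<^bsub>E\<^esub> x \<in> tors (pow\<mm> n)}" using S(1) by blast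
      then have "Idl S \<subseteq> {a \<in> carrier A. a \<odot>\<^bsub>E\<^esub> x \<in> tors (pow\<mm> n)}"
        by (intro R.genideal_minimal transporter_ideal tors_submodule x pow\<mm>_carrier)
      then have "\<mm> \<subseteq> {a \<in> carrier A. a \<odot>\<^bsub>E\<^esub> x \<in> tors (pow\<mm> n)}" using S(3) by simp
      then have "x \<in> tors (pow\<mm> (Suc n))" by (intro tors_pow\<mm>_Suc x) blast
      then show "\<exists>n. x \<in> tors (pow\<mm> n)" by blast
    qed
  qed
  then show ?thesis using assms ann_ideal by blast
qed

text \<open>
  For \<open>J = \<mm>\<^sup>n\<close> this computes the homomorphisms from \<open>tors (\<mm>\<^sup>n)\<close> to \<open>E\<close> without counting lengths.  By
  Noetherian induction on \<open>J\<close>: choose \<open>b \<notin> J\<close> with \<open>\<mm> b \<subseteq> J\<close> and put \<open>J' = J + Ab\<close>.  Multiplication by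
  \<open>b\<close> maps \<open>tors J\<close> into the socle \<open>A e\<^sub>0\<close>, with kernel \<open>tors J'\<close>.  If \<open>f\<close> agrees with \<open>a'\<close> on \<open>tors J'\<close>, then
  \<open>f - a'\<close> factors through \<open>b\<close>; the induced map on the socle is multiplication by some \<open>t\<close>, so
  \<open>f = a' + tb\<close>.
\<close>

lemma hom_tors_is_smult:
  assumes "ideal J A" and "pow\<mm> n \<subseteq> J" and "f \<in> module_homs A (E\<lparr>carrier := tors J\<rparr>) E"
  shows "\<exists>a \<in> carrier A. \<forall>e \<in> tors J. f e = a \<odot>\<^bsub>E\<^esub> e"
  using assms
proof (induction arbitrary: f rule: ideal_induct)
  case (larger J)
  interpret J: ideal J A by (rule larger.hyps)
  note f = larger.prems(2)
  have Jc: "J \<subseteq> carrier A" by (rule J.a_subset)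
  have T: "submodule (tors J) A E" by (rule tors_submodule[OF Jc])
  have Tc: "e \<in> carrier E" if "e \<in> tors J" for e using that by (simp add: tors_def)
  have f0: "f \<zero>\<^bsub>E\<^esub> = \<zero>\<^bsub>E\<^esub>"
    using module_homs_zero[OF submodule_module[OF T] module_axioms f] by simp
  have fc: "f e \<in> carrier E" if "e \<in> tors J" for e using module_homs_closed[OF f] that by simp
  have fs: "f (a \<odot>\<^bsub>E\<^esub> e) = a \<odot>\<^bsub>E\<^esub> f e" if "a \<in> carrier A" "e \<in> tors J" for a e
    using module_homs_smult[OF f that(1)] that by simp
  show ?case
  proof (cases "\<one> \<in> J")
    case True
    have "f e = \<zero> \<odot>\<^bsub>E\<^esub> e" if "e \<in> tors J" for e
    proof -
      have "e = \<one> \<odot>\<^bsub>E\<^esub> e" using Tc[OF that] by simp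
      also have "\<dots> = \<zero>\<^bsub>E\<^esub>" using that True unfolding tors_def by blast
      finally show ?thesis using f0 by simp
    qed
    then show ?thesis by blast
  next
    case False
    \<comment> \<open>An element \<open>b \<notin> J\<close> of the last power of \<open>\<mm>\<close> not contained in \<open>J\<close> satisfies \<open>\<mm> b \<subseteq> J\<close>.\<close>
    define i where "i = (LEAST i. pow\<mm> i \<subseteq> J)"
    have iJ: "pow\<mm> i \<subseteq> J" unfolding i_def by (rule LeastI) (rule larger.prems)
    have "i \<noteq> 0"
    proof
      assume "i = 0"
      then show False using iJ False by (auto simp: pow\<mm>_0)
    qed
    then obtain k where k: "i = Suc k" using not0_implies_Suc by blast
    then have "\<not> pow\<mm> k \<subseteq> J" using not_less_Least[of k "\<lambda>i. pow\<mm> i \<subseteq> J"] i_def by auto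
    then obtain b where b: "b \<in> pow\<mm> k" "b \<notin> J" by blast
    have bc: "b \<in> carrier A" using b pow\<mm>_carrier by blast
    have \<mm>b: "c \<otimes> b \<in> J" if "c \<in> \<mm>" for c
    proof -
      have "b \<otimes> c \<in> pow\<mm> i"
        using b that ideal_prod.prod[of b "pow\<mm> k" c \<mm> A] by (simp add: k pow\<mm>_Suc)
      then show ?thesis using iJ that bc \<mm>_carrier R.m_comm by auto
    qed
    define J' where "J' = Idl (insert b J)"
    have J': "ideal J' A" unfolding J'_def using bc Jc by (intro R.genideal_ideal) auto
    have JJ': "J \<subset> J'" using R.genideal_self[of "insert b J"] bc Jc b by (auto simp: J'_def)
    have T': "tors J' = {e \<in> tors J. b \<odot>\<^bsub>E\<^esub> e = \<zero>\<^bsub>E\<^esub>}"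
      unfolding J'_def using bc Jc by (subst tors_genideal) (auto simp: tors_def)
    have f': "f \<in> module_homs A (E\<lparr>carrier := tors J'\<rparr>) E"
      using module_homs_restrict[OF f, of "tors J'"] T' by simp
    have "pow\<mm> n \<subseteq> J'" using larger.prems(1) JJ' by blast
    from larger.IH[OF J' JJ' this f'] obtain a' where a': "a' \<in> carrier A"
      and fa': "\<And>e. e \<in> tors J' \<Longrightarrow> f e = a' \<odot>\<^bsub>E\<^esub> e" by auto
    \<comment> \<open>Modulo \<open>tors J'\<close> the module \<open>tors J\<close> is spanned by any preimage of \<open>e\<^sub>0\<close> under \<open>b\<close>, so the
      value of \<open>f - a'\<close> on it determines \<open>t\<close>.\<close>
    obtain e1 where e1: "e1 \<in> tors J" "b \<odot>\<^bsub>E\<^esub> e1 = e\<^sub>0"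
      using tors_detects[OF larger.hyps bc b(2)] by blast
    define y where "y = f e1 \<ominus>\<^bsub>E\<^esub> a' \<odot>\<^bsub>E\<^esub> e1"
    have yc: "y \<in> carrier E" using fc e1 Tc a' by (simp add: y_def)
    have "c \<odot>\<^bsub>E\<^esub> y = \<zero>\<^bsub>E\<^esub>" if c: "c \<in> \<mm>" for c
    proof -
      have cc: "c \<in> carrier A" using c \<mm>_carrier by blast
      have "b \<odot>\<^bsub>E\<^esub> (c \<odot>\<^bsub>E\<^esub> e1) = c \<odot>\<^bsub>E\<^esub> e\<^sub>0"
        using bc cc e1 Tc by (metis R.m_comm smult_assoc1)
      then have "c \<odot>\<^bsub>E\<^esub> e1 \<in> tors J'"
        using T' \<mm>_e\<^sub>0[OF c] submoduleE(4)[OF T cc e1(1)] by simp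
      then have "c \<odot>\<^bsub>E\<^esub> f e1 = a' \<odot>\<^bsub>E\<^esub> (c \<odot>\<^bsub>E\<^esub> e1)" using fa' fs[OF cc e1(1)] by simp
      also have "\<dots> = c \<odot>\<^bsub>E\<^esub> (a' \<odot>\<^bsub>E\<^esub> e1)" using a' cc e1 Tc by (metis R.m_comm smult_assoc1)
      finally show ?thesis
        using cc a' e1 fc Tc by (simp add: y_def smult_minus_distr diff_zero_iff)
    qed
    then obtain t where t: "t \<in> carrier A" "y = t \<odot>\<^bsub>E\<^esub> e\<^sub>0"
      using socle[of y] yc by (auto simp: tors_def)
    have "f e = (a' \<oplus> t \<otimes> b) \<odot>\<^bsub>E\<^esub> e" if e: "e \<in> tors J" for e
    proof -
      have "c \<odot>\<^bsub>E\<^esub> (b \<odot>\<^bsub>E\<^esub> e) = \<zero>\<^bsub>E\<^esub>" if "c \<in> \<mm>" for c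
        using \<mm>b[OF that] e bc \<mm>_carrier[OF that] by (simp add: tors_def smult_assoc1[symmetric])
      then have "b \<odot>\<^bsub>E\<^esub> e \<in> tors \<mm>" using bc e by (simp add: tors_def)
      then obtain u where u: "u \<in> carrier A" "b \<odot>\<^bsub>E\<^esub> e = u \<odot>\<^bsub>E\<^esub> e\<^sub>0" using socle by blast
      have ue: "u \<odot>\<^bsub>E\<^esub> e1 \<in> tors J" using submoduleE(4)[OF T u(1) e1(1)] .
      define z where "z = e \<ominus>\<^bsub>E\<^esub> u \<odot>\<^bsub>E\<^esub> e1"
      have zT: "z \<in> tors J" unfolding z_def by (rule submodule_diff[OF T e ue])
      have "b \<odot>\<^bsub>E\<^esub> (u \<odot>\<^bsub>E\<^esub> e1) = u \<odot>\<^bsub>E\<^esub> e\<^sub>0" using bc u e1 Tc by (metis R.m_comm smult_assoc1)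
      then have "b \<odot>\<^bsub>E\<^esub> z = \<zero>\<^bsub>E\<^esub>"
        using bc u e e1 Tc e\<^sub>0_closed by (simp add: z_def smult_minus_distr diff_zero_iff)
      then have fz: "f z = a' \<odot>\<^bsub>E\<^esub> z" using fa' T' zT by simp
      have ez: "e = z \<oplus>\<^bsub>E\<^esub> u \<odot>\<^bsub>E\<^esub> e1"
        using Tc[OF e] Tc[OF ue] by (simp add: z_def a_minus_def M.a_assoc M.l_neg)
      have fe1: "f e1 = y \<oplus>\<^bsub>E\<^esub> a' \<odot>\<^bsub>E\<^esub> e1"
        using fc[OF e1(1)] a' Tc[OF e1(1)] by (simp add: y_def a_minus_def M.a_assoc M.l_neg)
      have "f e = f z \<oplus>\<^bsub>E\<^esub> u \<odot>\<^bsub>E\<^esub> f e1"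
        using ez module_homs_add[OF f, of z "u \<odot>\<^bsub>E\<^esub> e1"] zT ue fs[OF u(1) e1(1)] by simp
      also have "\<dots> = a' \<odot>\<^bsub>E\<^esub> z \<oplus>\<^bsub>E\<^esub> (u \<odot>\<^bsub>E\<^esub> y \<oplus>\<^bsub>E\<^esub> u \<odot>\<^bsub>E\<^esub> (a' \<odot>\<^bsub>E\<^esub> e1))"
        using fz fe1 u a' yc Tc[OF e1(1)] by (simp add: smult_r_distr)
      also have "u \<odot>\<^bsub>E\<^esub> (a' \<odot>\<^bsub>E\<^esub> e1) = a' \<odot>\<^bsub>E\<^esub> (u \<odot>\<^bsub>E\<^esub> e1)"
        using u a' Tc[OF e1(1)] by (metis R.m_comm smult_assoc1)
      also have "u \<odot>\<^bsub>E\<^esub> y = t \<odot>\<^bsub>E\<^esub> (b \<odot>\<^bsub>E\<^esub> e)"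
        using t u e\<^sub>0_closed by (metis R.m_comm smult_assoc1)
      also have "a' \<odot>\<^bsub>E\<^esub> z \<oplus>\<^bsub>E\<^esub> (t \<odot>\<^bsub>E\<^esub> (b \<odot>\<^bsub>E\<^esub> e) \<oplus>\<^bsub>E\<^esub> a' \<odot>\<^bsub>E\<^esub> (u \<odot>\<^bsub>E\<^esub> e1))
          = a' \<odot>\<^bsub>E\<^esub> (z \<oplus>\<^bsub>E\<^esub> u \<odot>\<^bsub>E\<^esub> e1) \<oplus>\<^bsub>E\<^esub> t \<odot>\<^bsub>E\<^esub> (b \<odot>\<^bsub>E\<^esub> e)"
        using a' t bc Tc[OF e] Tc[OF zT] Tc[OF ue] by (simp add: smult_r_distr M.a_ac)
      also have "\<dots> = (a' \<oplus> t \<otimes> b) \<odot>\<^bsub>E\<^esub> e"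
        using ez a' t bc Tc[OF e] by (simp add: smult_l_distr smult_assoc1)
      finally show ?thesis .
    qed
    moreover have "a' \<oplus> t \<otimes> b \<in> carrier A" using a' t bc by simp
    ultimately show ?thesis by blast
  qed
qed

end

section \<open>Artinian submodules\<close>

context module
begin

definition artinian :: "'c set \<Rightarrow> bool"
  where "artinian N \<longleftrightarrow> (\<forall>W :: nat \<Rightarrow> 'c set.
    (\<forall>n. submodule (W n) R M \<and> W n \<subseteq> N \<and> W (Suc n) \<subseteq> W n) \<longrightarrow> (\<exists>n. \<forall>k \<ge> n. W k = W n))"

lemma artinianD:
  assumes "artinian N" and "\<And>n. submodule (W n) R M" and "\<And>n. W n \<subseteq> N" and "\<And>n. W (Suc n) \<subseteq> W n"
  shows "\<exists>n. \<forall>k \<ge> n. W k = W n"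
  using assms unfolding artinian_def by simp

lemma artinian_minimal:
  assumes N: "artinian N" and F: "F \<noteq> {}" and sub: "\<And>V. V \<in> F \<Longrightarrow> submodule V R M \<and> V \<subseteq> N"
  shows "\<exists>V \<in> F. \<forall>V' \<in> F. V' \<subseteq> V \<longrightarrow> V' = V"
proof (rule ccontr)
  assume "\<not> ?thesis"
  then have "\<forall>V \<in> F. \<exists>V' \<in> F. V' \<subset> V" by blast
  then obtain s where s: "\<And>V. V \<in> F \<Longrightarrow> s V \<in> F \<and> s V \<subset> V" by metis
  obtain V0 where "V0 \<in> F" using F by blast
  define W where "W n = (s ^^ n) V0" for n
  have WF: "W n \<in> F" for n
    by (induction n) (use \<open>V0 \<in> F\<close> s in \<open>auto simp: W_def\<close>)
  have lt: "W (Suc n) \<subset> W n" for n using s[OF WF[of n]] by (simp add: W_def)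
  have "\<exists>n. \<forall>k \<ge> n. W k = W n"
    by (rule artinianD[OF N]) (use sub WF lt in blast)+
  then obtain n where n: "\<And>k. k \<ge> n \<Longrightarrow> W k = W n" by blast
  have "W (Suc n) = W n" by (rule n) simp
  then show False using lt[of n] by blast
qed

text \<open>
  Under duality the filtration of a power series ideal by order corresponds to the filtration of \<open>W\<close>
  by the kernels of \<open>x\<^sup>j\<close>; its \<open>j\<close>-th graded piece is embedded by \<open>x\<^sup>j\<close> into the kernel of \<open>x\<close>, and
  \<open>layer x j W\<close> is that image.  It plays the part of the ideal of leading coefficients in Hilbert's
  basis theorem.
\<close>

definition layer :: "'a \<Rightarrow> nat \<Rightarrow> 'c set \<Rightarrow> 'c set"
  where "layer x j W = (\<lambda>e. x [^] j \<odot>\<^bsub>M\<^esub> e) ` {e \<in> W. x [^] Suc j \<odot>\<^bsub>M\<^esub> e = \<zero>\<^bsub>M\<^esub>}"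

lemma layer_submodule:
  assumes "x \<in> carrier R" and "submodule W R M"
  shows "submodule (layer x j W) R M"
  unfolding layer_def using assms
  by (intro hom_image_submodule hom_kernel_submodule module_axioms smult_hom R.nat_pow_closed)

lemma layer_mono: "W' \<subseteq> W \<Longrightarrow> layer x j W' \<subseteq> layer x j W"
  by (auto simp: layer_def)

lemma layer_Suc:
  assumes x: "x \<in> carrier R" and W: "submodule W R M"
  shows "layer x (Suc j) W \<subseteq> layer x j W"
proof
  note WE = submoduleE[OF W]
  fix y assume "y \<in> layer x (Suc j) W"
  then obtain e where e: "e \<in> W" "x [^] Suc (Suc j) \<odot>\<^bsub>M\<^esub> e = \<zero>\<^bsub>M\<^esub>" "y = x [^] Suc j \<odot>\<^bsub>M\<^esub> e"
    by (auto simp: layer_def)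
  have ec: "e \<in> carrier M" using e WE by blast
  have "x [^] Suc j \<odot>\<^bsub>M\<^esub> (x \<odot>\<^bsub>M\<^esub> e) = \<zero>\<^bsub>M\<^esub>" "y = x [^] j \<odot>\<^bsub>M\<^esub> (x \<odot>\<^bsub>M\<^esub> e)"
    using e ec x by (simp_all add: smult_assoc1[symmetric])
  moreover have "x \<odot>\<^bsub>M\<^esub> e \<in> W" using WE(4) x e by blast
  ultimately show "y \<in> layer x j W" unfolding layer_def by blast
qed

lemma layer_antimono:
  assumes x: "x \<in> carrier R" and W: "submodule W R M" and "i \<le> j"
  shows "layer x j W \<subseteq> layer x i W"
  using assms(3) by (induction j rule: dec_induct) (use layer_Suc[OF x W] in blast)+

text \<open>
  By induction on the power of \<open>x\<close> killing \<open>e\<close>: correct \<open>e\<close> by an element of \<open>W'\<close> with the same image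
  in the top layer.
\<close>

lemma layers_determine:
  assumes x: "x \<in> carrier R" and W: "submodule W R M" and W': "submodule W' R M" "W' \<subseteq> W"
    and tors: "\<And>e. e \<in> W \<Longrightarrow> \<exists>j. x [^] (j :: nat) \<odot>\<^bsub>M\<^esub> e = \<zero>\<^bsub>M\<^esub>"
    and layers: "\<And>j. layer x j W \<subseteq> layer x j W'"
  shows "W = W'"
proof -
  have Wc: "e \<in> carrier M" if "e \<in> W" for e using submoduleE(1)[OF W] that by blast
  have "\<forall>e \<in> W. x [^] j \<odot>\<^bsub>M\<^esub> e = \<zero>\<^bsub>M\<^esub> \<longrightarrow> e \<in> W'" for j :: nat
  proof (induction j)
    case 0
    then show ?case using submodule_zero[OF W'(1)] Wc by auto
  next
    case (Suc j)
    show ?case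
    proof (intro ballI impI)
      fix e assume e: "e \<in> W" "x [^] Suc j \<odot>\<^bsub>M\<^esub> e = \<zero>\<^bsub>M\<^esub>"
      then have "x [^] j \<odot>\<^bsub>M\<^esub> e \<in> layer x j W'" using layers[of j] unfolding layer_def by blast
      then obtain e' where e': "e' \<in> W'" "x [^] j \<odot>\<^bsub>M\<^esub> e = x [^] j \<odot>\<^bsub>M\<^esub> e'"
        by (auto simp: layer_def)
      have e'W: "e' \<in> W" using e' W' by blast
      have "x [^] j \<odot>\<^bsub>M\<^esub> (e \<ominus>\<^bsub>M\<^esub> e') = \<zero>\<^bsub>M\<^esub>"
        using e' x Wc[OF e(1)] Wc[OF e'W] by (simp add: smult_minus_distr diff_zero_iff)
      then have "e \<ominus>\<^bsub>M\<^esub> e' \<in> W'" using Suc submodule_diff[OF W e(1) e'W] by blast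
      then have "(e \<ominus>\<^bsub>M\<^esub> e') \<oplus>\<^bsub>M\<^esub> e' \<in> W'" using submoduleE(5)[OF W'(1)] e' by blast
      then show "e \<in> W'"
        using Wc[OF e(1)] Wc[OF e'W] by (simp add: a_minus_def M.a_assoc M.l_neg)
    qed
  qed
  then show ?thesis using tors W' by blast
qed

text \<open>
  Dual form of Hilbert's basis theorem.  The layers of a descending chain form a double sequence of
  submodules of the kernel of \<open>x\<close> that decreases in both indices.  Its diagonal becomes stationary at some
  \<open>k0\<close>, which settles all layers \<open>j \<ge> k0\<close> at once; the finitely many rows below \<open>k0\<close> become stationary one
  by one.
\<close>

lemma artinian_lift:
  assumes x: "x \<in> carrier R" and N: "N \<subseteq> carrier M"
    and tors: "\<And>e. e \<in> N \<Longrightarrow> \<exists>j. x [^] (j :: nat) \<odot>\<^bsub>M\<^esub> e = \<zero>\<^bsub>M\<^esub>"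
    and art: "artinian {e \<in> N. x \<odot>\<^bsub>M\<^esub> e = \<zero>\<^bsub>M\<^esub>}"
  shows "artinian N"
  unfolding artinian_def
proof (intro allI impI)
  fix W :: "nat \<Rightarrow> 'c set"
  assume "\<forall>n. submodule (W n) R M \<and> W n \<subseteq> N \<and> W (Suc n) \<subseteq> W n"
  then have W: "submodule (W n) R M" "W n \<subseteq> N" "W (Suc n) \<subseteq> W n" for n by auto
  have anti: "W k \<subseteq> W n" if "n \<le> k" for n k
    using that by (induction k rule: dec_induct) (use W(3) in blast)+
  have L: "layer x j (W k) \<subseteq> layer x i (W n)" if "i \<le> j" "n \<le> k" for i j n k
    using layer_antimono[OF x W(1) that(1)] layer_mono[OF anti[OF that(2)]] by blast
  have LN: "layer x j (W n) \<subseteq> {e \<in> N. x \<odot>\<^bsub>M\<^esub> e = \<zero>\<^bsub>M\<^esub>}" for j n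
  proof
    fix y assume "y \<in> layer x j (W n)"
    then obtain e where e: "e \<in> W n" "x [^] Suc j \<odot>\<^bsub>M\<^esub> e = \<zero>\<^bsub>M\<^esub>" "y = x [^] j \<odot>\<^bsub>M\<^esub> e"
      by (auto simp: layer_def)
    have ec: "e \<in> carrier M" using e W N by blast
    have "y \<in> W n" using e submoduleE(4)[OF W(1)] x by simp
    moreover have "x \<odot>\<^bsub>M\<^esub> y = \<zero>\<^bsub>M\<^esub>"
      using e ec x by (simp add: smult_assoc1[symmetric] R.m_comm)
    ultimately show "y \<in> {e \<in> N. x \<odot>\<^bsub>M\<^esub> e = \<zero>\<^bsub>M\<^esub>}" using W(2) by blast
  qed
  have "\<exists>n. \<forall>k \<ge> n. layer x k (W k) = layer x n (W n)"
    by (rule artinianD[OF art]) (use layer_submodule[OF x W(1)] LN L in auto)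
  then obtain k0 where k0: "\<And>k. k \<ge> k0 \<Longrightarrow> layer x k (W k) = layer x k0 (W k0)" by blast
  have "\<exists>n. \<forall>k \<ge> n. layer x j (W k) = layer x j (W n)" for j
    by (rule artinianD[OF art]) (use layer_submodule[OF x W(1)] LN L in auto)
  then obtain s where s: "\<And>j k. k \<ge> s j \<Longrightarrow> layer x j (W k) = layer x j (W (s j))" by metis
  define n where "n = Max (insert k0 (s ` {..<k0}))"
  have nk0: "k0 \<le> n" and ns: "\<And>j. j < k0 \<Longrightarrow> s j \<le> n" by (auto simp: n_def)
  have stable: "layer x j (W n) \<subseteq> layer x j (W k)" if k: "k \<ge> n" for j k
  proof (cases "j < k0")
    case True
    then have "s j \<le> n" "s j \<le> k" using ns k le_trans by blast+
    then show ?thesis using s[of j n] s[of j k] by simp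
  next
    case False
    have "layer x j (W n) \<subseteq> layer x k0 (W k0)" using L[of k0 j k0 n] False nk0 by simp
    also have "\<dots> = layer x (max j k) (W (max j k))" using k0[of "max j k"] False by simp
    also have "\<dots> \<subseteq> layer x j (W k)" using L[of j "max j k" k "max j k"] by simp
    finally show ?thesis .
  qed
  have "W k = W n" if k: "k \<ge> n" for k
  proof -
    have "W n = W k"
    proof (rule layers_determine[OF x W(1) W(1) anti[OF k] _ stable[OF k]])
      show "\<exists>j. x [^] (j :: nat) \<odot>\<^bsub>M\<^esub> e = \<zero>\<^bsub>M\<^esub>" if "e \<in> W n" for e
        using tors W(2) that by blast
    qed
    then show ?thesis ..
  qed
  then show "\<exists>n. \<forall>k \<ge> n. W k = W n" by blast
qed

end

context residue_hull
begin

lemma pow_torsion: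
  assumes x: "x \<in> \<mm>" and e: "e \<in> carrier E"
  shows "\<exists>j. x [^] (j :: nat) \<odot>\<^bsub>E\<^esub> e = \<zero>\<^bsub>E\<^esub>"
proof -
  obtain n where "e \<in> tors (pow\<mm> n)" using torsion[OF e] by blast
  moreover have "x [^] n \<in> pow\<mm> n" unfolding pow\<mm>_def by (rule R.ideal_power_pow[OF \<mm>_ideal x])
  ultimately show ?thesis by (auto simp: tors_def)
qed

lemma artinian_socle: "artinian (tors \<mm>)"
  unfolding artinian_def
proof (intro allI impI)
  fix W :: "nat \<Rightarrow> 'e set"
  assume "\<forall>n. submodule (W n) A E \<and> W n \<subseteq> tors \<mm> \<and> W (Suc n) \<subseteq> W n"
  then have W: "submodule (W n) A E" "W n \<subseteq> tors \<mm>" "W (Suc n) \<subseteq> W n" for n by auto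
  have anti: "W k \<subseteq> W n" if "n \<le> k" for n k
    using that by (induction k rule: dec_induct) (use W(3) in blast)+
  show "\<exists>n. \<forall>k \<ge> n. W k = W n"
  proof (cases "\<exists>n. W n = {\<zero>\<^bsub>E\<^esub>}")
    case True
    then obtain n where n: "W n = {\<zero>\<^bsub>E\<^esub>}" by blast
    have "W k = W n" if "k \<ge> n" for k
      using anti[OF that] submodule_zero[OF W(1)[of k]] unfolding n by blast
    then show ?thesis by blast
  next
    case False
    have "W k = tors \<mm>" for k
    proof
      have "e\<^sub>0 \<in> W k" using e\<^sub>0_mem[OF W(1)] False by blast
      then have "c \<odot>\<^bsub>E\<^esub> e\<^sub>0 \<in> W k" if "c \<in> carrier A" for c
        using submoduleE(4)[OF W(1)] that by blast
      then show "tors \<mm> \<subseteq> W k" using socle by blast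
    qed (rule W(2))
    then show ?thesis by simp
  qed
qed

text \<open>
  Start with the simple module \<open>tors \<mm>\<close>, given by finitely many equations \<open>x e = 0\<close>, and remove the
  equations one at a time.
\<close>

theorem artinian: "artinian (carrier E)"
proof -
  obtain S where S: "S \<subseteq> carrier A" "finite S" "\<mm> = Idl S"
    using finetely_gen[OF \<mm>_ideal] by blast
  have S\<mm>: "S \<subseteq> \<mm>" using R.genideal_self[OF S(1)] S(3) by simp
  have "artinian (tors (S - T))" if "finite T" "T \<subseteq> S" for T
    using that
  proof (induction T rule: finite_induct)
    case empty
    then show ?case using artinian_socle tors_genideal[OF S(1)] S(3) by simp
  next
    case (insert x T)
    have x: "x \<in> \<mm>" "x \<in> carrier A" using insert.prems S\<mm> S(1) by blast+
    have "tors (S - T) = {e \<in> tors (S - insert x T). x \<odot>\<^bsub>E\<^esub> e = \<zero>\<^bsub>E\<^esub>}"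
      using insert.prems insert.hyps by (auto simp: tors_def)
    then have art: "artinian {e \<in> tors (S - insert x T). x \<odot>\<^bsub>E\<^esub> e = \<zero>\<^bsub>E\<^esub>}"
      using insert by simp
    show ?case
      by (rule artinian_lift[OF x(2) _ _ art]) (use pow_torsion[OF x(1)] in \<open>auto simp: tors_def\<close>)
  qed
  from this[OF S(2)] have "artinian (tors {})" by simp
  then show ?thesis by (simp add: tors_def)
qed

end

section \<open>Adic completions\<close>

context cring
begin

lemma ideal_power_quotient_cring: "ideal I R \<Longrightarrow> cring (R Quot ideal_power R I n)"
  by (rule ideal.quotient_is_cring[OF ideal_power_ideal is_cring])

lemma quotient_add:
  "ideal I R \<Longrightarrow> a \<in> carrier R \<Longrightarrow> b \<in> carrier R \<Longrightarrow>
    (I +> a) \<oplus>\<^bsub>R Quot I\<^esub> (I +> b) = I +> (a \<oplus> b)"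
  by (simp add: FactRing_def ideal.a_rcos_sum)

lemma quotient_mult:
  "ideal I R \<Longrightarrow> a \<in> carrier R \<Longrightarrow> b \<in> carrier R \<Longrightarrow>
    (I +> a) \<otimes>\<^bsub>R Quot I\<^esub> (I +> b) = I +> (a \<otimes> b)"
  by (simp add: FactRing_def ideal.rcoset_mult_add)

lemma quotient_carrier:
  "X \<in> carrier (R Quot I) \<longleftrightarrow> (\<exists>a \<in> carrier R. X = I +> a)"
  by (auto simp: FactRing_def A_RCOSETS_def')

lemma coset_eq_of_mem:
  assumes "ideal I R" and "a \<in> carrier R" and "b \<in> I +> a"
  shows "I +> a = I +> b"
  using assms by (intro a_repr_independence additive_subgroup.a_subgroup ideal.axioms(1))

lemma coset_self: "ideal I R \<Longrightarrow> a \<in> carrier R \<Longrightarrow> a \<in> I +> a"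
  by (simp add: abelian_subgroup.a_rcos_self abelian_subgroupI3 ideal.axioms(1) abelian_group_axioms)

lemma coset_mono: "I \<subseteq> J \<Longrightarrow> I +> a \<subseteq> J +> a"
  by (auto simp: a_r_coset_def')

text \<open>
  Elements of the completion are handled through coherent sequences of representatives in \<open>R\<close>.
\<close>

lemma completion_representatives:
  assumes I: "ideal I R" and x: "x \<in> carrier (adic_completion R I)"
  shows "\<exists>a. (\<forall>n. a n \<in> carrier R) \<and> (\<forall>n. x n = ideal_power R I n +> a n) \<and>
    (\<forall>n. a (Suc n) \<in> ideal_power R I n +> a n)"
proof -
  have "\<forall>n. \<exists>a \<in> carrier R. x n = ideal_power R I n +> a"
    using x by (simp add: adic_completion_def quotient_carrier)
  then obtain a where a: "\<And>n. a n \<in> carrier R" "\<And>n. x n = ideal_power R I n +> a n" by metis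
  have "a (Suc n) \<in> x n" for n
  proof -
    have "a (Suc n) \<in> x (Suc n)" unfolding a(2) by (rule coset_self[OF ideal_power_ideal[OF I] a(1)])
    then show ?thesis using x by (auto simp: adic_completion_def)
  qed
  then have "\<And>n. a (Suc n) \<in> ideal_power R I n +> a n" by (simp only: a(2))
  with a show ?thesis by blast
qed

lemma completion_carrierI:
  assumes I: "ideal I R" and a: "\<And>n. a n \<in> carrier R" and "\<And>n. a (Suc n) \<in> ideal_power R I n +> a n"
  shows "(\<lambda>n. ideal_power R I n +> a n) \<in> carrier (adic_completion R I)"
proof -
  have "ideal_power R I (Suc n) +> a (Suc n) \<subseteq> ideal_power R I n +> a n" for n
  proof -
    have "ideal_power R I (Suc n) +> a (Suc n) \<subseteq> ideal_power R I n +> a (Suc n)"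
      by (rule coset_mono) (rule ideal_power_antimono[OF I], simp)
    also have "\<dots> = ideal_power R I n +> a n"
      using coset_eq_of_mem[OF ideal_power_ideal[OF I] a assms(3)] by simp
    finally show ?thesis .
  qed
  then show ?thesis unfolding adic_completion_def using a quotient_carrier by (auto simp del: nat_pow_Suc)
qed

lemma completion_mult:
  "x \<otimes>\<^bsub>adic_completion R I\<^esub> y = (\<lambda>n. x n \<otimes>\<^bsub>R Quot ideal_power R I n\<^esub> y n)"
  by (simp add: adic_completion_def)

lemma completion_add:
  "x \<oplus>\<^bsub>adic_completion R I\<^esub> y = (\<lambda>n. x n \<oplus>\<^bsub>R Quot ideal_power R I n\<^esub> y n)"
  by (simp add: adic_completion_def)

lemma mem_coset_iff:
  assumes I: "ideal I R" and a: "a \<in> carrier R" and b: "b \<in> carrier R"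
  shows "b \<in> I +> a \<longleftrightarrow> b \<ominus> a \<in> I"
proof -
  have "b \<ominus> a \<in> I \<longleftrightarrow> I +> b = I +> a" by (rule quotient_eq_iff_same_a_r_cos[OF I b a])
  then show ?thesis using coset_eq_of_mem[OF I a] coset_self[OF I b] by metis
qed

lemma completion_mult_closed:
  assumes I: "ideal I R" and x: "x \<in> carrier (adic_completion R I)" and y: "y \<in> carrier (adic_completion R I)"
  shows "x \<otimes>\<^bsub>adic_completion R I\<^esub> y \<in> carrier (adic_completion R I)"
proof -
  obtain a where a: "\<And>n. a n \<in> carrier R" "\<And>n. x n = ideal_power R I n +> a n"
    "\<And>n. a (Suc n) \<in> ideal_power R I n +> a n" using completion_representatives[OF I x] by blast
  obtain b where b: "\<And>n. b n \<in> carrier R" "\<And>n. y n = ideal_power R I n +> b n"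
    "\<And>n. b (Suc n) \<in> ideal_power R I n +> b n" using completion_representatives[OF I y] by blast
  have "x \<otimes>\<^bsub>adic_completion R I\<^esub> y = (\<lambda>n. ideal_power R I n +> (a n \<otimes> b n))"
    using a b by (simp add: completion_mult quotient_mult[OF ideal_power_ideal[OF I]])
  moreover have "a (Suc n) \<otimes> b (Suc n) \<in> ideal_power R I n +> (a n \<otimes> b n)" for n
  proof -
    let ?J = "ideal_power R I n"
    have J: "ideal ?J R" by (rule ideal_power_ideal[OF I])
    have "?J +> (a n \<otimes> b n) = (?J +> a n) \<otimes>\<^bsub>R Quot ?J\<^esub> (?J +> b n)"
      using a b by (simp add: quotient_mult[OF J])
    also have "\<dots> = (?J +> a (Suc n)) \<otimes>\<^bsub>R Quot ?J\<^esub> (?J +> b (Suc n))"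
      using coset_eq_of_mem[OF J a(1,3)] coset_eq_of_mem[OF J b(1,3)] by simp
    also have "\<dots> = ?J +> (a (Suc n) \<otimes> b (Suc n))" using a b by (simp add: quotient_mult[OF J])
    finally show ?thesis using coset_self[OF J, of "a (Suc n) \<otimes> b (Suc n)"] a b by simp
  qed
  ultimately show ?thesis using completion_carrierI[OF I, of "\<lambda>n. a n \<otimes> b n"] a b by simp
qed

lemma completion_add_closed:
  assumes I: "ideal I R" and x: "x \<in> carrier (adic_completion R I)" and y: "y \<in> carrier (adic_completion R I)"
  shows "x \<oplus>\<^bsub>adic_completion R I\<^esub> y \<in> carrier (adic_completion R I)"
proof -
  obtain a where a: "\<And>n. a n \<in> carrier R" "\<And>n. x n = ideal_power R I n +> a n"
    "\<And>n. a (Suc n) \<in> ideal_power R I n +> a n" using completion_representatives[OF I x] by blast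
  obtain b where b: "\<And>n. b n \<in> carrier R" "\<And>n. y n = ideal_power R I n +> b n"
    "\<And>n. b (Suc n) \<in> ideal_power R I n +> b n" using completion_representatives[OF I y] by blast
  have "x \<oplus>\<^bsub>adic_completion R I\<^esub> y = (\<lambda>n. ideal_power R I n +> (a n \<oplus> b n))"
    using a b by (simp add: completion_add quotient_add[OF ideal_power_ideal[OF I]])
  moreover have "a (Suc n) \<oplus> b (Suc n) \<in> ideal_power R I n +> (a n \<oplus> b n)" for n
  proof -
    let ?J = "ideal_power R I n"
    have J: "ideal ?J R" by (rule ideal_power_ideal[OF I])
    have "?J +> (a n \<oplus> b n) = (?J +> a n) \<oplus>\<^bsub>R Quot ?J\<^esub> (?J +> b n)"
      using a b by (simp add: quotient_add[OF J])
    also have "\<dots> = (?J +> a (Suc n)) \<oplus>\<^bsub>R Quot ?J\<^esub> (?J +> b (Suc n))"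
      using coset_eq_of_mem[OF J a(1,3)] coset_eq_of_mem[OF J b(1,3)] by simp
    also have "\<dots> = ?J +> (a (Suc n) \<oplus> b (Suc n))" using a b by (simp add: quotient_add[OF J])
    finally show ?thesis using coset_self[OF J, of "a (Suc n) \<oplus> b (Suc n)"] a b by simp
  qed
  ultimately show ?thesis using completion_carrierI[OF I, of "\<lambda>n. a n \<oplus> b n"] a b by simp
qed

lemma completion_const:
  assumes I: "ideal I R" and a: "a \<in> carrier R"
  shows "(\<lambda>n. ideal_power R I n +> a) \<in> carrier (adic_completion R I)"
  using completion_carrierI[OF I, of "\<lambda>n. a"] a coset_self[OF ideal_power_ideal[OF I] a] by simp

lemma completion_one: "\<one>\<^bsub>adic_completion R I\<^esub> = (\<lambda>n. ideal_power R I n +> \<one>)"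
  by (simp add: adic_completion_def FactRing_def)

lemma completion_zero:
  assumes I: "ideal I R"
  shows "\<zero>\<^bsub>adic_completion R I\<^esub> = (\<lambda>n. ideal_power R I n +> \<zero>)"
proof -
  have "ideal_power R I n +> \<zero> = ideal_power R I n" for n
    using a_rcos_zero[OF ideal_power_ideal[OF I]] additive_subgroup.zero_closed
      ideal.axioms(1)[OF ideal_power_ideal[OF I]] by metis
  then show ?thesis by (simp add: adic_completion_def FactRing_def)
qed

lemma completion_cring:
  assumes I: "ideal I R"
  shows "cring (adic_completion R I)"
proof -
  let ?C = "adic_completion R I"
  have Q: "cring (R Quot ideal_power R I n)" for n by (rule ideal_power_quotient_cring[OF I])
  have comp: "x n \<in> carrier (R Quot ideal_power R I n)" if "x \<in> carrier ?C" for x n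
    using that by (simp add: adic_completion_def)
  have minus: "\<exists>y \<in> carrier ?C. y \<oplus>\<^bsub>?C\<^esub> x = \<zero>\<^bsub>?C\<^esub>" if x: "x \<in> carrier ?C" for x
  proof -
    obtain a where a: "\<And>n. a n \<in> carrier R" "\<And>n. x n = ideal_power R I n +> a n"
      "\<And>n. a (Suc n) \<in> ideal_power R I n +> a n" using completion_representatives[OF I x] by blast
    have minus1: "(\<lambda>n. ideal_power R I n +> \<ominus> \<one>) \<in> carrier ?C" by (rule completion_const[OF I]) simp
    let ?y = "(\<lambda>n. ideal_power R I n +> \<ominus> \<one>) \<otimes>\<^bsub>?C\<^esub> x"
    have "?y \<in> carrier ?C" by (rule completion_mult_closed[OF I minus1 x])
    moreover have "?y \<oplus>\<^bsub>?C\<^esub> x = \<zero>\<^bsub>?C\<^esub>"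
      unfolding completion_zero[OF I]
      using a by (simp add: completion_mult completion_add quotient_mult[OF ideal_power_ideal[OF I]]
          quotient_add[OF ideal_power_ideal[OF I]] l_minus l_neg)
    ultimately show ?thesis by blast
  qed
  show ?thesis
  proof (rule cringI)
    show "abelian_group ?C"
    proof (rule abelian_groupI)
      show "\<zero>\<^bsub>?C\<^esub> \<in> carrier ?C" unfolding completion_zero[OF I] by (rule completion_const[OF I]) simp
    next
      fix x y z assume "x \<in> carrier ?C" "y \<in> carrier ?C" "z \<in> carrier ?C"
      then show "(x \<oplus>\<^bsub>?C\<^esub> y) \<oplus>\<^bsub>?C\<^esub> z = x \<oplus>\<^bsub>?C\<^esub> (y \<oplus>\<^bsub>?C\<^esub> z)"
        unfolding completion_add
        by (intro ext cring.cring_simprules(7)[OF Q] comp)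
    next
      fix x y assume "x \<in> carrier ?C" "y \<in> carrier ?C"
      then show "x \<oplus>\<^bsub>?C\<^esub> y = y \<oplus>\<^bsub>?C\<^esub> x"
        unfolding completion_add
        by (intro ext cring.cring_simprules(10)[OF Q] comp)
    next
      fix x assume "x \<in> carrier ?C"
      then show "\<zero>\<^bsub>?C\<^esub> \<oplus>\<^bsub>?C\<^esub> x = x"
        unfolding completion_add
        by (intro ext) (simp add: adic_completion_def cring.cring_simprules(8)[OF Q])
    qed (use completion_add_closed[OF I] minus in auto)
    show "comm_monoid ?C"
    proof (rule comm_monoidI)
      show "\<one>\<^bsub>?C\<^esub> \<in> carrier ?C" unfolding completion_one by (rule completion_const[OF I]) simp
    next
      fix x y z assume "x \<in> carrier ?C" "y \<in> carrier ?C" "z \<in> carrier ?C"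
      then show "(x \<otimes>\<^bsub>?C\<^esub> y) \<otimes>\<^bsub>?C\<^esub> z = x \<otimes>\<^bsub>?C\<^esub> (y \<otimes>\<^bsub>?C\<^esub> z)"
        unfolding completion_mult by (intro ext cring.cring_simprules(11)[OF Q] comp)
    next
      fix x y assume "x \<in> carrier ?C" "y \<in> carrier ?C"
      then show "x \<otimes>\<^bsub>?C\<^esub> y = y \<otimes>\<^bsub>?C\<^esub> x"
        unfolding completion_mult by (intro ext cring.cring_simprules(14)[OF Q] comp)
    next
      fix x assume "x \<in> carrier ?C"
      then show "\<one>\<^bsub>?C\<^esub> \<otimes>\<^bsub>?C\<^esub> x = x"
        unfolding completion_mult
        by (intro ext) (simp add: adic_completion_def cring.cring_simprules(12)[OF Q])
    qed (use completion_mult_closed[OF I] in auto)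
  next
    fix x y z assume "x \<in> carrier ?C" "y \<in> carrier ?C" "z \<in> carrier ?C"
    then show "(x \<oplus>\<^bsub>?C\<^esub> y) \<otimes>\<^bsub>?C\<^esub> z = x \<otimes>\<^bsub>?C\<^esub> z \<oplus>\<^bsub>?C\<^esub> y \<otimes>\<^bsub>?C\<^esub> z"
      unfolding completion_mult completion_add by (intro ext cring.cring_simprules(13)[OF Q] comp)
  qed
qed

end

section \<open>Essential ideals of domains\<close>

lemma (in domain) essential_ideal_nonzero:
  assumes "essential_ideal I R"
  shows "\<exists>x \<in> I. x \<noteq> \<zero>"
proof -
  have "I \<inter> carrier R \<noteq> {\<zero>}"
    using assms oneideal carrier_one_not_zero unfolding essential_ideal_def by simp
  moreover have "\<zero> \<in> I"
    using assms additive_subgroup.zero_closed ideal.axioms(1) unfolding essential_ideal_def by blast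
  ultimately show ?thesis by auto
qed

lemma (in domain) essential_idealI:
  assumes I: "ideal I R" and x: "x \<in> I" "x \<noteq> \<zero>"
  shows "essential_ideal I R"
  unfolding essential_ideal_def
proof (intro conjI allI impI)
  fix J assume J: "ideal J R \<and> J \<noteq> {\<zero>}"
  have "\<zero> \<in> J" using J additive_subgroup.zero_closed ideal.axioms(1) by blast
  then obtain b where b: "b \<in> J" "b \<noteq> \<zero>" using J by blast
  have c: "x \<in> carrier R" "b \<in> carrier R"
    using ideal.Icarr[OF I x(1)] ideal.Icarr[of J R b] b J by simp_all
  have "x \<otimes> b \<in> I" by (rule ideal.I_r_closed[OF I x(1) c(2)])
  moreover have "x \<otimes> b \<in> J" using J ideal.I_l_closed[of J R b x] b c by blast
  moreover have "x \<otimes> b \<noteq> \<zero>" using integral[of x b] x b c by blast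
  ultimately show "I \<inter> J \<noteq> {\<zero>}" by blast
qed (rule I)

section \<open>The completion as endomorphism ring of the hull\<close>

context residue_hull
begin

lemma completion_eq: "completion A = adic_completion A \<mm>"
  by (simp add: completion_def max_ideal_eq)

lemma completion_is_cring: "cring (completion A)"
  unfolding completion_eq by (rule R.completion_cring[OF \<mm>_ideal])

lemma completion_map_eq: "completion_map A a = (\<lambda>n. pow\<mm> n +> a)"
  by (simp add: completion_map_def max_ideal_eq pow\<mm>_def)

lemma completion_map_closed: "a \<in> carrier A \<Longrightarrow> completion_map A a \<in> carrier (completion A)"
  unfolding completion_eq completion_map_eq pow\<mm>_def by (rule R.completion_const[OF \<mm>_ideal])

lemma completion_rep:
  assumes "x \<in> carrier (completion A)"
  obtains a where "a \<in> carrier A" "x n = pow\<mm> n +> a" "a \<in> x n"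
proof -
  have "\<exists>a \<in> carrier A. x n = pow\<mm> n +> a"
    using assms by (simp add: completion_eq adic_completion_def R.quotient_carrier pow\<mm>_def)
  then obtain a where "a \<in> carrier A" "x n = pow\<mm> n +> a" by blast
  with that R.coset_self[OF pow\<mm>_ideal] show ?thesis by blast
qed

lemma completion_nested:
  assumes x: "x \<in> carrier (completion A)" and "k \<le> n"
  shows "x n \<subseteq> x k"
  using assms(2)
proof (induction n rule: dec_induct)
  case (step n)
  then show ?case using x unfolding completion_eq adic_completion_def by auto
qed simp

lemma completion_mem_carrier:
  assumes x: "x \<in> carrier (completion A)" and "a \<in> x n"
  shows "a \<in> carrier A"
proof -
  obtain b where b: "b \<in> carrier A" "x n = pow\<mm> n +> b" using completion_rep[OF x] by metis
  then show ?thesis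
    using assms(2) R.a_r_coset_subset_G[OF pow\<mm>_carrier] by blast
qed

lemma completion_mem_diff:
  assumes x: "x \<in> carrier (completion A)" and a: "a \<in> x n" and b: "b \<in> x n"
  shows "a \<ominus> b \<in> pow\<mm> n"
proof -
  obtain c where c: "c \<in> carrier A" "x n = pow\<mm> n +> c" using completion_rep[OF x] by metis
  have "pow\<mm> n +> a = x n" "pow\<mm> n +> b = x n"
    using R.coset_eq_of_mem[OF pow\<mm>_ideal c(1)] a b c(2) by simp_all
  then show ?thesis
    using R.quotient_eq_iff_same_a_r_cos[OF pow\<mm>_ideal, of a b n] completion_mem_carrier[OF x] a b by simp
qed

lemma smult_eq_on_tors:
  assumes "a \<in> carrier A" "b \<in> carrier A" "a \<ominus> b \<in> J" "e \<in> tors J"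
  shows "a \<odot>\<^bsub>E\<^esub> e = b \<odot>\<^bsub>E\<^esub> e"
  using assms by (auto simp: tors_def minus_smult_distr diff_zero_iff)

text \<open>
  On the part of \<open>E\<close> killed by \<open>\<mm>\<^sup>n\<close> an element of the completion acts through its \<open>n\<close>-th component.
\<close>

definition act :: "(nat \<Rightarrow> 'a set) \<Rightarrow> 'e \<Rightarrow> 'e"
  where "act x e = (THE y. \<exists>n. \<exists>a \<in> x n. e \<in> tors (pow\<mm> n) \<and> y = a \<odot>\<^bsub>E\<^esub> e)"

lemma act_eq:
  assumes x: "x \<in> carrier (completion A)" and e: "e \<in> tors (pow\<mm> n)" and a: "a \<in> x n"
  shows "act x e = a \<odot>\<^bsub>E\<^esub> e"
  unfolding act_def
proof (rule the_equality)
  show "\<exists>n. \<exists>b \<in> x n. e \<in> tors (pow\<mm> n) \<and> a \<odot>\<^bsub>E\<^esub> e = b \<odot>\<^bsub>E\<^esub> e" using e a by blast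
next
  fix y assume "\<exists>n. \<exists>b \<in> x n. e \<in> tors (pow\<mm> n) \<and> y = b \<odot>\<^bsub>E\<^esub> e"
  then obtain k b where b: "b \<in> x k" "e \<in> tors (pow\<mm> k)" "y = b \<odot>\<^bsub>E\<^esub> e" by blast
  define l where "l = min n k"
  have "a \<in> x l" "b \<in> x l"
    using completion_nested[OF x, of l n] completion_nested[OF x, of l k] a b by (auto simp: l_def)
  then have "a \<ominus> b \<in> pow\<mm> l" by (rule completion_mem_diff[OF x])
  moreover have "e \<in> tors (pow\<mm> l)" using e b by (simp add: l_def min_def)
  ultimately show "y = a \<odot>\<^bsub>E\<^esub> e"
    using smult_eq_on_tors[of a b] completion_mem_carrier[OF x] a b by simp
qed

lemma act_hom:
  assumes x: "x \<in> carrier (completion A)"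
  shows "act x \<in> module_homs A E E"
proof -
  have loc: "\<exists>n. \<exists>a \<in> x n. a \<in> carrier A \<and> e \<in> tors (pow\<mm> n) \<and> e' \<in> tors (pow\<mm> n)"
    if e: "e \<in> carrier E" "e' \<in> carrier E" for e e'
  proof -
    obtain k l where "e \<in> tors (pow\<mm> k)" "e' \<in> tors (pow\<mm> l)" using torsion e by metis
    then have "e \<in> tors (pow\<mm> (max k l))" "e' \<in> tors (pow\<mm> (max k l))"
      using tors_pow\<mm>_mono[of k "max k l"] tors_pow\<mm>_mono[of l "max k l"] by auto
    moreover obtain a where "a \<in> carrier A" "a \<in> x (max k l)" using completion_rep[OF x] by metis
    ultimately show ?thesis by blast
  qed
  show ?thesis
    unfolding module_homs_def
  proof (intro CollectI conjI ballI funcsetI)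
    fix e assume e: "e \<in> carrier E"
    then obtain n a where "a \<in> x n" "a \<in> carrier A" "e \<in> tors (pow\<mm> n)" using loc by blast
    then show "act x e \<in> carrier E" using act_eq[OF x] e by simp
  next
    fix e e' assume e: "e \<in> carrier E" "e' \<in> carrier E"
    then obtain n a where a: "a \<in> x n" "a \<in> carrier A" "e \<in> tors (pow\<mm> n)" "e' \<in> tors (pow\<mm> n)"
      using loc by blast
    then have "e \<oplus>\<^bsub>E\<^esub> e' \<in> tors (pow\<mm> n)"
      using submoduleE(5)[OF tors_submodule[OF pow\<mm>_carrier]] by blast
    then show "act x (e \<oplus>\<^bsub>E\<^esub> e') = act x e \<oplus>\<^bsub>E\<^esub> act x e'"
      using act_eq[OF x _ a(1)] a e by (simp add: smult_r_distr)
  next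
    fix r e assume r: "r \<in> carrier A" and e: "e \<in> carrier E"
    then obtain n a where a: "a \<in> x n" "a \<in> carrier A" "e \<in> tors (pow\<mm> n)" using loc by blast
    then have "r \<odot>\<^bsub>E\<^esub> e \<in> tors (pow\<mm> n)"
      using submoduleE(4)[OF tors_submodule[OF pow\<mm>_carrier]] r by blast
    then show "act x (r \<odot>\<^bsub>E\<^esub> e) = r \<odot>\<^bsub>E\<^esub> act x e"
      using act_eq[OF x _ a(1)] a e r by (simp add: smult_assoc1[symmetric] R.m_comm)
  qed
qed

lemma act_closed:
  "x \<in> carrier (completion A) \<Longrightarrow> e \<in> carrier E \<Longrightarrow> act x e \<in> carrier E"
  using module_homs_closed[OF act_hom] .

lemma act_completion_map:
  assumes a: "a \<in> carrier A" and e: "e \<in> carrier E"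
  shows "act (completion_map A a) e = a \<odot>\<^bsub>E\<^esub> e"
proof -
  obtain n where n: "e \<in> tors (pow\<mm> n)" using torsion[OF e] by blast
  show ?thesis
    by (rule act_eq[OF completion_map_closed[OF a] n])
      (simp add: completion_map_eq R.coset_self[OF pow\<mm>_ideal a])
qed

lemma act_mult:
  assumes x: "x \<in> carrier (completion A)" and y: "y \<in> carrier (completion A)" and e: "e \<in> carrier E"
  shows "act (x \<otimes>\<^bsub>completion A\<^esub> y) e = act x (act y e)"
proof -
  interpret C: cring "completion A" by (rule completion_is_cring)
  obtain n where n: "e \<in> tors (pow\<mm> n)" using torsion[OF e] by blast
  obtain a where a: "a \<in> carrier A" "x n = pow\<mm> n +> a" "a \<in> x n" using completion_rep[OF x] .
  obtain b where b: "b \<in> carrier A" "y n = pow\<mm> n +> b" "b \<in> y n" using completion_rep[OF y] .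
  have "(x \<otimes>\<^bsub>completion A\<^esub> y) n = pow\<mm> n +> (a \<otimes> b)"
    using a b R.quotient_mult[OF pow\<mm>_ideal]
    by (simp add: completion_eq R.completion_mult pow\<mm>_def)
  then have "a \<otimes> b \<in> (x \<otimes>\<^bsub>completion A\<^esub> y) n"
    using R.coset_self[OF pow\<mm>_ideal] a b by simp
  then have "act (x \<otimes>\<^bsub>completion A\<^esub> y) e = (a \<otimes> b) \<odot>\<^bsub>E\<^esub> e" using n x y by (intro act_eq) simp_all
  moreover have be: "act y e = b \<odot>\<^bsub>E\<^esub> e" by (rule act_eq[OF y n b(3)])
  moreover have "b \<odot>\<^bsub>E\<^esub> e \<in> tors (pow\<mm> n)"
    using submoduleE(4)[OF tors_submodule[OF pow\<mm>_carrier]] b n by blast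
  then have "act x (b \<odot>\<^bsub>E\<^esub> e) = a \<odot>\<^bsub>E\<^esub> (b \<odot>\<^bsub>E\<^esub> e)" by (rule act_eq[OF x _ a(3)])
  ultimately show ?thesis using a b e by (simp add: smult_assoc1)
qed

lemma act_faithful:
  assumes x: "x \<in> carrier (completion A)" and zero: "\<And>e. e \<in> carrier E \<Longrightarrow> act x e = \<zero>\<^bsub>E\<^esub>"
  shows "x = \<zero>\<^bsub>completion A\<^esub>"
proof -
  have "x n = pow\<mm> n +> \<zero>" for n
  proof -
    obtain a where a: "a \<in> carrier A" "x n = pow\<mm> n +> a" "a \<in> x n" using completion_rep[OF x] .
    have "a \<odot>\<^bsub>E\<^esub> e = \<zero>\<^bsub>E\<^esub>" if "e \<in> tors (pow\<mm> n)" for e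
      using act_eq[OF x that a(3)] zero that by (simp add: tors_def)
    then have "a \<in> pow\<mm> n" by (rule annihilator_tors[OF pow\<mm>_ideal a(1)])
    then have "pow\<mm> n +> a = pow\<mm> n" by (rule R.a_rcos_zero[OF pow\<mm>_ideal])
    moreover have "pow\<mm> n +> \<zero> = pow\<mm> n" using R.a_coset_add_zero[OF pow\<mm>_carrier] .
    ultimately show ?thesis using a by simp
  qed
  then show ?thesis unfolding completion_eq R.completion_zero[OF \<mm>_ideal] pow\<mm>_def by (intro ext)
qed

lemma act_add:
  assumes x: "x \<in> carrier (completion A)" and y: "y \<in> carrier (completion A)" and e: "e \<in> carrier E"
  shows "act (x \<oplus>\<^bsub>completion A\<^esub> y) e = act x e \<oplus>\<^bsub>E\<^esub> act y e"
proof -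
  interpret C: cring "completion A" by (rule completion_is_cring)
  obtain n where n: "e \<in> tors (pow\<mm> n)" using torsion[OF e] by blast
  obtain a where a: "a \<in> carrier A" "x n = pow\<mm> n +> a" "a \<in> x n" using completion_rep[OF x] .
  obtain b where b: "b \<in> carrier A" "y n = pow\<mm> n +> b" "b \<in> y n" using completion_rep[OF y] .
  have "(x \<oplus>\<^bsub>completion A\<^esub> y) n = pow\<mm> n +> (a \<oplus> b)"
    using a b R.quotient_add[OF pow\<mm>_ideal]
    by (simp add: completion_eq R.completion_add pow\<mm>_def)
  then have "a \<oplus> b \<in> (x \<oplus>\<^bsub>completion A\<^esub> y) n"
    using R.coset_self[OF pow\<mm>_ideal] a b by simp
  then have "act (x \<oplus>\<^bsub>completion A\<^esub> y) e = (a \<oplus> b) \<odot>\<^bsub>E\<^esub> e" using n x y by (intro act_eq) simp_all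
  then show ?thesis
    using act_eq[OF x n a(3)] act_eq[OF y n b(3)] a b e by (simp add: smult_l_distr)
qed

lemma act_zero: "e \<in> carrier E \<Longrightarrow> act \<zero>\<^bsub>completion A\<^esub> e = \<zero>\<^bsub>E\<^esub>"
proof -
  assume e: "e \<in> carrier E"
  have "\<zero>\<^bsub>completion A\<^esub> = completion_map A \<zero>"
    unfolding completion_eq R.completion_zero[OF \<mm>_ideal] completion_map_eq pow\<mm>_def ..
  then show ?thesis using act_completion_map[OF R.zero_closed e] e by simp
qed

lemma act_injective:
  assumes x: "x \<in> carrier (completion A)" and y: "y \<in> carrier (completion A)"
    and eq: "\<And>e. e \<in> carrier E \<Longrightarrow> act x e = act y e"
  shows "x = y"
proof -
  interpret C: cring "completion A" by (rule completion_is_cring)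
  let ?z = "x \<ominus>\<^bsub>completion A\<^esub> y"
  have xz: "x = ?z \<oplus>\<^bsub>completion A\<^esub> y" using x y by (simp add: a_minus_def C.a_assoc C.l_neg)
  have z: "?z \<in> carrier (completion A)" using x y by simp
  have "act ?z e = \<zero>\<^bsub>E\<^esub>" if e: "e \<in> carrier E" for e
  proof -
    have "act y e = act ?z e \<oplus>\<^bsub>E\<^esub> act y e"
      using eq[OF e] act_add[OF z y e] xz by simp
    then show ?thesis using act_closed[OF z e] act_closed[OF y e] by (metis M.add.l_cancel_one' M.a_comm)
  qed
  then have "?z = \<zero>\<^bsub>completion A\<^esub>" by (rule act_faithful[OF z])
  then show ?thesis using xz y by simp
qed

text \<open>
  On each \<open>tors (\<mm>\<^sup>n)\<close> an endomorphism is multiplication by some \<open>a n\<close>; these cohere, because only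
  elements of \<open>\<mm>\<^sup>n\<close> kill \<open>tors (\<mm>\<^sup>n)\<close>.
\<close>

lemma act_surjective:
  assumes f: "f \<in> module_homs A E E"
  shows "\<exists>x \<in> carrier (completion A). \<forall>e \<in> carrier E. f e = act x e"
proof -
  have "\<exists>a \<in> carrier A. \<forall>e \<in> tors (pow\<mm> n). f e = a \<odot>\<^bsub>E\<^esub> e" for n
    by (rule hom_tors_is_smult[OF pow\<mm>_ideal subset_refl module_homs_restrict[OF f]])
      (auto simp: tors_def)
  then obtain a where a: "\<And>n. a n \<in> carrier A"
    and fa: "\<And>n e. e \<in> tors (pow\<mm> n) \<Longrightarrow> f e = a n \<odot>\<^bsub>E\<^esub> e" by metis
  define x where "x n = pow\<mm> n +> a n" for n
  have "a (Suc n) \<in> pow\<mm> n +> a n" for n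
  proof -
    have "(a (Suc n) \<ominus> a n) \<odot>\<^bsub>E\<^esub> e = \<zero>\<^bsub>E\<^esub>" if e: "e \<in> tors (pow\<mm> n)" for e
    proof -
      have "e \<in> tors (pow\<mm> (Suc n))" using e tors_pow\<mm>_mono[of n "Suc n"] by auto
      then have "a (Suc n) \<odot>\<^bsub>E\<^esub> e = a n \<odot>\<^bsub>E\<^esub> e" using fa e by metis
      moreover have "e \<in> carrier E" using e by (simp add: tors_def)
      ultimately show ?thesis using a[of n] a[of "Suc n"] by (simp add: minus_smult_distr diff_zero_iff)
    qed
    then have "a (Suc n) \<ominus> a n \<in> pow\<mm> n" using a by (intro annihilator_tors[OF pow\<mm>_ideal]) auto
    then show ?thesis using R.mem_coset_iff[OF pow\<mm>_ideal] a by blast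
  qed
  then have x: "x \<in> carrier (completion A)"
    using R.completion_carrierI[OF \<mm>_ideal, of a] a
    unfolding completion_eq x_def pow\<mm>_def by blast
  have "f e = act x e" if e: "e \<in> carrier E" for e
  proof -
    obtain n where n: "e \<in> tors (pow\<mm> n)" using torsion[OF e] by blast
    have "a n \<in> x n" unfolding x_def by (rule R.coset_self[OF pow\<mm>_ideal a])
    then show ?thesis using act_eq[OF x n] fa[OF n] by simp
  qed
  then show ?thesis using x by blast
qed

lemma completion_map_eq_zero:
  assumes a: "a \<in> carrier A" and "completion_map A a = \<zero>\<^bsub>completion A\<^esub>"
  shows "a = \<zero>"
  using faithful[OF a] act_completion_map[OF a] act_zero assms(2) by metis

lemma completion_map_mult:
  assumes a: "a \<in> carrier A" and b: "b \<in> carrier A"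
  shows "completion_map A (a \<otimes> b) = completion_map A a \<otimes>\<^bsub>completion A\<^esub> completion_map A b"
  unfolding completion_map_eq completion_eq R.completion_mult
  using R.quotient_mult[OF pow\<mm>_ideal a b] unfolding pow\<mm>_def by simp

lemma completion_map_add:
  assumes a: "a \<in> carrier A" and b: "b \<in> carrier A"
  shows "completion_map A (a \<oplus> b) = completion_map A a \<oplus>\<^bsub>completion A\<^esub> completion_map A b"
  unfolding completion_map_eq completion_eq R.completion_add
  using R.quotient_add[OF pow\<mm>_ideal a b] unfolding pow\<mm>_def by simp

lemma contraction_ideal:
  assumes I: "ideal I (completion A)"
  shows "ideal {a \<in> carrier A. completion_map A a \<in> I} A"
proof -
  interpret C: cring "completion A" by (rule completion_is_cring)
  interpret I: ideal I "completion A" by (rule I)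
  have "completion_map A \<in> ring_hom A (completion A)"
  proof (rule ring_hom_memI)
    show "completion_map A \<one> = \<one>\<^bsub>completion A\<^esub>"
      unfolding completion_map_eq completion_eq R.completion_one pow\<mm>_def ..
  qed (use completion_map_closed completion_map_mult completion_map_add in auto)
  then interpret h: ring_hom_ring A "completion A" "completion_map A"
    by (intro ring_hom_ringI2 R.ring_axioms C.ring_axioms)
  show ?thesis by (rule h.ideal_vimage[OF I])
qed

section \<open>Simple divisibility over a local ring\<close>

text \<open>A preimage of \<open>e\<close> under \<open>r\<close> is the image of \<open>1\<close> under an extension of \<open>ra \<mapsto> ae\<close> to \<open>A\<close>.\<close>

lemma divisible: "divisible_module A E"
  unfolding divisible_module_def
proof (intro allI impI equalityI subsetI)
  fix r e assume r: "non_zero_divisor A r" and e: "e \<in> carrier E"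
  have rc: "r \<in> carrier A" and nzd: "\<And>s. s \<in> carrier A \<Longrightarrow> r \<otimes> s = \<zero> \<Longrightarrow> s = \<zero>"
    using r by (auto simp: non_zero_divisor_def)
  let ?A = "ideal_module A (carrier A)"
  have mod: "module A ?A" by (rule R.ideal_module_module[OF R.oneideal])
  have f: "(\<lambda>a. r \<otimes> a) \<in> module_homs A ?A ?A"
    using rc by (auto simp: module_homs_def ideal_module_def R.r_distr R.m_lcomm)
  have inj: "inj_on (\<lambda>a. r \<otimes> a) (carrier ?A)"
  proof (rule inj_onI)
    fix a b assume "a \<in> carrier ?A" "b \<in> carrier ?A" and eq: "r \<otimes> a = r \<otimes> b"
    then have ab: "a \<in> carrier A" "b \<in> carrier A" by (simp_all add: ideal_module_def)
    have "r \<otimes> (a \<ominus> b) = r \<otimes> a \<ominus> r \<otimes> b"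
      using rc ab by (simp add: a_minus_def R.r_distr R.r_minus)
    then have "r \<otimes> (a \<ominus> b) = \<zero>" using eq rc ab by (simp add: R.r_neg a_minus_def)
    then have "a \<ominus> b = \<zero>" using nzd ab by simp
    then show "a = b" using ab by simp
  qed
  have g: "(\<lambda>a. a \<odot>\<^bsub>E\<^esub> e) \<in> module_homs A ?A E"
    using e by (auto simp: module_homs_def ideal_module_def smult_l_distr smult_assoc1)
  obtain h where h: "h \<in> module_homs A ?A E" and hr: "\<And>a. a \<in> carrier A \<Longrightarrow> h (r \<otimes> a) = a \<odot>\<^bsub>E\<^esub> e"
    using injective_module_extend[OF injective mod mod f inj g] by (auto simp: ideal_module_def)
  have "h \<one> \<in> carrier E" using module_homs_closed[OF h, of \<one>] by (simp add: ideal_module_def)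
  moreover have "r \<odot>\<^bsub>E\<^esub> h \<one> = e"
    using module_homs_smult[OF h rc, of \<one>] hr[OF R.one_closed] e by (simp add: ideal_module_def)
  ultimately show "e \<in> (\<lambda>x. r \<odot>\<^bsub>E\<^esub> x) ` carrier E" by blast
qed (auto simp: non_zero_divisor_def)

lemma E_nonzero: "carrier E \<noteq> {\<zero>\<^bsub>E\<^esub>}"
  using e\<^sub>0_closed e\<^sub>0_nonzero by blast

lemma A_nontrivial: "\<one> \<noteq> \<zero>"
proof
  assume "\<one> = \<zero>"
  then have "\<one> \<in> \<mm>" using additive_subgroup.zero_closed[OF ideal.axioms(1)[OF \<mm>_ideal]] by simp
  then show False using \<mm>_proper by simp
qed

lemma divisible_hom_image:
  assumes f: "f \<in> module_homs A E E"
  shows "divisible_module A (E\<lparr>carrier := f ` carrier E\<rparr>)"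
  unfolding divisible_module_def
proof (intro allI impI)
  fix r assume r: "non_zero_divisor A r"
  then have rc: "r \<in> carrier A" by (simp add: non_zero_divisor_def)
  have "(\<lambda>x. r \<odot>\<^bsub>E\<^esub> x) ` (f ` carrier E) = f ` ((\<lambda>x. r \<odot>\<^bsub>E\<^esub> x) ` carrier E)"
    using module_homs_smult[OF f rc] by (auto simp: image_image intro!: image_eqI)
  also have "(\<lambda>x. r \<odot>\<^bsub>E\<^esub> x) ` carrier E = carrier E"
    using divisible r by (simp add: divisible_module_def)
  finally show "(\<lambda>x. r \<odot>\<^bsub>E\<lparr>carrier := f ` carrier E\<rparr>\<^esub> x) ` carrier (E\<lparr>carrier := f ` carrier E\<rparr>) =
      carrier (E\<lparr>carrier := f ` carrier E\<rparr>)" by simp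
qed

lemma simple_divisible_endo:
  assumes E: "simple_divisible A E" and f: "f \<in> module_homs A E E"
  shows "f ` carrier E = carrier E \<or> (\<forall>e \<in> carrier E. f e = \<zero>\<^bsub>E\<^esub>)"
proof -
  have "submodule (f ` carrier E) A E"
    by (rule hom_image_submodule[OF module_axioms f carrier_is_submodule])
  moreover have "f ` carrier E \<subseteq> carrier E" using module_homs_closed[OF f] by blast
  ultimately have "f ` carrier E = {\<zero>\<^bsub>E\<^esub>} \<or> f ` carrier E = carrier E"
    using E divisible_hom_image[OF f] unfolding simple_divisible_def by blast
  then show ?thesis by blast
qed

lemma simple_divisible_imp_domain:
  assumes E: "simple_divisible A E"
  shows "domain (completion A)"
proof -
  interpret C: cring "completion A" by (rule completion_is_cring)
  show ?thesis
  proof (intro domain.intro completion_is_cring domain_axioms.intro)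
    show "\<one>\<^bsub>completion A\<^esub> \<noteq> \<zero>\<^bsub>completion A\<^esub>"
    proof
      assume "\<one>\<^bsub>completion A\<^esub> = \<zero>\<^bsub>completion A\<^esub>"
      moreover have "\<one>\<^bsub>completion A\<^esub> = completion_map A \<one>"
        unfolding completion_map_eq completion_eq R.completion_one pow\<mm>_def ..
      ultimately show False using completion_map_eq_zero[OF R.one_closed] A_nontrivial by simp
    qed
  next
    fix x y assume xy: "x \<otimes>\<^bsub>completion A\<^esub> y = \<zero>\<^bsub>completion A\<^esub>"
      and x: "x \<in> carrier (completion A)" and y: "y \<in> carrier (completion A)"
    have zero: "act x (act y e) = \<zero>\<^bsub>E\<^esub>" if "e \<in> carrier E" for e
      using act_mult[OF x y that] act_zero[OF that] xy by simp
    show "x = \<zero>\<^bsub>completion A\<^esub> \<or> y = \<zero>\<^bsub>completion A\<^esub>"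
    proof (cases "act y ` carrier E = carrier E")
      case True
      have "act x e = \<zero>\<^bsub>E\<^esub>" if "e \<in> carrier E" for e
      proof -
        have "e \<in> act y ` carrier E" using True that by simp
        then obtain e' where "e' \<in> carrier E" "e = act y e'" by (rule imageE)
        then show ?thesis using zero by simp
      qed
      then have "x = \<zero>\<^bsub>completion A\<^esub>" by (rule act_faithful[OF x])
      then show ?thesis ..
    next
      case False
      then have "act y e = \<zero>\<^bsub>E\<^esub>" if "e \<in> carrier E" for e
        using simple_divisible_endo[OF E act_hom[OF y]] that by simp
      then have "y = \<zero>\<^bsub>completion A\<^esub>" by (rule act_faithful[OF y])
      then show ?thesis ..
    qed
  qed
qed

lemma domain_of_completion:
  assumes "domain (completion A)"
  shows "domain A"
proof -
  interpret C: domain "completion A" by fact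
  show ?thesis
  proof (intro domain.intro R.is_cring domain_axioms.intro A_nontrivial)
    fix a b assume ab: "a \<otimes> b = \<zero>" "a \<in> carrier A" "b \<in> carrier A"
    have "\<zero>\<^bsub>completion A\<^esub> = completion_map A \<zero>"
      unfolding completion_eq R.completion_zero[OF \<mm>_ideal] completion_map_eq pow\<mm>_def ..
    then have "completion_map A a \<otimes>\<^bsub>completion A\<^esub> completion_map A b = \<zero>\<^bsub>completion A\<^esub>"
      using completion_map_mult[of a b] ab by simp
    then have "completion_map A a = \<zero>\<^bsub>completion A\<^esub> \<or> completion_map A b = \<zero>\<^bsub>completion A\<^esub>"
      using C.integral completion_map_closed ab by blast
    then show "a = \<zero> \<or> b = \<zero>" using completion_map_eq_zero ab by blast
  qed
qed

text \<open>
  The main use of the Artinian property: a submodule \<open>V\<close> of \<open>K\<close> minimal among the faithful ones is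
  divisible, since \<open>rV \<subseteq> V\<close> is again faithful for \<open>r \<noteq> 0\<close> in a domain.
\<close>

lemma faithful_submodule_contains_divisible:
  assumes dom: "domain A" and K: "submodule K A E"
    and faith: "\<And>a. a \<in> carrier A \<Longrightarrow> (\<And>e. e \<in> K \<Longrightarrow> a \<odot>\<^bsub>E\<^esub> e = \<zero>\<^bsub>E\<^esub>) \<Longrightarrow> a = \<zero>"
  shows "\<exists>V \<subseteq> K. submodule V A E \<and> V \<noteq> {\<zero>\<^bsub>E\<^esub>} \<and> divisible_module A (E\<lparr>carrier := V\<rparr>)"
proof -
  interpret D: domain A by (rule dom)
  define F where "F = {V. submodule V A E \<and> V \<subseteq> K \<and> (\<forall>a \<in> carrier A. (\<forall>e \<in> V. a \<odot>\<^bsub>E\<^esub> e = \<zero>\<^bsub>E\<^esub>) \<longrightarrow> a = \<zero>)}"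
  have "K \<in> F" using K faith by (auto simp: F_def)
  have "\<exists>V \<in> F. \<forall>V' \<in> F. V' \<subseteq> V \<longrightarrow> V' = V"
  proof (rule artinian_minimal[OF artinian])
    show "F \<noteq> {}" using \<open>K \<in> F\<close> by blast
    show "submodule V A E \<and> V \<subseteq> carrier E" if "V \<in> F" for V
      using that submoduleE(1) by (simp add: F_def)
  qed
  then obtain V where VF: "V \<in> F" and min: "\<And>V'. V' \<in> F \<Longrightarrow> V' \<subseteq> V \<Longrightarrow> V' = V" by blast
  have V: "submodule V A E" "V \<subseteq> K" using VF by (auto simp: F_def)
  have Vfaith: "a = \<zero>" if "a \<in> carrier A" "\<And>e. e \<in> V \<Longrightarrow> a \<odot>\<^bsub>E\<^esub> e = \<zero>\<^bsub>E\<^esub>" for a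
    using VF that by (simp add: F_def)
  have Vc: "e \<in> carrier E" if "e \<in> V" for e using submoduleE(1)[OF V(1)] that by blast
  have "V \<noteq> {\<zero>\<^bsub>E\<^esub>}" using Vfaith[OF R.one_closed] A_nontrivial by auto
  moreover have "divisible_module A (E\<lparr>carrier := V\<rparr>)"
    unfolding divisible_module_def
  proof (intro allI impI)
    fix r assume r: "non_zero_divisor A r"
    have rc: "r \<in> carrier A" using r by (simp add: non_zero_divisor_def)
    have r0: "r \<noteq> \<zero>"
    proof
      assume "r = \<zero>"
      then have "r \<otimes> \<one> = \<zero>" by simp
      then show False using r A_nontrivial R.one_closed unfolding non_zero_divisor_def by blast
    qed
    have sub: "submodule ((\<lambda>e. r \<odot>\<^bsub>E\<^esub> e) ` V) A E"
      by (rule hom_image_submodule[OF module_axioms smult_hom[OF rc] V(1)])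
    have le: "(\<lambda>e. r \<odot>\<^bsub>E\<^esub> e) ` V \<subseteq> V" using submoduleE(4)[OF V(1) rc] by blast
    have "a = \<zero>" if a: "a \<in> carrier A" and kill: "\<forall>e \<in> (\<lambda>e. r \<odot>\<^bsub>E\<^esub> e) ` V. a \<odot>\<^bsub>E\<^esub> e = \<zero>\<^bsub>E\<^esub>" for a
    proof -
      have "(a \<otimes> r) \<odot>\<^bsub>E\<^esub> e = \<zero>\<^bsub>E\<^esub>" if "e \<in> V" for e
        using kill that a rc Vc by (simp add: smult_assoc1)
      then have "a \<otimes> r = \<zero>" using a rc by (intro Vfaith) auto
      then show ?thesis using D.integral a rc r0 by blast
    qed
    then have "(\<lambda>e. r \<odot>\<^bsub>E\<^esub> e) ` V \<in> F"
      using sub subset_trans[OF le V(2)] unfolding F_def by blast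
    then have "(\<lambda>e. r \<odot>\<^bsub>E\<^esub> e) ` V = V" using le by (rule min)
    then show "(\<lambda>x. r \<odot>\<^bsub>E\<lparr>carrier := V\<rparr>\<^esub> x) ` carrier (E\<lparr>carrier := V\<rparr>) = carrier (E\<lparr>carrier := V\<rparr>)"
      by simp
  qed
  ultimately show ?thesis using V by blast
qed

text \<open>On the image of \<open>f\<close> the map \<open>h\<close> is forced; injectivity extends it to \<open>E\<close>.\<close>

lemma factor_through:
  assumes f: "f \<in> module_homs A E E" and k: "k \<in> module_homs A E E"
    and ker: "\<And>e. e \<in> carrier E \<Longrightarrow> f e = \<zero>\<^bsub>E\<^esub> \<Longrightarrow> k e = \<zero>\<^bsub>E\<^esub>"
  shows "\<exists>h \<in> module_homs A E E. \<forall>e \<in> carrier E. k e = h (f e)"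
proof -
  define s where "s y = (SOME e. e \<in> carrier E \<and> f e = y)" for y
  have s: "s y \<in> carrier E" "f (s y) = y" if "y \<in> f ` carrier E" for y
    using someI_ex[of "\<lambda>e. e \<in> carrier E \<and> f e = y"] that by (auto simp: s_def)
  have eq: "k e = k e'" if "e \<in> carrier E" "e' \<in> carrier E" "f e = f e'" for e e'
  proof -
    have "f (e \<ominus>\<^bsub>E\<^esub> e') = \<zero>\<^bsub>E\<^esub>"
      using module_homs_minus[OF module_axioms module_axioms f that(1,2)] that module_homs_closed[OF f]
      by (simp add: diff_zero_iff)
    then have "k e \<ominus>\<^bsub>E\<^esub> k e' = \<zero>\<^bsub>E\<^esub>"
      using ker[of "e \<ominus>\<^bsub>E\<^esub> e'"] that module_homs_minus[OF module_axioms module_axioms k that(1,2)] by simp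
    then show ?thesis using module_homs_closed[OF k] that by (simp add: diff_zero_iff)
  qed
  have ks: "k (s (f e)) = k e" if "e \<in> carrier E" for e using eq s[of "f e"] that by blast
  have "(\<lambda>y. k (s y)) \<in> module_homs A (E\<lparr>carrier := f ` carrier E\<rparr>) E"
    unfolding module_homs_def
  proof (intro CollectI conjI ballI funcsetI)
    fix y assume "y \<in> carrier (E\<lparr>carrier := f ` carrier E\<rparr>)"
    then show "k (s y) \<in> carrier E" using s module_homs_closed[OF k] by simp
  next
    fix y z assume "y \<in> carrier (E\<lparr>carrier := f ` carrier E\<rparr>)" "z \<in> carrier (E\<lparr>carrier := f ` carrier E\<rparr>)"
    then obtain u v where uv: "u \<in> carrier E" "v \<in> carrier E" "y = f u" "z = f v" by auto
    then have "y \<oplus>\<^bsub>E\<^esub> z = f (u \<oplus>\<^bsub>E\<^esub> v)" using module_homs_add[OF f] by simp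
    then show "k (s (y \<oplus>\<^bsub>E\<lparr>carrier := f ` carrier E\<rparr>\<^esub> z)) = k (s y) \<oplus>\<^bsub>E\<^esub> k (s z)"
      using ks uv module_homs_add[OF k] by simp
  next
    fix r y assume r: "r \<in> carrier A" and "y \<in> carrier (E\<lparr>carrier := f ` carrier E\<rparr>)"
    then obtain u where u: "u \<in> carrier E" "y = f u" by auto
    then have "r \<odot>\<^bsub>E\<^esub> y = f (r \<odot>\<^bsub>E\<^esub> u)" using module_homs_smult[OF f] r by simp
    then show "k (s (r \<odot>\<^bsub>E\<lparr>carrier := f ` carrier E\<rparr>\<^esub> y)) = r \<odot>\<^bsub>E\<^esub> k (s y)"
      using ks u r module_homs_smult[OF k] by simp
  qed
  from extend_endo[OF hom_image_submodule[OF module_axioms f carrier_is_submodule] this]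
  obtain h where "h \<in> module_homs A E E" and "\<And>y. y \<in> f ` carrier E \<Longrightarrow> h y = k (s y)" by auto
  then show ?thesis using ks by (intro bexI[of _ h]) auto
qed

text \<open>
  If the kernel \<open>K\<close> of \<open>x\<close> were faithful over \<open>A\<close>, it would contain a nonzero divisible submodule.  An
  \<open>a \<noteq> 0\<close> killing \<open>K\<close> is a multiple of \<open>x\<close> among the endomorphisms, that is, in the completion.
\<close>

lemma simple_divisible_multiple_in_A:
  assumes E: "simple_divisible A E" and x: "x \<in> carrier (completion A)" "x \<noteq> \<zero>\<^bsub>completion A\<^esub>"
  shows "\<exists>a \<in> carrier A. \<exists>y \<in> carrier (completion A). a \<noteq> \<zero> \<and> completion_map A a = y \<otimes>\<^bsub>completion A\<^esub> x"
proof -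
  interpret C: domain "completion A" by (rule simple_divisible_imp_domain[OF E])
  have dom: "domain A" by (rule domain_of_completion[OF simple_divisible_imp_domain[OF E]])
  define K where "K = {e \<in> carrier E. act x e = \<zero>\<^bsub>E\<^esub>}"
  have K: "submodule K A E"
    unfolding K_def by (rule hom_kernel_submodule[OF module_axioms act_hom[OF x(1)] carrier_is_submodule])
  have KE: "K \<subset> carrier E"
  proof -
    have "K \<noteq> carrier E" using act_faithful[OF x(1)] x(2) by (auto simp: K_def)
    then show ?thesis by (auto simp: K_def)
  qed
  have "\<not> (\<forall>a. a \<in> carrier A \<longrightarrow> (\<forall>e \<in> K. a \<odot>\<^bsub>E\<^esub> e = \<zero>\<^bsub>E\<^esub>) \<longrightarrow> a = \<zero>)"
  proof
    assume "\<forall>a. a \<in> carrier A \<longrightarrow> (\<forall>e \<in> K. a \<odot>\<^bsub>E\<^esub> e = \<zero>\<^bsub>E\<^esub>) \<longrightarrow> a = \<zero>"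
    then have "\<exists>V \<subseteq> K. submodule V A E \<and> V \<noteq> {\<zero>\<^bsub>E\<^esub>} \<and> divisible_module A (E\<lparr>carrier := V\<rparr>)"
      by (intro faithful_submodule_contains_divisible[OF dom K]) simp
    then obtain V where "V \<subseteq> K" "submodule V A E" "V \<noteq> {\<zero>\<^bsub>E\<^esub>}" "divisible_module A (E\<lparr>carrier := V\<rparr>)"
      by blast
    then show False using E KE unfolding simple_divisible_def by blast
  qed
  then obtain a where a: "a \<in> carrier A" "a \<noteq> \<zero>" and aK: "\<And>e. e \<in> K \<Longrightarrow> a \<odot>\<^bsub>E\<^esub> e = \<zero>\<^bsub>E\<^esub>" by blast
  have "\<exists>h \<in> module_homs A E E. \<forall>e \<in> carrier E. a \<odot>\<^bsub>E\<^esub> e = h (act x e)"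
    by (rule factor_through[OF act_hom[OF x(1)] smult_hom[OF a(1)]]) (use aK in \<open>auto simp: K_def\<close>)
  then obtain h where h: "h \<in> module_homs A E E" "\<And>e. e \<in> carrier E \<Longrightarrow> a \<odot>\<^bsub>E\<^esub> e = h (act x e)" by blast
  obtain y where y: "y \<in> carrier (completion A)" "\<And>e. e \<in> carrier E \<Longrightarrow> h e = act y e"
    using act_surjective[OF h(1)] by blast
  have eq: "act (completion_map A a) e = act (y \<otimes>\<^bsub>completion A\<^esub> x) e" if "e \<in> carrier E" for e
    using act_completion_map[OF a(1) that] h(2)[OF that] y(2)[OF act_closed[OF x(1) that]]
      act_mult[OF y(1) x(1) that] by simp
  have "completion_map A a = y \<otimes>\<^bsub>completion A\<^esub> x"
    by (rule act_injective) (use eq completion_map_closed[OF a(1)] x y in auto)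
  then show ?thesis using a y by blast
qed

lemma simple_divisible_imp_essentially_complete:
  assumes E: "simple_divisible A E"
  shows "essentially_complete A"
  unfolding essentially_complete_def
proof (intro allI impI)
  fix I assume I: "essential_ideal I (completion A)"
  interpret C: domain "completion A" by (rule simple_divisible_imp_domain[OF E])
  interpret D: domain A by (rule domain_of_completion[OF simple_divisible_imp_domain[OF E]])
  have idI: "ideal I (completion A)" using I by (simp add: essential_ideal_def)
  obtain x where x: "x \<in> I" "x \<noteq> \<zero>\<^bsub>completion A\<^esub>" using C.essential_ideal_nonzero[OF I] by auto
  have xc: "x \<in> carrier (completion A)" by (rule ideal.Icarr[OF idI x(1)])
  from simple_divisible_multiple_in_A[OF E xc x(2)]
  obtain a y where a: "a \<in> carrier A" "a \<noteq> \<zero>" "y \<in> carrier (completion A)"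
    "completion_map A a = y \<otimes>\<^bsub>completion A\<^esub> x"
    by auto
  define I' where "I' = {a \<in> carrier A. completion_map A a \<in> I}"
  have idI': "ideal I' A" unfolding I'_def by (rule contraction_ideal[OF idI])
  have aI: "a \<in> I'" unfolding I'_def using a ideal.I_l_closed[OF idI x(1)] by simp
  show "essential_ideal {a \<in> carrier A. completion_map A a \<in> I} A"
    using D.essential_idealI[OF idI' aI a(2)] by (simp add: I'_def)
qed

text \<open>
  A nonzero endomorphism that vanishes on a proper submodule \<open>V\<close> has a nonzero multiple in \<open>A\<close>, which
  kills \<open>V\<close> and so prevents \<open>V\<close> from being divisible.
\<close>

lemma complete_imp_simple_divisible:
  assumes dom: "domain (completion A)" and ec: "essentially_complete A"
  shows "simple_divisible A E"
  unfolding simple_divisible_def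
proof (intro conjI allI impI divisible E_nonzero)
  interpret C: domain "completion A" by (rule dom)
  interpret D: domain A by (rule domain_of_completion[OF dom])
  fix V assume "submodule V A E \<and> V \<noteq> {\<zero>\<^bsub>E\<^esub>} \<and> V \<subset> carrier E"
  then have V: "submodule V A E" "V \<noteq> {\<zero>\<^bsub>E\<^esub>}" "V \<subset> carrier E" by auto
  show "\<not> divisible_module A (E\<lparr>carrier := V\<rparr>)"
  proof
    assume div: "divisible_module A (E\<lparr>carrier := V\<rparr>)"
    obtain e where e: "e \<in> carrier E" "e \<notin> V" using V(3) by blast
    obtain f where f: "f \<in> module_homs A E E" "\<And>v. v \<in> V \<Longrightarrow> f v = \<zero>\<^bsub>E\<^esub>" "f e = e\<^sub>0"
      using separating_hom[OF module_axioms V(1) e] by blast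
    obtain x where x: "x \<in> carrier (completion A)" "\<And>e. e \<in> carrier E \<Longrightarrow> f e = act x e"
      using act_surjective[OF f(1)] by blast
    have x0: "x \<noteq> \<zero>\<^bsub>completion A\<^esub>" using x(2)[OF e(1)] f(3) act_zero[OF e(1)] e\<^sub>0_nonzero by auto
    define I where "I = PIdl\<^bsub>completion A\<^esub> x"
    have idI: "ideal I (completion A)" unfolding I_def by (rule C.cgenideal_ideal[OF x(1)])
    have xI: "x \<in> I" unfolding I_def by (rule C.cgenideal_self[OF x(1)])
    have "essential_ideal I (completion A)" by (rule C.essential_idealI[OF idI xI x0])
    then have ess: "essential_ideal {a \<in> carrier A. completion_map A a \<in> I} A"
      using ec by (simp add: essentially_complete_def)
    obtain a where a: "a \<in> carrier A" "completion_map A a \<in> I" "a \<noteq> \<zero>"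
      using D.essential_ideal_nonzero[OF ess] by auto
    then obtain y where y: "y \<in> carrier (completion A)" "completion_map A a = y \<otimes>\<^bsub>completion A\<^esub> x"
      by (auto simp: I_def cgenideal_def)
    have "a \<odot>\<^bsub>E\<^esub> v = \<zero>\<^bsub>E\<^esub>" if v: "v \<in> V" for v
    proof -
      have vc: "v \<in> carrier E" using v V by blast
      have "a \<odot>\<^bsub>E\<^esub> v = act y (act x v)"
        using act_completion_map[OF a(1) vc] y act_mult[OF y(1) x(1) vc] by simp
      also have "act x v = \<zero>\<^bsub>E\<^esub>" using x(2)[OF vc] f(2)[OF v] by simp
      finally show ?thesis
        using module_homs_zero[OF module_axioms module_axioms act_hom[OF y(1)]] by simp
    qed
    then have "(\<lambda>v. a \<odot>\<^bsub>E\<^esub> v) ` V \<subseteq> {\<zero>\<^bsub>E\<^esub>}" by blast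
    moreover have "non_zero_divisor A a"
      unfolding non_zero_divisor_def using a D.integral by blast
    then have "(\<lambda>v. a \<odot>\<^bsub>E\<^esub> v) ` V = V" using div unfolding divisible_module_def by simp
    ultimately show False using V(2) submodule_zero[OF V(1)] by blast
  qed
qed

theorem simple_divisible_iff:
  "simple_divisible A E \<longleftrightarrow> analytically_irreducible A \<and> essentially_complete A"
  unfolding analytically_irreducible_def
  using simple_divisible_imp_domain simple_divisible_imp_essentially_complete
    complete_imp_simple_divisible by blast

end

section \<open>Localization of rings\<close>

locale multiplicative_set = cring R for R (structure) +
  fixes S :: "'a set"
  assumes S_carrier: "S \<subseteq> carrier R"
    and one_S: "\<one> \<in> S"
    and mult_S: "s \<in> S \<Longrightarrow> t \<in> S \<Longrightarrow> s \<otimes> t \<in> S"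
begin

abbreviation frac :: "'a \<Rightarrow> 'a \<Rightarrow> ('a \<times> 'a) set"
  where "frac \<equiv> fraction R S"

abbreviation L :: "('a \<times> 'a) set ring"
  where "L \<equiv> localization R S"

lemma S_closed [simp]: "s \<in> S \<Longrightarrow> s \<in> carrier R"
  using S_carrier by blast

lemma fraction_rel_iff:
  "((a, s), (b, t)) \<in> fraction_rel R S \<longleftrightarrow>
    a \<in> carrier R \<and> s \<in> S \<and> b \<in> carrier R \<and> t \<in> S \<and> (\<exists>u \<in> S. u \<otimes> (a \<otimes> t) = u \<otimes> (b \<otimes> s))"
proof -
  have "u \<otimes> (a \<otimes> t \<ominus> b \<otimes> s) = \<zero> \<longleftrightarrow> u \<otimes> (a \<otimes> t) = u \<otimes> (b \<otimes> s)"
    if c: "a \<in> carrier R" "s \<in> S" "b \<in> carrier R" "t \<in> S" "u \<in> S" for u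
  proof -
    have "u \<otimes> (a \<otimes> t \<ominus> b \<otimes> s) = u \<otimes> (a \<otimes> t) \<ominus> u \<otimes> (b \<otimes> s)"
      using c by (simp add: a_minus_def r_distr r_minus)
    then show ?thesis using c by simp
  qed
  then show ?thesis by (auto simp: fraction_rel_def)
qed

lemma fraction_rel_trans:
  assumes "((a, s), (b, t)) \<in> fraction_rel R S" and "((b, t), (c, w)) \<in> fraction_rel R S"
  shows "((a, s), (c, w)) \<in> fraction_rel R S"
proof -
  obtain u v where c: "a \<in> carrier R" "s \<in> S" "b \<in> carrier R" "t \<in> S" "c \<in> carrier R" "w \<in> S"
    "u \<in> S" "v \<in> S" and u: "u \<otimes> (a \<otimes> t) = u \<otimes> (b \<otimes> s)" and v: "v \<otimes> (b \<otimes> w) = v \<otimes> (c \<otimes> t)"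
    using assms unfolding fraction_rel_iff by blast
  have "(u \<otimes> v \<otimes> t) \<otimes> (a \<otimes> w) = (u \<otimes> (a \<otimes> t)) \<otimes> (v \<otimes> w)" using c by (simp add: m_ac)
  also have "\<dots> = (v \<otimes> (b \<otimes> w)) \<otimes> (u \<otimes> s)" unfolding u using c by (simp add: m_ac)
  also have "\<dots> = (u \<otimes> v \<otimes> t) \<otimes> (c \<otimes> s)" unfolding v using c by (simp add: m_ac)
  finally show ?thesis unfolding fraction_rel_iff using c mult_S by blast
qed

lemma equiv_fraction_rel: "equiv (carrier R \<times> S) (fraction_rel R S)"
proof (rule equivI)
  show "fraction_rel R S \<subseteq> (carrier R \<times> S) \<times> (carrier R \<times> S)" by (auto simp: fraction_rel_def)
  show "refl_on (carrier R \<times> S) (fraction_rel R S)"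
    unfolding refl_on_def using one_S by (auto simp: fraction_rel_iff)
  show "sym (fraction_rel R S)"
    by (rule symI) (auto simp: fraction_rel_iff, metis)
  show "trans (fraction_rel R S)" by (rule transI) (auto intro: fraction_rel_trans)
qed

lemma frac_eq_iff:
  assumes "a \<in> carrier R" "s \<in> S" "b \<in> carrier R" "t \<in> S"
  shows "frac a s = frac b t \<longleftrightarrow> (\<exists>u \<in> S. u \<otimes> (a \<otimes> t) = u \<otimes> (b \<otimes> s))"
  using eq_equiv_class_iff[OF equiv_fraction_rel, of "(a, s)" "(b, t)"] assms
  by (simp add: fraction_def fraction_rel_iff)

lemma frac_eqI:
  assumes "a \<in> carrier R" "s \<in> S" "b \<in> carrier R" "t \<in> S" "a \<otimes> t = b \<otimes> s"
  shows "frac a s = frac b t"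
  using frac_eq_iff[OF assms(1-4)] one_S assms by auto

lemma mem_frac:
  assumes "a \<in> carrier R" "s \<in> S"
  shows "(b, t) \<in> frac a s \<longleftrightarrow> b \<in> carrier R \<and> t \<in> S \<and> frac b t = frac a s"
  unfolding fraction_def Image_singleton_iff
  using eq_equiv_class_iff[OF equiv_fraction_rel, of "(a, s)" "(b, t)"] assms
  by (auto simp: fraction_rel_iff)

lemma carrier_L: "P \<in> carrier L \<longleftrightarrow> (\<exists>a \<in> carrier R. \<exists>s \<in> S. P = frac a s)"
  by (auto simp: localization_def quotient_def fraction_def)

lemma frac_closed [simp]: "a \<in> carrier R \<Longrightarrow> s \<in> S \<Longrightarrow> frac a s \<in> carrier L"
  using carrier_L by blast

lemma zero_L: "\<zero>\<^bsub>L\<^esub> = frac \<zero> \<one>"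
  by (simp add: localization_def)

lemma one_L: "\<one>\<^bsub>L\<^esub> = frac \<one> \<one>"
  by (simp add: localization_def)

lemma Union_frac:
  assumes as: "a \<in> carrier R" "s \<in> S" and bt: "b \<in> carrier R" "t \<in> S"
    and const: "\<And>a' s' b' t'. a' \<in> carrier R \<Longrightarrow> s' \<in> S \<Longrightarrow> b' \<in> carrier R \<Longrightarrow> t' \<in> S \<Longrightarrow>
      frac a' s' = frac a s \<Longrightarrow> frac b' t' = frac b t \<Longrightarrow> F a' s' b' t' = F a s b t"
  shows "(\<Union>(a', s') \<in> frac a s. \<Union>(b', t') \<in> frac b t. F a' s' b' t') = F a s b t"
proof -
  have "(a, s) \<in> frac a s" "(b, t) \<in> frac b t" using as bt by (simp_all add: mem_frac)
  then have "F a s b t \<subseteq> (\<Union>(a', s') \<in> frac a s. \<Union>(b', t') \<in> frac b t. F a' s' b' t')" by blast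
  moreover have "F a' s' b' t' = F a s b t" if "(a', s') \<in> frac a s" "(b', t') \<in> frac b t" for a' s' b' t'
    using that as bt const[of a' s' b' t'] by (simp add: mem_frac)
  then have "(\<Union>(a', s') \<in> frac a s. \<Union>(b', t') \<in> frac b t. F a' s' b' t') \<subseteq> F a s b t" by fast
  ultimately show ?thesis by (rule subset_antisym[rotated])
qed

lemma frac_mult:
  assumes as: "a \<in> carrier R" "s \<in> S" and bt: "b \<in> carrier R" "t \<in> S"
  shows "frac a s \<otimes>\<^bsub>L\<^esub> frac b t = frac (a \<otimes> b) (s \<otimes> t)"
proof -
  have "frac (a' \<otimes> b') (s' \<otimes> t') = frac (a \<otimes> b) (s \<otimes> t)"
    if c: "a' \<in> carrier R" "s' \<in> S" "b' \<in> carrier R" "t' \<in> S"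
      and eq: "frac a' s' = frac a s" "frac b' t' = frac b t" for a' s' b' t'
  proof -
    obtain u v where uv: "u \<in> S" "v \<in> S" "u \<otimes> (a' \<otimes> s) = u \<otimes> (a \<otimes> s')" "v \<otimes> (b' \<otimes> t) = v \<otimes> (b \<otimes> t')"
      using eq c as bt by (auto simp: frac_eq_iff)
    have "(u \<otimes> v) \<otimes> ((a' \<otimes> b') \<otimes> (s \<otimes> t)) = (u \<otimes> (a' \<otimes> s)) \<otimes> (v \<otimes> (b' \<otimes> t))"
      using c as bt uv(1,2) by (simp add: m_ac)
    also have "\<dots> = (u \<otimes> v) \<otimes> ((a \<otimes> b) \<otimes> (s' \<otimes> t'))"
      unfolding uv(3,4) using c as bt uv(1,2) by (simp add: m_ac)
    finally show ?thesis using c as bt uv(1,2) mult_S by (subst frac_eq_iff) auto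
  qed
  then show ?thesis
    unfolding localization_def using Union_frac[OF as bt, of "\<lambda>a s b t. frac (a \<otimes> b) (s \<otimes> t)"] by simp
qed

lemma frac_add:
  assumes as: "a \<in> carrier R" "s \<in> S" and bt: "b \<in> carrier R" "t \<in> S"
  shows "frac a s \<oplus>\<^bsub>L\<^esub> frac b t = frac (a \<otimes> t \<oplus> b \<otimes> s) (s \<otimes> t)"
proof -
  have "frac (a' \<otimes> t' \<oplus> b' \<otimes> s') (s' \<otimes> t') = frac (a \<otimes> t \<oplus> b \<otimes> s) (s \<otimes> t)"
    if c: "a' \<in> carrier R" "s' \<in> S" "b' \<in> carrier R" "t' \<in> S"
      and eq: "frac a' s' = frac a s" "frac b' t' = frac b t" for a' s' b' t'
  proof -
    obtain u v where uv: "u \<in> S" "v \<in> S" "u \<otimes> (a' \<otimes> s) = u \<otimes> (a \<otimes> s')" "v \<otimes> (b' \<otimes> t) = v \<otimes> (b \<otimes> t')"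
      using eq c as bt by (auto simp: frac_eq_iff)
    have "(u \<otimes> v) \<otimes> ((a' \<otimes> t' \<oplus> b' \<otimes> s') \<otimes> (s \<otimes> t)) =
        (u \<otimes> (a' \<otimes> s)) \<otimes> (v \<otimes> (t \<otimes> t')) \<oplus> (v \<otimes> (b' \<otimes> t)) \<otimes> (u \<otimes> (s \<otimes> s'))"
      using c as bt uv(1,2) by (simp add: m_ac r_distr l_distr)
    also have "\<dots> = (u \<otimes> v) \<otimes> ((a \<otimes> t \<oplus> b \<otimes> s) \<otimes> (s' \<otimes> t'))"
      unfolding uv(3,4) using c as bt uv(1,2) by (simp add: m_ac r_distr l_distr)
    finally show ?thesis using c as bt uv(1,2) mult_S by (subst frac_eq_iff) auto
  qed
  then show ?thesis
    unfolding localization_def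
    using Union_frac[OF as bt, of "\<lambda>a s b t. frac (a \<otimes> t \<oplus> b \<otimes> s) (s \<otimes> t)"] by simp
qed

lemma frac_cases:
  assumes "P \<in> carrier L"
  obtains a s where "a \<in> carrier R" "s \<in> S" "P = frac a s"
  using assms carrier_L by blast

lemma localization_cring: "cring L"
proof (rule cringI)
  show "abelian_group L"
  proof (rule abelian_groupI)
    fix P Q W assume "P \<in> carrier L" "Q \<in> carrier L" "W \<in> carrier L"
    then obtain a s b t c w where *: "a \<in> carrier R" "s \<in> S" "b \<in> carrier R" "t \<in> S" "c \<in> carrier R" "w \<in> S"
      and eq: "P = frac a s" "Q = frac b t" "W = frac c w"
      by (metis frac_cases)
    show "P \<oplus>\<^bsub>L\<^esub> Q \<oplus>\<^bsub>L\<^esub> W = P \<oplus>\<^bsub>L\<^esub> (Q \<oplus>\<^bsub>L\<^esub> W)"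
      unfolding eq using * mult_S by (simp add: frac_add m_ac a_ac r_distr l_distr)
  next
    fix P Q assume "P \<in> carrier L" "Q \<in> carrier L"
    then obtain a s b t where *: "a \<in> carrier R" "s \<in> S" "b \<in> carrier R" "t \<in> S"
      and eq: "P = frac a s" "Q = frac b t"
      by (metis frac_cases)
    show "P \<oplus>\<^bsub>L\<^esub> Q = Q \<oplus>\<^bsub>L\<^esub> P"
      unfolding eq using * by (simp add: frac_add m_ac a_ac)
    show "P \<oplus>\<^bsub>L\<^esub> Q \<in> carrier L"
      unfolding eq using * mult_S by (simp add: frac_add)
  next
    fix P assume "P \<in> carrier L"
    then obtain a s where *: "a \<in> carrier R" "s \<in> S" and eq: "P = frac a s" by (metis frac_cases)
    show "\<zero>\<^bsub>L\<^esub> \<oplus>\<^bsub>L\<^esub> P = P" unfolding eq zero_L using * one_S by (simp add: frac_add)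
    have "frac (\<ominus> a) s \<oplus>\<^bsub>L\<^esub> P = frac (\<ominus> a \<otimes> s \<oplus> a \<otimes> s) (s \<otimes> s)"
      unfolding eq using * by (simp add: frac_add)
    also have "\<dots> = \<zero>\<^bsub>L\<^esub>"
      unfolding zero_L using * one_S mult_S by (intro frac_eqI) (simp_all add: l_minus l_neg)
    finally show "\<exists>Q \<in> carrier L. Q \<oplus>\<^bsub>L\<^esub> P = \<zero>\<^bsub>L\<^esub>" using * by (intro bexI[of _ "frac (\<ominus> a) s"]) simp_all
  next
    show "\<zero>\<^bsub>L\<^esub> \<in> carrier L" unfolding zero_L using one_S by simp
  qed
  show "comm_monoid L"
  proof (rule comm_monoidI)
    fix P Q W assume "P \<in> carrier L" "Q \<in> carrier L" "W \<in> carrier L"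
    then obtain a s b t c w where *: "a \<in> carrier R" "s \<in> S" "b \<in> carrier R" "t \<in> S" "c \<in> carrier R" "w \<in> S"
      and eq: "P = frac a s" "Q = frac b t" "W = frac c w"
      by (metis frac_cases)
    show "P \<otimes>\<^bsub>L\<^esub> Q \<otimes>\<^bsub>L\<^esub> W = P \<otimes>\<^bsub>L\<^esub> (Q \<otimes>\<^bsub>L\<^esub> W)"
      unfolding eq using * mult_S by (simp add: frac_mult m_ac)
  next
    fix P Q assume "P \<in> carrier L" "Q \<in> carrier L"
    then obtain a s b t where *: "a \<in> carrier R" "s \<in> S" "b \<in> carrier R" "t \<in> S"
      and eq: "P = frac a s" "Q = frac b t"
      by (metis frac_cases)
    show "P \<otimes>\<^bsub>L\<^esub> Q = Q \<otimes>\<^bsub>L\<^esub> P"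
      unfolding eq using * by (simp add: frac_mult m_ac)
    show "P \<otimes>\<^bsub>L\<^esub> Q \<in> carrier L"
      unfolding eq using * mult_S by (simp add: frac_mult)
  next
    fix P assume "P \<in> carrier L"
    then obtain a s where *: "a \<in> carrier R" "s \<in> S" and eq: "P = frac a s" by (metis frac_cases)
    show "\<one>\<^bsub>L\<^esub> \<otimes>\<^bsub>L\<^esub> P = P" unfolding eq one_L using * one_S by (simp add: frac_mult)
  next
    show "\<one>\<^bsub>L\<^esub> \<in> carrier L" unfolding one_L using one_S by simp
  qed
next
  fix P Q W assume "P \<in> carrier L" "Q \<in> carrier L" "W \<in> carrier L"
  then obtain a s b t c w where *: "a \<in> carrier R" "s \<in> S" "b \<in> carrier R" "t \<in> S" "c \<in> carrier R" "w \<in> S"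
    and eq: "P = frac a s" "Q = frac b t" "W = frac c w"
    by (metis frac_cases)
  have "(P \<oplus>\<^bsub>L\<^esub> Q) \<otimes>\<^bsub>L\<^esub> W = frac ((a \<otimes> t \<oplus> b \<otimes> s) \<otimes> c) (s \<otimes> t \<otimes> w)"
    unfolding eq using * mult_S by (simp add: frac_add frac_mult)
  also have "\<dots> = frac (a \<otimes> c \<otimes> (t \<otimes> w) \<oplus> b \<otimes> c \<otimes> (s \<otimes> w)) (s \<otimes> w \<otimes> (t \<otimes> w))"
    using * mult_S by (intro frac_eqI) (simp_all add: m_ac a_ac r_distr l_distr)
  also have "\<dots> = P \<otimes>\<^bsub>L\<^esub> W \<oplus>\<^bsub>L\<^esub> Q \<otimes>\<^bsub>L\<^esub> W"
    unfolding eq using * mult_S by (simp add: frac_add frac_mult)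
  finally show "(P \<oplus>\<^bsub>L\<^esub> Q) \<otimes>\<^bsub>L\<^esub> W = P \<otimes>\<^bsub>L\<^esub> W \<oplus>\<^bsub>L\<^esub> Q \<otimes>\<^bsub>L\<^esub> W" .
qed

definition loc :: "'a \<Rightarrow> ('a \<times> 'a) set"
  where "loc r = frac r \<one>"

lemma loc_closed [simp]: "r \<in> carrier R \<Longrightarrow> loc r \<in> carrier L"
  by (simp add: loc_def one_S)

lemma loc_ring_hom: "ring_hom_ring R L loc"
proof -
  interpret L: cring L by (rule localization_cring)
  show ?thesis
  proof (rule ring_hom_ringI2[OF ring_axioms L.ring_axioms], rule ring_hom_memI)
    show "loc \<one> = \<one>\<^bsub>L\<^esub>" by (simp add: loc_def one_L)
  qed (use one_S in \<open>simp_all add: loc_def frac_mult frac_add\<close>)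
qed

lemma loc_numerator:
  assumes "a \<in> carrier R" "s \<in> S"
  shows "loc s \<otimes>\<^bsub>L\<^esub> frac a s = loc a"
  unfolding loc_def using assms one_S
  by (simp add: frac_mult) (intro frac_eqI, simp_all add: m_ac)

lemma frac_eq_mult_loc:
  assumes "a \<in> carrier R" "s \<in> S"
  shows "frac \<one> s \<otimes>\<^bsub>L\<^esub> loc a = frac a s"
  unfolding loc_def using assms one_S by (simp add: frac_mult)

lemma frac_unit:
  assumes "a \<in> S" "s \<in> S"
  shows "frac a s \<in> Units L"
proof -
  have eq: "frac s a \<otimes>\<^bsub>L\<^esub> frac a s = \<one>\<^bsub>L\<^esub>" "frac a s \<otimes>\<^bsub>L\<^esub> frac s a = \<one>\<^bsub>L\<^esub>"
    unfolding one_L using assms one_S mult_S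
    by (simp_all add: frac_mult) (intro frac_eqI; simp add: m_ac)+
  then show ?thesis using assms by (auto simp: Units_def intro!: bexI[of _ "frac s a"])
qed

text \<open>Every ideal of the localization is generated by its contraction to \<open>R\<close>.\<close>

lemma localization_noetherian:
  assumes "noetherian_ring R"
  shows "noetherian_ring L"
proof -
  interpret N: noetherian_ring R by (rule assms)
  interpret L: cring L by (rule localization_cring)
  interpret h: ring_hom_ring R L loc by (rule loc_ring_hom)
  show ?thesis
  proof (rule L.noetherian_ringI)
    fix J assume J: "ideal J L"
    define I where "I = {r \<in> carrier R. loc r \<in> J}"
    have "ideal I R" unfolding I_def by (rule h.ideal_vimage[OF J])
    then obtain T where T: "T \<subseteq> carrier R" "finite T" "I = Idl T" using N.finetely_gen by blast
    have TI: "T \<subseteq> I" using T genideal_self by blast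
    have locT: "loc ` T \<subseteq> carrier L" using T(1) by auto
    let ?K = "Idl\<^bsub>L\<^esub> (loc ` T)"
    have K: "ideal ?K L" by (rule L.genideal_ideal[OF locT])
    have "?K \<subseteq> J" using TI by (intro L.genideal_minimal[OF J]) (auto simp: I_def)
    moreover have "J \<subseteq> ?K"
    proof
      fix P assume P: "P \<in> J"
      then obtain a s where as: "a \<in> carrier R" "s \<in> S" "P = frac a s"
        using frac_cases[of P] ideal.Icarr[OF J] by metis
      have "loc a \<in> J" using ideal.I_l_closed[OF J P, of "loc s"] loc_numerator[OF as(1,2)] as by simp
      then have "a \<in> I" using as by (simp add: I_def)
      moreover have "I \<subseteq> {r \<in> carrier R. loc r \<in> ?K}"
      proof -
        have "T \<subseteq> {r \<in> carrier R. loc r \<in> ?K}" using T(1) L.genideal_self[OF locT] by blast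
        then have "Idl T \<subseteq> {r \<in> carrier R. loc r \<in> ?K}" by (rule genideal_minimal[OF h.ideal_vimage[OF K]])
        then show ?thesis using T(3) by simp
      qed
      ultimately have "loc a \<in> ?K" by blast
      then have "frac \<one> s \<otimes>\<^bsub>L\<^esub> loc a \<in> ?K" using ideal.I_l_closed[OF K] as by simp
      then show "P \<in> ?K" using frac_eq_mult_loc[OF as(1,2)] as by simp
    qed
    ultimately show "\<exists>T' \<subseteq> carrier L. finite T' \<and> J = Idl\<^bsub>L\<^esub> T'"
      using locT T(2) by (intro exI[of _ "loc ` T"]) auto
  qed
qed

lemma frac_zero_iff:
  assumes "a \<in> carrier R" "s \<in> S"
  shows "frac a s = \<zero>\<^bsub>L\<^esub> \<longleftrightarrow> (\<exists>u \<in> S. u \<otimes> a = \<zero>)"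
  unfolding zero_L using assms one_S by (simp add: frac_eq_iff)

lemma non_zero_divisor_loc:
  assumes r: "non_zero_divisor R r"
  shows "non_zero_divisor L (loc r)"
  unfolding non_zero_divisor_def
proof (intro conjI ballI impI)
  have rc: "r \<in> carrier R" using r by (simp add: non_zero_divisor_def)
  then show "loc r \<in> carrier L" by simp
  fix P assume P: "P \<in> carrier L" and zero: "loc r \<otimes>\<^bsub>L\<^esub> P = \<zero>\<^bsub>L\<^esub>"
  obtain a s where as: "a \<in> carrier R" "s \<in> S" "P = frac a s" using frac_cases[OF P] .
  have "frac (r \<otimes> a) s = \<zero>\<^bsub>L\<^esub>" using zero as rc one_S by (simp add: loc_def frac_mult)
  then obtain u where u: "u \<in> S" "u \<otimes> (r \<otimes> a) = \<zero>" using as rc by (auto simp: frac_zero_iff)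
  then have "r \<otimes> (u \<otimes> a) = \<zero>" using as rc by (simp add: m_lcomm)
  then have "u \<otimes> a = \<zero>" using r u as by (simp add: non_zero_divisor_def)
  then show "P = \<zero>\<^bsub>L\<^esub>" using as u by (auto simp: frac_zero_iff)
qed

lemma non_zero_divisor_numerator:
  assumes inj: "inj_on loc (carrier R)" and a: "a \<in> carrier R" and s: "s \<in> S"
    and nzd: "non_zero_divisor L (frac a s)"
  shows "non_zero_divisor R a"
  unfolding non_zero_divisor_def
proof (intro conjI ballI impI a)
  fix t assume t: "t \<in> carrier R" and zero: "a \<otimes> t = \<zero>"
  have "frac a s \<otimes>\<^bsub>L\<^esub> loc t = \<zero>\<^bsub>L\<^esub>"
    using a s t zero one_S by (auto simp: loc_def frac_mult frac_zero_iff)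
  then have "loc t = \<zero>\<^bsub>L\<^esub>" using nzd t by (simp add: non_zero_divisor_def)
  then have "loc t = loc \<zero>" by (simp add: loc_def zero_L)
  then show "t = \<zero>" using inj t by (simp add: inj_on_def)
qed

lemma non_zero_divisor_denominator:
  assumes inj: "inj_on loc (carrier R)" and s: "s \<in> S"
  shows "non_zero_divisor R s"
  unfolding non_zero_divisor_def
proof (intro conjI ballI impI S_closed[OF s])
  fix t assume t: "t \<in> carrier R" and zero: "s \<otimes> t = \<zero>"
  then have "loc t = \<zero>\<^bsub>L\<^esub>" unfolding loc_def using s one_S by (auto simp: frac_zero_iff)
  then have "loc t = loc \<zero>" by (simp add: loc_def zero_L)
  then show "t = \<zero>" using inj t by (simp add: inj_on_def)
qed

text \<open>
  The ring operations of a module record carry no information; they are copied to fill the fields.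
\<close>

definition restrict_scalars :: "(('a \<times> 'a) set, 'm, 'y) module_scheme \<Rightarrow> ('a, 'm) module"
  where "restrict_scalars M =
    \<lparr>carrier = carrier M, monoid.mult = (\<otimes>\<^bsub>M\<^esub>), one = \<one>\<^bsub>M\<^esub>, ring.zero = \<zero>\<^bsub>M\<^esub>, add = (\<oplus>\<^bsub>M\<^esub>),
     smult = (\<lambda>r x. loc r \<odot>\<^bsub>M\<^esub> x)\<rparr>"

lemma restrict_scalars_module:
  assumes "module L M"
  shows "module R (restrict_scalars M)"
proof -
  interpret M: module L M by (rule assms)
  interpret h: ring_hom_ring R L loc by (rule loc_ring_hom)
  show ?thesis
  proof (rule moduleI)
    show "abelian_group (restrict_scalars M)"
      by (rule abelian_groupI)
        (auto simp: restrict_scalars_def M.M.a_ac M.M.l_neg intro!: bexI[of _ "\<ominus>\<^bsub>M\<^esub> _"])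
  qed (auto simp: restrict_scalars_def is_cring M.smult_l_distr M.smult_r_distr M.smult_assoc1)
qed

lemma restrict_scalars_hom:
  "f \<in> module_homs L M N \<Longrightarrow> f \<in> module_homs R (restrict_scalars M) (restrict_scalars N)"
  by (auto simp: module_homs_def restrict_scalars_def)

end

section \<open>Localization of modules\<close>

text \<open>
  Modules on which a multiplicative set acts bijectively are the modules over the localization;
  no tensor product is involved, the underlying additive group stays the same.
\<close>

locale localized_module = module R E + multiplicative_set R S
  for R :: "('a, 'r) ring_scheme" (structure) and E :: "('a, 'e, 'x) module_scheme" (structure) and S +
  assumes S_inj: "s \<in> S \<Longrightarrow> x \<in> carrier E \<Longrightarrow> y \<in> carrier E \<Longrightarrow> s \<odot>\<^bsub>E\<^esub> x = s \<odot>\<^bsub>E\<^esub> y \<Longrightarrow> x = y"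
    and S_surj: "s \<in> S \<Longrightarrow> x \<in> carrier E \<Longrightarrow> \<exists>y \<in> carrier E. s \<odot>\<^bsub>E\<^esub> y = x"
begin

text \<open>The fraction \<open>a/s\<close> sends \<open>x\<close> to the unique solution \<open>y\<close> of \<open>s y = a x\<close>.\<close>

definition loc_smult :: "('a \<times> 'a) set \<Rightarrow> 'e \<Rightarrow> 'e"
  where "loc_smult P x = (THE y. \<exists>a s. a \<in> carrier R \<and> s \<in> S \<and> P = frac a s \<and>
    y \<in> carrier E \<and> s \<odot>\<^bsub>E\<^esub> y = a \<odot>\<^bsub>E\<^esub> x)"

lemma loc_smult_eq:
  assumes c: "a \<in> carrier R" "s \<in> S" "x \<in> carrier E" "y \<in> carrier E" and y: "s \<odot>\<^bsub>E\<^esub> y = a \<odot>\<^bsub>E\<^esub> x"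
  shows "loc_smult (frac a s) x = y"
  unfolding loc_smult_def
proof (rule the_equality)
  show "\<exists>b t. b \<in> carrier R \<and> t \<in> S \<and> frac a s = frac b t \<and> y \<in> carrier E \<and> t \<odot>\<^bsub>E\<^esub> y = b \<odot>\<^bsub>E\<^esub> x"
    using assms by blast
next
  fix z assume "\<exists>b t. b \<in> carrier R \<and> t \<in> S \<and> frac a s = frac b t \<and> z \<in> carrier E \<and> t \<odot>\<^bsub>E\<^esub> z = b \<odot>\<^bsub>E\<^esub> x"
  then obtain b t where bt: "b \<in> carrier R" "t \<in> S" "frac a s = frac b t" and z: "z \<in> carrier E"
    and tz: "t \<odot>\<^bsub>E\<^esub> z = b \<odot>\<^bsub>E\<^esub> x" by blast
  obtain u where u: "u \<in> S" "u \<otimes> (a \<otimes> t) = u \<otimes> (b \<otimes> s)" using bt c by (auto simp: frac_eq_iff)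
  have "(u \<otimes> (s \<otimes> t)) \<odot>\<^bsub>E\<^esub> z = (u \<otimes> s) \<odot>\<^bsub>E\<^esub> (t \<odot>\<^bsub>E\<^esub> z)"
    using u bt c z by (simp add: smult_assoc1[symmetric] R.m_ac)
  also have "\<dots> = (u \<otimes> (b \<otimes> s)) \<odot>\<^bsub>E\<^esub> x"
    unfolding tz using u(1) bt c by (simp add: smult_assoc1[symmetric] R.m_ac)
  also have "\<dots> = (u \<otimes> t) \<odot>\<^bsub>E\<^esub> (a \<odot>\<^bsub>E\<^esub> x)"
    unfolding u(2)[symmetric] using u(1) bt c by (simp add: smult_assoc1[symmetric] R.m_ac)
  also have "\<dots> = (u \<otimes> (s \<otimes> t)) \<odot>\<^bsub>E\<^esub> y"
    unfolding y[symmetric] using u(1) bt c by (simp add: smult_assoc1[symmetric] R.m_ac)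
  finally show "z = y" using S_inj[OF _ z c(4)] mult_S u(1) bt(2) c(2) by blast
qed

lemma loc_smult_props:
  assumes c: "a \<in> carrier R" "s \<in> S" "x \<in> carrier E"
  shows loc_smult_frac_closed: "loc_smult (frac a s) x \<in> carrier E"
    and smult_loc_smult: "s \<odot>\<^bsub>E\<^esub> loc_smult (frac a s) x = a \<odot>\<^bsub>E\<^esub> x"
proof -
  obtain y where "y \<in> carrier E" "s \<odot>\<^bsub>E\<^esub> y = a \<odot>\<^bsub>E\<^esub> x" using S_surj[OF c(2), of "a \<odot>\<^bsub>E\<^esub> x"] c by blast
  then show "loc_smult (frac a s) x \<in> carrier E" "s \<odot>\<^bsub>E\<^esub> loc_smult (frac a s) x = a \<odot>\<^bsub>E\<^esub> x"
    using loc_smult_eq[OF c] by simp_all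
qed

lemma loc_smult_loc: "a \<in> carrier R \<Longrightarrow> x \<in> carrier E \<Longrightarrow> loc_smult (loc a) x = a \<odot>\<^bsub>E\<^esub> x"
  unfolding loc_def using one_S by (intro loc_smult_eq) simp_all

definition E\<^sub>L :: "(('a \<times> 'a) set, 'e) module"
  where "E\<^sub>L = \<lparr>carrier = carrier E, monoid.mult = (\<otimes>\<^bsub>E\<^esub>), one = \<one>\<^bsub>E\<^esub>, ring.zero = \<zero>\<^bsub>E\<^esub>, add = (\<oplus>\<^bsub>E\<^esub>),
     smult = loc_smult\<rparr>"

lemma E\<^sub>L_simps [simp]:
  "carrier E\<^sub>L = carrier E" "\<zero>\<^bsub>E\<^sub>L\<^esub> = \<zero>\<^bsub>E\<^esub>" "x \<oplus>\<^bsub>E\<^sub>L\<^esub> y = x \<oplus>\<^bsub>E\<^esub> y" "P \<odot>\<^bsub>E\<^sub>L\<^esub> x = loc_smult P x"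
  by (simp_all add: E\<^sub>L_def)

lemma localized_module_module: "module L E\<^sub>L"
proof (rule moduleI)
  show "cring L" by (rule localization_cring)
  show "abelian_group E\<^sub>L"
    by (rule abelian_groupI)
      (auto simp: M.a_ac M.l_neg intro!: bexI[of _ "\<ominus>\<^bsub>E\<^esub> _"])
next
  fix P x assume "P \<in> carrier L" "x \<in> carrier E\<^sub>L"
  then show "P \<odot>\<^bsub>E\<^sub>L\<^esub> x \<in> carrier E\<^sub>L"
    by (auto simp: carrier_L loc_smult_frac_closed)
next
  fix P Q x assume "P \<in> carrier L" "Q \<in> carrier L" "x \<in> carrier E\<^sub>L"
  then obtain a s b t where *: "a \<in> carrier R" "s \<in> S" "b \<in> carrier R" "t \<in> S" "x \<in> carrier E"
    and eq: "P = frac a s" "Q = frac b t"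
    by (metis frac_cases E\<^sub>L_simps(1))
  define y where "y = loc_smult P x"
  define z where "z = loc_smult Q x"
  have y: "y \<in> carrier E" "s \<odot>\<^bsub>E\<^esub> y = a \<odot>\<^bsub>E\<^esub> x" unfolding y_def eq using * loc_smult_props by auto
  have z: "z \<in> carrier E" "t \<odot>\<^bsub>E\<^esub> z = b \<odot>\<^bsub>E\<^esub> x" unfolding z_def eq using * loc_smult_props by auto
  have "(s \<otimes> t) \<odot>\<^bsub>E\<^esub> (y \<oplus>\<^bsub>E\<^esub> z) = t \<odot>\<^bsub>E\<^esub> (s \<odot>\<^bsub>E\<^esub> y) \<oplus>\<^bsub>E\<^esub> s \<odot>\<^bsub>E\<^esub> (t \<odot>\<^bsub>E\<^esub> z)"
    using * y(1) z(1) by (simp add: smult_r_distr smult_assoc1[symmetric] R.m_ac)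
  also have "\<dots> = (a \<otimes> t \<oplus> b \<otimes> s) \<odot>\<^bsub>E\<^esub> x"
    unfolding y(2) z(2) using * by (simp add: smult_l_distr smult_assoc1[symmetric] R.m_ac)
  finally have "loc_smult (frac (a \<otimes> t \<oplus> b \<otimes> s) (s \<otimes> t)) x = y \<oplus>\<^bsub>E\<^esub> z"
    using * y z mult_S by (intro loc_smult_eq) simp_all
  then show "(P \<oplus>\<^bsub>L\<^esub> Q) \<odot>\<^bsub>E\<^sub>L\<^esub> x = P \<odot>\<^bsub>E\<^sub>L\<^esub> x \<oplus>\<^bsub>E\<^sub>L\<^esub> Q \<odot>\<^bsub>E\<^sub>L\<^esub> x"
    using * by (simp add: eq frac_add y_def z_def)
  define w where "w = loc_smult P z"
  have w: "w \<in> carrier E" "s \<odot>\<^bsub>E\<^esub> w = a \<odot>\<^bsub>E\<^esub> z" unfolding w_def eq using * z loc_smult_props by auto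
  have "(s \<otimes> t) \<odot>\<^bsub>E\<^esub> w = t \<odot>\<^bsub>E\<^esub> (s \<odot>\<^bsub>E\<^esub> w)"
    using * w(1) by (simp add: smult_assoc1[symmetric] R.m_ac)
  also have "\<dots> = a \<odot>\<^bsub>E\<^esub> (t \<odot>\<^bsub>E\<^esub> z)"
    unfolding w(2) using * z(1) by (simp add: smult_assoc1[symmetric] R.m_ac)
  also have "\<dots> = (a \<otimes> b) \<odot>\<^bsub>E\<^esub> x" unfolding z(2) using * by (simp add: smult_assoc1)
  finally have "loc_smult (frac (a \<otimes> b) (s \<otimes> t)) x = w"
    using * w mult_S by (intro loc_smult_eq) simp_all
  then show "(P \<otimes>\<^bsub>L\<^esub> Q) \<odot>\<^bsub>E\<^sub>L\<^esub> x = P \<odot>\<^bsub>E\<^sub>L\<^esub> (Q \<odot>\<^bsub>E\<^sub>L\<^esub> x)"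
    using * by (simp add: eq frac_mult w_def z_def)
next
  fix P x y assume "P \<in> carrier L" "x \<in> carrier E\<^sub>L" "y \<in> carrier E\<^sub>L"
  then obtain a s where *: "a \<in> carrier R" "s \<in> S" "x \<in> carrier E" "y \<in> carrier E" and eq: "P = frac a s"
    by (metis frac_cases E\<^sub>L_simps(1))
  have "loc_smult (frac a s) (x \<oplus>\<^bsub>E\<^esub> y) = loc_smult (frac a s) x \<oplus>\<^bsub>E\<^esub> loc_smult (frac a s) y"
    using * loc_smult_props by (intro loc_smult_eq) (simp_all add: smult_r_distr)
  then show "P \<odot>\<^bsub>E\<^sub>L\<^esub> (x \<oplus>\<^bsub>E\<^sub>L\<^esub> y) = P \<odot>\<^bsub>E\<^sub>L\<^esub> x \<oplus>\<^bsub>E\<^sub>L\<^esub> P \<odot>\<^bsub>E\<^sub>L\<^esub> y" by (simp add: eq)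
next
  fix x assume "x \<in> carrier E\<^sub>L"
  then show "\<one>\<^bsub>L\<^esub> \<odot>\<^bsub>E\<^sub>L\<^esub> x = x" using loc_smult_loc[of \<one> x] by (simp add: one_L loc_def)
qed

text \<open>
  Linearity over \<open>R\<close> is enough: \<open>s h((a/s) x) = a h(x)\<close>, and \<open>s\<close> can be cancelled in \<open>E\<close>.
\<close>

lemma hom_is_L_linear:
  assumes N: "module L N" and h: "h \<in> module_homs R (restrict_scalars N) E"
  shows "h \<in> module_homs L N E\<^sub>L"
proof -
  interpret N: module L N by (rule N)
  have hc: "h x \<in> carrier E" if "x \<in> carrier N" for x
    using module_homs_closed[OF h, of x] that by (simp add: restrict_scalars_def)
  have hs: "h (loc r \<odot>\<^bsub>N\<^esub> x) = r \<odot>\<^bsub>E\<^esub> h x" if "r \<in> carrier R" "x \<in> carrier N" for r x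
    using module_homs_smult[OF h that(1), of x] that by (simp add: restrict_scalars_def)
  have "h (P \<odot>\<^bsub>N\<^esub> x) = loc_smult P (h x)" if P: "P \<in> carrier L" and x: "x \<in> carrier N" for P x
  proof -
    obtain a s where as: "a \<in> carrier R" "s \<in> S" "P = frac a s" using frac_cases[OF P] .
    have "s \<odot>\<^bsub>E\<^esub> h (P \<odot>\<^bsub>N\<^esub> x) = h (loc s \<odot>\<^bsub>N\<^esub> (P \<odot>\<^bsub>N\<^esub> x))" using hs as P x by simp
    also have "loc s \<odot>\<^bsub>N\<^esub> (P \<odot>\<^bsub>N\<^esub> x) = loc a \<odot>\<^bsub>N\<^esub> x"
      using as P x loc_numerator[OF as(1,2)] by (simp add: N.smult_assoc1[symmetric])
    also have "h (loc a \<odot>\<^bsub>N\<^esub> x) = a \<odot>\<^bsub>E\<^esub> h x" using hs as x by simp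
    finally show ?thesis using loc_smult_eq[of a s "h x" "h (P \<odot>\<^bsub>N\<^esub> x)"] as hc x P by simp
  qed
  then show ?thesis
    using hc module_homs_add[OF h] by (auto simp: module_homs_def restrict_scalars_def)
qed

lemma localized_module_injective:
  assumes inj: "injective_module R E"
  shows "injective_module L E\<^sub>L"
  unfolding injective_module_def
proof (intro conjI allI impI localized_module_module)
  fix M N :: "(('a \<times> 'a) set, ('a \<times> 'a) set) module" and f g
  assume "module L M \<and> module L N \<and> f \<in> module_homs L M N \<and> inj_on f (carrier M) \<and> g \<in> module_homs L M E\<^sub>L"
  then have M: "module L M" and N: "module L N" and f: "f \<in> module_homs L M N" "inj_on f (carrier M)"
    and g: "g \<in> module_homs L M E\<^sub>L" by auto
  have g': "g \<in> module_homs R (restrict_scalars M) E"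
    using g by (auto simp: module_homs_def restrict_scalars_def loc_smult_loc Pi_iff)
  have f': "inj_on f (carrier (restrict_scalars M))" using f(2) by (simp add: restrict_scalars_def)
  obtain h where h: "h \<in> module_homs R (restrict_scalars N) E"
    "\<forall>x \<in> carrier (restrict_scalars M). h (f x) = g x"
    using injective_module_extend[OF inj restrict_scalars_module[OF M] restrict_scalars_module[OF N]
        restrict_scalars_hom[OF f(1)] f' g'] by auto
  then show "\<exists>h \<in> module_homs L N E\<^sub>L. \<forall>x \<in> carrier M. h (f x) = g x"
    using hom_is_L_linear[OF N h(1)] by (intro bexI[of _ h]) (simp_all add: restrict_scalars_def)
qed

lemma L_submodule_imp_submodule:
  assumes V: "submodule V L E\<^sub>L"
  shows "submodule V R E"
proof -
  interpret EL: module L E\<^sub>L by (rule localized_module_module)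
  note VE = EL.submoduleE[OF V]
  have sm: "a \<odot>\<^bsub>E\<^esub> x \<in> V" if "a \<in> carrier R" "x \<in> V" for a x
    using VE(4)[of "loc a" x] VE(1) that loc_smult_loc[of a x] by (simp add: subset_iff)
  show ?thesis
  proof (rule submoduleI)
    show "V \<subseteq> carrier E" using VE(1) by simp
    show "\<zero>\<^bsub>E\<^esub> \<in> V" using EL.submodule_zero[OF V] by simp
    show "\<ominus>\<^bsub>E\<^esub> x \<in> V" if "x \<in> V" for x
      using sm[of "\<ominus> \<one>" x] that VE(1) by (simp add: smult_l_minus subset_iff)
    show "x \<oplus>\<^bsub>E\<^esub> y \<in> V" if "x \<in> V" "y \<in> V" for x y using VE(5) that by simp
  qed (rule sm)
qed

lemma submodule_imp_L_submodule:
  assumes V: "submodule V R E" and closed: "\<And>s x. s \<in> S \<Longrightarrow> x \<in> carrier E \<Longrightarrow> s \<odot>\<^bsub>E\<^esub> x \<in> V \<Longrightarrow> x \<in> V"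
  shows "submodule V L E\<^sub>L"
proof -
  interpret EL: module L E\<^sub>L by (rule localized_module_module)
  note VE = submoduleE[OF V]
  have sm: "loc_smult P x \<in> V" if P: "P \<in> carrier L" and x: "x \<in> V" for P x
  proof -
    obtain a s where as: "a \<in> carrier R" "s \<in> S" "P = frac a s" using frac_cases[OF P] .
    have xc: "x \<in> carrier E" using x VE(1) by blast
    show ?thesis
      using closed[OF as(2) loc_smult_frac_closed[OF as(1,2) xc]]
        smult_loc_smult[OF as(1,2) xc] VE(4)[OF as(1) x] as(3) by simp
  qed
  show ?thesis
  proof (rule EL.submoduleI)
    show "V \<subseteq> carrier E\<^sub>L" using VE(1) by simp
    show "\<zero>\<^bsub>E\<^sub>L\<^esub> \<in> V" using submodule_zero[OF V] by simp
    show "\<ominus>\<^bsub>E\<^sub>L\<^esub> x \<in> V" if x: "x \<in> V" for x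
    proof -
      have "\<ominus>\<^bsub>E\<^sub>L\<^esub> x = (\<ominus>\<^bsub>L\<^esub> \<one>\<^bsub>L\<^esub>) \<odot>\<^bsub>E\<^sub>L\<^esub> x" 
        using x VE(1) EL.smult_l_minus[of "\<one>\<^bsub>L\<^esub>" x] EL.smult_one[of x] by auto
      moreover have "\<ominus>\<^bsub>L\<^esub> \<one>\<^bsub>L\<^esub> \<in> carrier L" by (intro EL.R.a_inv_closed EL.R.one_closed)
      ultimately show ?thesis using sm[of "\<ominus>\<^bsub>L\<^esub> \<one>\<^bsub>L\<^esub>" x] x by simp
    qed
    show "x \<oplus>\<^bsub>E\<^sub>L\<^esub> y \<in> V" if "x \<in> V" "y \<in> V" for x y using VE(5) that by simp
    show "P \<odot>\<^bsub>E\<^sub>L\<^esub> x \<in> V" if "P \<in> carrier L" "x \<in> V" for P x using sm that by simp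
  qed
qed

lemma simple_divisible_localized:
  assumes div: "divisible_module L E\<^sub>L" and E: "simple_divisible R E"
  shows "simple_divisible L E\<^sub>L"
  unfolding simple_divisible_def
proof (intro conjI allI impI div)
  show "carrier E\<^sub>L \<noteq> {\<zero>\<^bsub>E\<^sub>L\<^esub>}" using E by (simp add: simple_divisible_def)
  fix V assume V: "submodule V L E\<^sub>L \<and> V \<noteq> {\<zero>\<^bsub>E\<^sub>L\<^esub>} \<and> V \<subset> carrier E\<^sub>L"
  then have VR: "submodule V R E" using L_submodule_imp_submodule by blast
  show "\<not> divisible_module L (E\<^sub>L\<lparr>carrier := V\<rparr>)"
  proof
    assume d: "divisible_module L (E\<^sub>L\<lparr>carrier := V\<rparr>)"
    have "(\<lambda>x. r \<odot>\<^bsub>E\<^esub> x) ` V = V" if r: "non_zero_divisor R r" for r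
    proof -
      have "(\<lambda>x. loc_smult (loc r) x) ` V = V"
        using d non_zero_divisor_loc[OF r] by (simp add: divisible_module_def)
      moreover have "(\<lambda>x. loc_smult (loc r) x) ` V = (\<lambda>x. r \<odot>\<^bsub>E\<^esub> x) ` V"
      proof (rule image_cong[OF refl])
        fix x assume "x \<in> V"
        then have "x \<in> carrier E" using submoduleE(1)[OF VR] by blast
        then show "loc_smult (loc r) x = r \<odot>\<^bsub>E\<^esub> x"
          using loc_smult_loc r by (simp add: non_zero_divisor_def)
      qed
      ultimately show ?thesis by simp
    qed
    then have "divisible_module R (E\<lparr>carrier := V\<rparr>)" by (simp add: divisible_module_def)
    then show False using E V VR unfolding simple_divisible_def by simp
  qed
qed

text \<open>
  Injectivity of \<open>R \<rightarrow> L\<close> makes every \<open>s \<in> S\<close> a non-zero-divisor, so a divisible \<open>V\<close> satisfies \<open>sV = V\<close> and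
  is closed under division by \<open>s\<close>.
\<close>

lemma simple_divisible_of_localized:
  assumes inj: "inj_on loc (carrier R)" and E: "simple_divisible L E\<^sub>L"
  shows "simple_divisible R E"
  unfolding simple_divisible_def
proof (intro conjI allI impI)
  show "divisible_module R E"
    unfolding divisible_module_def
  proof (intro allI impI)
    fix r assume r: "non_zero_divisor R r"
    have "(\<lambda>x. loc_smult (loc r) x) ` carrier E = carrier E"
      using E non_zero_divisor_loc[OF r] by (simp add: simple_divisible_def divisible_module_def)
    moreover have "(\<lambda>x. loc_smult (loc r) x) ` carrier E = (\<lambda>x. r \<odot>\<^bsub>E\<^esub> x) ` carrier E"
      using loc_smult_loc r by (intro image_cong) (simp_all add: non_zero_divisor_def)
    ultimately show "(\<lambda>x. r \<odot>\<^bsub>E\<^esub> x) ` carrier E = carrier E" by simp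
  qed
  show "carrier E \<noteq> {\<zero>\<^bsub>E\<^esub>}" using E by (simp add: simple_divisible_def)
  fix V assume V: "submodule V R E \<and> V \<noteq> {\<zero>\<^bsub>E\<^esub>} \<and> V \<subset> carrier E"
  then have VR: "submodule V R E" by blast
  show "\<not> divisible_module R (E\<lparr>carrier := V\<rparr>)"
  proof
    assume "divisible_module R (E\<lparr>carrier := V\<rparr>)"
    then have d: "(\<lambda>x. r \<odot>\<^bsub>E\<^esub> x) ` V = V" if "non_zero_divisor R r" for r
      using that by (simp add: divisible_module_def)
    have Vc: "x \<in> carrier E" if "x \<in> V" for x using submoduleE(1)[OF VR] that by blast
    have VL: "submodule V L E\<^sub>L"
    proof (rule submodule_imp_L_submodule[OF VR])
      fix s x assume s: "s \<in> S" and x: "x \<in> carrier E" and "s \<odot>\<^bsub>E\<^esub> x \<in> V"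
      then have "s \<odot>\<^bsub>E\<^esub> x \<in> (\<lambda>x. s \<odot>\<^bsub>E\<^esub> x) ` V"
        using d[OF non_zero_divisor_denominator[OF inj s]] by simp
      then obtain y where "y \<in> V" "s \<odot>\<^bsub>E\<^esub> x = s \<odot>\<^bsub>E\<^esub> y" by (rule imageE)
      then show "x \<in> V" using S_inj[OF s x] Vc by metis
    qed
    have "(\<lambda>x. P \<odot>\<^bsub>E\<^sub>L\<^esub> x) ` V = V" if P: "non_zero_divisor L P" for P
    proof
      have Pc: "P \<in> carrier L" using P by (simp add: non_zero_divisor_def)
      show "(\<lambda>x. P \<odot>\<^bsub>E\<^sub>L\<^esub> x) ` V \<subseteq> V"
        using module.submoduleE(4)[OF localized_module_module VL Pc] by blast
      obtain a s where as: "a \<in> carrier R" "s \<in> S" "P = frac a s" using frac_cases[OF Pc] .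
      have a: "non_zero_divisor R a" using non_zero_divisor_numerator[OF inj as(1,2)] P as(3) by simp
      show "V \<subseteq> (\<lambda>x. P \<odot>\<^bsub>E\<^sub>L\<^esub> x) ` V"
      proof
        fix v assume v: "v \<in> V"
        have "s \<odot>\<^bsub>E\<^esub> v \<in> (\<lambda>x. a \<odot>\<^bsub>E\<^esub> x) ` V"
          using d[OF a] submoduleE(4)[OF VR S_closed[OF as(2)] v] by simp
        then obtain w where w: "w \<in> V" "s \<odot>\<^bsub>E\<^esub> v = a \<odot>\<^bsub>E\<^esub> w" by auto
        then have "P \<odot>\<^bsub>E\<^sub>L\<^esub> w = v" using loc_smult_eq[OF as(1,2) Vc[OF w(1)] Vc[OF v]] as(3) by simp
        then show "v \<in> (\<lambda>x. P \<odot>\<^bsub>E\<^sub>L\<^esub> x) ` V" using w by blast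
      qed
    qed
    then have "divisible_module L (E\<^sub>L\<lparr>carrier := V\<rparr>)" by (simp add: divisible_module_def)
    then show False using E V VL unfolding simple_divisible_def by simp
  qed
qed

end

section \<open>Injective hulls of residue domains\<close>

text \<open>Extending \<open>s x \<mapsto> x\<close> along the injection \<open>s\<close> gives an inverse of \<open>s\<close>.\<close>

lemma injective_surjective_smult:
  assumes inj: "injective_module R E" and s: "s \<in> carrier R" and "inj_on (\<lambda>x. s \<odot>\<^bsub>E\<^esub> x) (carrier E)"
    and x: "x \<in> carrier E"
  shows "\<exists>y \<in> carrier E. s \<odot>\<^bsub>E\<^esub> y = x"
proof -
  interpret E: module R E using inj by (simp add: injective_module_def)
  have "id \<in> module_homs R E E" by (auto simp: module_homs_def)
  from injective_module_extend[OF inj E.module_axioms E.module_axioms E.smult_hom[OF s] assms(3) this]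
  obtain h where h: "h \<in> module_homs R E E" "\<And>x. x \<in> carrier E \<Longrightarrow> h (s \<odot>\<^bsub>E\<^esub> x) = x" by auto
  then have "s \<odot>\<^bsub>E\<^esub> h x = x" using module_homs_smult[OF h(1) s x] x by simp
  then show ?thesis using module_homs_closed[OF h(1) x] by blast
qed

text \<open>The element \<open>e\<close> is the image of \<open>1\<close> under the embedding of \<open>R/q\<close>.\<close>

lemma injective_hull_generator:
  assumes q: "primeideal q R" and hull: "injective_hull R (quotient_module R q) E"
  obtains e where "e \<in> carrier E" "\<And>r. r \<in> carrier R \<Longrightarrow> r \<odot>\<^bsub>E\<^esub> e = \<zero>\<^bsub>E\<^esub> \<longleftrightarrow> r \<in> q"
    "\<And>V. submodule V R E \<Longrightarrow> V \<noteq> {\<zero>\<^bsub>E\<^esub>} \<Longrightarrow> \<exists>r \<in> carrier R - q. r \<odot>\<^bsub>E\<^esub> e \<in> V"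
proof -
  interpret q: primeideal q R by (rule q)
  let ?Q = "quotient_module R q"
  obtain i where i: "i \<in> module_homs R ?Q E" "inj_on i (carrier ?Q)"
    "essential_submodule (i ` carrier ?Q) R E" and inj: "injective_module R E"
    using hull unfolding injective_hull_def by blast
  interpret E: module R E using inj by (simp add: injective_module_def)
  have car: "C \<in> carrier ?Q \<longleftrightarrow> (\<exists>r \<in> carrier R. C = q +>\<^bsub>R\<^esub> r)" for C
    by (auto simp: quotient_module_def ring.defs module.defs FactRing_def A_RCOSETS_def')
  have sm: "r \<odot>\<^bsub>?Q\<^esub> C = (q +>\<^bsub>R\<^esub> r) \<otimes>\<^bsub>R Quot q\<^esub> C" for r C
    by (simp add: quotient_module_def ring.defs module.defs)
  define e where "e = i (q +>\<^bsub>R\<^esub> \<one>\<^bsub>R\<^esub>)"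
  have ec: "e \<in> carrier E" unfolding e_def using module_homs_closed[OF i(1)] car by blast
  have i_eq: "i (q +>\<^bsub>R\<^esub> r) = r \<odot>\<^bsub>E\<^esub> e" if r: "r \<in> carrier R" for r
  proof -
    have "r \<odot>\<^bsub>?Q\<^esub> (q +>\<^bsub>R\<^esub> \<one>\<^bsub>R\<^esub>) = q +>\<^bsub>R\<^esub> r"
      unfolding sm using q.quotient_mult[OF q.ideal_axioms r q.one_closed] r by simp
    moreover have "q +>\<^bsub>R\<^esub> \<one>\<^bsub>R\<^esub> \<in> carrier ?Q" using car by blast
    ultimately show ?thesis unfolding e_def using module_homs_smult[OF i(1) r] by metis
  qed
  have kill: "r \<odot>\<^bsub>E\<^esub> e = \<zero>\<^bsub>E\<^esub> \<longleftrightarrow> r \<in> q" if r: "r \<in> carrier R" for r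
  proof -
    have "r \<odot>\<^bsub>E\<^esub> e = \<zero>\<^bsub>E\<^esub> \<longleftrightarrow> i (q +>\<^bsub>R\<^esub> r) = i (q +>\<^bsub>R\<^esub> \<zero>\<^bsub>R\<^esub>)"
      using i_eq[OF r] i_eq[OF q.zero_closed] ec by simp
    also have "\<dots> \<longleftrightarrow> q +>\<^bsub>R\<^esub> r = q +>\<^bsub>R\<^esub> \<zero>\<^bsub>R\<^esub>"
      using i(2) car r by (intro inj_on_eq_iff) auto
    also have "\<dots> \<longleftrightarrow> r \<ominus>\<^bsub>R\<^esub> \<zero>\<^bsub>R\<^esub> \<in> q"
      using q.quotient_eq_iff_same_a_r_cos[OF q.ideal_axioms r q.zero_closed] by simp
    finally show ?thesis using r by (simp add: a_minus_def)
  qed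
  have "\<exists>r \<in> carrier R - q. r \<odot>\<^bsub>E\<^esub> e \<in> V" if V: "submodule V R E" "V \<noteq> {\<zero>\<^bsub>E\<^esub>}" for V
  proof -
    have "i ` carrier ?Q \<inter> V \<noteq> {\<zero>\<^bsub>E\<^esub>}" and sub: "submodule (i ` carrier ?Q) R E"
      using i(3) V unfolding essential_submodule_def by auto
    moreover have "\<zero>\<^bsub>E\<^esub> \<in> i ` carrier ?Q \<inter> V"
      using E.submodule_zero[OF sub] E.submodule_zero[OF V(1)] by blast
    ultimately obtain y where y: "y \<in> i ` carrier ?Q" "y \<in> V" "y \<noteq> \<zero>\<^bsub>E\<^esub>" by auto
    then obtain r where "r \<in> carrier R" "y = r \<odot>\<^bsub>E\<^esub> e" using car i_eq by auto
    then show ?thesis using y kill by auto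
  qed
  with ec kill show ?thesis by (rule that)
qed

theorem mainTheorem2:
  fixes R :: "('a, 'r) ring_scheme" and q :: "'a set" and E :: "('a, 'e, 'x) module_scheme"
  assumes "cring R" and "noetherian_ring R" and "local_ring R"
    and "primeideal q R"
    and "injective_hull R (quotient_module R q) E"
  shows "(simple_divisible R E \<longrightarrow>
            analytically_irreducible (localization_at R q) \<and> essentially_complete (localization_at R q))
       \<and> (inj_on (localization_map R q) (carrier R) \<longrightarrow>
            analytically_irreducible (localization_at R q) \<and> essentially_complete (localization_at R q) \<longrightarrow>
            simple_divisible R E)"
proof -
  interpret q: primeideal q R by fact
  have inj: "injective_module R E" using assms(5) by (simp add: injective_hull_def)
  interpret E: module R E using inj by (simp add: injective_module_def)
  obtain e where e: "e \<in> carrier E" and kill: "\<And>r. r \<in> carrier R \<Longrightarrow> r \<odot>\<^bsub>E\<^esub> e = \<zero>\<^bsub>E\<^esub> \<longleftrightarrow> r \<in> q"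
    and ess: "\<And>V. submodule V R E \<Longrightarrow> V \<noteq> {\<zero>\<^bsub>E\<^esub>} \<Longrightarrow> \<exists>r \<in> carrier R - q. r \<odot>\<^bsub>E\<^esub> e \<in> V"
    using injective_hull_generator[OF assms(4,5)] by blast
  have one_q: "\<one>\<^bsub>R\<^esub> \<notin> q" using q.one_imp_carrier q.I_notcarr by auto
  define S where "S = carrier R - q"
  \<comment> \<open>The kernel of \<open>s\<close> meets \<open>R/q\<close> trivially because \<open>q\<close> is prime, so it vanishes by essentiality.\<close>
  have S_inj: "x = y" if s: "s \<in> S" and xy: "x \<in> carrier E" "y \<in> carrier E"
    and eq: "s \<odot>\<^bsub>E\<^esub> x = s \<odot>\<^bsub>E\<^esub> y" for s x y
  proof -
    have sc: "s \<in> carrier R" "s \<notin> q" using s by (simp_all add: S_def)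
    let ?K = "{x \<in> carrier E. s \<odot>\<^bsub>E\<^esub> x = \<zero>\<^bsub>E\<^esub>}"
    have K: "submodule ?K R E"
      by (rule E.hom_kernel_submodule[OF E.module_axioms E.smult_hom[OF sc(1)] E.carrier_is_submodule])
    have "?K = {\<zero>\<^bsub>E\<^esub>}"
    proof (rule ccontr)
      assume "?K \<noteq> {\<zero>\<^bsub>E\<^esub>}"
      then obtain r where r: "r \<in> carrier R" "r \<notin> q" "s \<odot>\<^bsub>E\<^esub> (r \<odot>\<^bsub>E\<^esub> e) = \<zero>\<^bsub>E\<^esub>"
        using ess[OF K] by blast
      then have "s \<otimes>\<^bsub>R\<^esub> r \<in> q" using kill[of "s \<otimes>\<^bsub>R\<^esub> r"] sc e by (simp add: E.smult_assoc1)
      then show False using q.I_prime[OF sc(1) r(1)] sc r by blast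
    qed
    moreover have "x \<ominus>\<^bsub>E\<^esub> y \<in> ?K" using xy eq sc by (simp add: E.smult_minus_distr E.diff_zero_iff)
    ultimately have "x \<ominus>\<^bsub>E\<^esub> y = \<zero>\<^bsub>E\<^esub>" by blast
    then show ?thesis using xy by (simp add: E.diff_zero_iff)
  qed
  interpret loc: localized_module R E S
  proof unfold_locales
    show "S \<subseteq> carrier R" by (auto simp: S_def)
    show "\<one>\<^bsub>R\<^esub> \<in> S" using one_q by (simp add: S_def)
    show "s \<otimes>\<^bsub>R\<^esub> t \<in> S" if "s \<in> S" "t \<in> S" for s t
      using that q.I_prime[of s t] by (auto simp: S_def)
    show "x = y" if "s \<in> S" "x \<in> carrier E" "y \<in> carrier E" "s \<odot>\<^bsub>E\<^esub> x = s \<odot>\<^bsub>E\<^esub> y" for s x y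
      using S_inj that by blast
    show "\<exists>y \<in> carrier E. s \<odot>\<^bsub>E\<^esub> y = x" if s: "s \<in> S" and x: "x \<in> carrier E" for s x
      using s S_inj by (intro injective_surjective_smult[OF inj _ _ x] inj_onI) (auto simp: S_def)
  qed
  interpret EL: module loc.L loc.E\<^sub>L by (rule loc.localized_module_module)
  interpret NL: noetherian_ring loc.L by (rule loc.localization_noetherian[OF assms(2)])
  \<comment> \<open>Since \<open>a/s\<close> kills \<open>e\<close> exactly when \<open>a \<in> q\<close>, this is the maximal ideal of \<open>R\<^sub>q\<close>.\<close>
  define \<mm> where "\<mm> = EL.ann e"
  interpret H: residue_hull loc.L loc.E\<^sub>L \<mm> e
  proof (intro residue_hull.intro residue_hull_axioms.intro EL.module_axioms NL.noetherian_ring_axioms)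
    show "injective_module loc.L loc.E\<^sub>L" by (rule loc.localized_module_injective[OF inj])
    show "ideal \<mm> loc.L" unfolding \<mm>_def using e by (intro EL.ann_ideal) simp
    show nz: "e \<noteq> \<zero>\<^bsub>loc.E\<^sub>L\<^esub>" using kill[OF q.one_closed] one_q e by simp
    show "\<one>\<^bsub>loc.L\<^esub> \<notin> \<mm>" unfolding \<mm>_def EL.ann_def using EL.smult_one[of e] e nz by simp
    show "e \<in> carrier loc.E\<^sub>L" using e by simp
    show "P \<odot>\<^bsub>loc.E\<^sub>L\<^esub> e = \<zero>\<^bsub>loc.E\<^sub>L\<^esub>" if "P \<in> \<mm>" for P using that by (simp add: \<mm>_def EL.ann_def)
    show "P \<in> Units loc.L" if P: "P \<in> carrier loc.L" "P \<notin> \<mm>" for P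
    proof -
      obtain a s where as: "a \<in> carrier R" "s \<in> S" "P = loc.frac a s" using loc.frac_cases[OF P(1)] .
      have "a \<notin> q"
      proof
        assume "a \<in> q"
        then have "loc.loc_smult P e = \<zero>\<^bsub>E\<^esub>"
          unfolding as(3) using as e kill[OF as(1)] by (intro loc.loc_smult_eq) simp_all
        then show False using P by (simp add: \<mm>_def EL.ann_def)
      qed
      then show ?thesis using loc.frac_unit[of a s] as by (simp add: S_def)
    qed
    show "e \<in> V" if V: "submodule V loc.L loc.E\<^sub>L" "V \<noteq> {\<zero>\<^bsub>loc.E\<^sub>L\<^esub>}" for V
    proof -
      obtain r where r: "r \<in> carrier R" "r \<notin> q" "r \<odot>\<^bsub>E\<^esub> e \<in> V"
        using ess[OF loc.L_submodule_imp_submodule[OF V(1)]] V(2) by auto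
      then have rS: "r \<in> S" by (simp add: S_def)
      have "loc.loc_smult (loc.frac \<one>\<^bsub>R\<^esub> r) (r \<odot>\<^bsub>E\<^esub> e) = e"
        using r rS e by (intro loc.loc_smult_eq) simp_all
      moreover have "loc.frac \<one>\<^bsub>R\<^esub> r \<odot>\<^bsub>loc.E\<^sub>L\<^esub> (r \<odot>\<^bsub>E\<^esub> e) \<in> V"
        using rS r by (intro EL.submoduleE(4)[OF V(1)]) simp_all
      ultimately show ?thesis by simp
    qed
  qed
  have L: "localization_at R q = loc.L" by (simp add: localization_at_def S_def)
  have map: "localization_map R q = loc.loc"
    unfolding localization_map_def loc.loc_def S_def[symmetric] ..
  show ?thesis
    unfolding L map
    using H.simple_divisible_iff loc.simple_divisible_localized[OF H.divisible]
      loc.simple_divisible_of_localized by blast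
qed

end
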